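(* The Markov chain $(d,d^* )$ on $X_0\cup X_1$ can be represented as a random walk on the weighted bipartite graph with vertex set $X_0\cup X_1$, whose edges between $G\in X_0$ and $H\in X_1$ are the (isomorphism classes of) exact sequences $$0\to\mathbb{Z}_p\to H\to G\to 0,$$ each such edge having weight $$\frac{1}{|\mathrm{Aut}(\mathbb{Z}_p\to H)|\,|G|}.$$ That is, from each vertex the probability of moving to a neighbouring vertex is the total weight of the edges joining the two vertices divided by the total weight of all edges at the starting vertex.
   Context: Fix a prime $p$. $X_0$ is the set of isomorphism classes of finite abelian $p$-groups; $X_1$ is the set of isomorphism classes of finitely generated $\mathbb{Z}_p$-modules of $\mathbb{Q}_p$-rank $1$. The random operator $d$ from $X_1$ to $X_0$: $d(H)$ is the quotient of $H$ by (the submodule generated by) a Haar-random element of $H$ (almost surely finite). The random operator $d^*$ from $X_0$ to $X_1$: $d^*(G)$ is the middle term of the extension $0\to\mathbb{Z}_p\to H\to G\to 0$ corresponding to a uniformly random element of the finite group $\mathrm{Ext}(G,\mathbb{Z}_p)$. The Markov chain $(d,d^* )$ has state space $X_0\cup X_1$, transition probabilities $\mathbb{P}(G\to H)=\mathbb{P}(d^*(G)\cong H)$ and $\mathbb{P}(H\to G)=\mathbb{P}(d(H)\cong G)$ for $G\in X_0$, $H\in X_1$, and all other transition probabilities $0$. Isomorphisms of exact sequences are commuting isomorphisms that are the identity on $\mathbb{Z}_p$ (and arbitrary isomorphisms on $H$ and $G$). $\mathrm{Aut}(\mathbb{Z}_p\to H)$ is the (finite) group of automorphisms of $H$ that preserve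 the given homomorphism $\mathbb{Z}_p\to H$. *)

theory Defs
  imports "HOL-Probability.Probability" "HOL-Computational_Algebra.Primes"
    "HOL-Algebra.Coset" "HOL-Algebra.Module"
begin

section \<open>The ring of p-adic integers\<close>

text \<open>The inverse limit of the rings of integers modulo \<open>p ^ n\<close>: \<open>x n\<close> is the residue of \<open>x\<close>
  modulo \<open>p ^ n\<close>, taken in \<open>{0..<p ^ n}\<close>. The record carries a scalar multiplication, so that the
  same object serves as the ring and as the free module of rank one over it.\<close>

type_synonym padic = "nat \<Rightarrow> int"

definition Zp :: "nat \<Rightarrow> (padic, padic) module" where
  "Zp p = \<lparr>carrier = {x. \<forall>n. 0 \<le> x n \<and> x n < int p ^ n \<and> x (Suc n) mod int p ^ n = x n},
           mult = (\<lambda>x y n. (x n * y n) mod int p ^ n),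
           one = (\<lambda>n. 1 mod int p ^ n),
           zero = (\<lambda>n. 0),
           add = (\<lambda>x y n. (x n + y n) mod int p ^ n),
           smult = (\<lambda>x y n. (x n * y n) mod int p ^ n)\<rparr>"


section \<open>Linear maps, spans and rank\<close>

definition lin_hom ::
  "('r, 'q) ring_scheme \<Rightarrow> ('r, 'a, 'm) module_scheme \<Rightarrow> ('r, 'b, 'n) module_scheme \<Rightarrow> ('a \<Rightarrow> 'b) set"
  where
  "lin_hom R M N = {f \<in> hom (add_monoid M) (add_monoid N).
     \<forall>a\<in>carrier R. \<forall>x\<in>carrier M. f (a \<odot>\<^bsub>M\<^esub> x) = a \<odot>\<^bsub>N\<^esub> f x}"

definition lin_iso ::
  "('r, 'q) ring_scheme \<Rightarrow> ('r, 'a, 'm) module_scheme \<Rightarrow> ('r, 'b, 'n) module_scheme \<Rightarrow> ('a \<Rightarrow> 'b) set"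
  where
  "lin_iso R M N = {f \<in> lin_hom R M N. bij_betw f (carrier M) (carrier N)}"

definition gen_submodule ::
  "('r, 'q) ring_scheme \<Rightarrow> ('r, 'a, 'm) module_scheme \<Rightarrow> 'a set \<Rightarrow> 'a set" where
  "gen_submodule R M S = \<Inter> {N. submodule N R M \<and> S \<subseteq> N}"

definition fin_gen ::
  "('r, 'q) ring_scheme \<Rightarrow> ('r, 'a, 'm) module_scheme \<Rightarrow> bool" where
  "fin_gen R M \<longleftrightarrow> (\<exists>S. finite S \<and> S \<subseteq> carrier M \<and> gen_submodule R M S = carrier M)"

definition lin_indep ::
  "('r, 'q) ring_scheme \<Rightarrow> ('r, 'a, 'm) module_scheme \<Rightarrow> 'a set \<Rightarrow> bool" where
  "lin_indep R M S \<longleftrightarrow> finite S \<and> S \<subseteq> carrier M \<and>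
     (\<forall>a \<in> S \<rightarrow> carrier R.
        (\<Oplus>\<^bsub>M\<^esub>s\<in>S. a s \<odot>\<^bsub>M\<^esub> s) = \<zero>\<^bsub>M\<^esub> \<longrightarrow> (\<forall>s\<in>S. a s = \<zero>\<^bsub>R\<^esub>))"

text \<open>The rank of a finitely generated module over a domain, i.e. the dimension of its scalar
  extension to the fraction field. \<open>Max\<close> is meaningful only for modules of finite rank.\<close>

definition module_rank ::
  "('r, 'q) ring_scheme \<Rightarrow> ('r, 'a, 'm) module_scheme \<Rightarrow> nat" where
  "module_rank R M = Max {card S | S. lin_indep R M S}"


section \<open>The two sets of isomorphism classes\<close>

text \<open>All groups and modules have their elements in one fixed type. It has the cardinality of the
  continuum, so every finite group and every finitely generated module over the p-adic integers has
  an isomorphic copy in it.\<close>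

type_synonym univ = "nat \<Rightarrow> int"
type_synonym grp = "univ monoid"
type_synonym zmod = "(padic, univ) module"

text \<open>Finite abelian p-groups are written multiplicatively, as in HOL-Algebra.\<close>

definition pgroups :: "nat \<Rightarrow> grp set" where
  "pgroups p = {G. comm_group G \<and> finite (carrier G) \<and> (\<exists>n. order G = p ^ n)}"

definition rank1_modules :: "nat \<Rightarrow> zmod set" where
  "rank1_modules p = {H. Module.module (Zp p) H \<and> fin_gen (Zp p) H \<and> module_rank (Zp p) H = 1}"

definition grp_iso_rel :: "nat \<Rightarrow> (grp \<times> grp) set" where
  "grp_iso_rel p = {(G, G'). G \<in> pgroups p \<and> G' \<in> pgroups p \<and> G \<cong> G'}"

definition zmod_isomorphic :: "nat \<Rightarrow> zmod \<Rightarrow> zmod \<Rightarrow> bool" where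
  "zmod_isomorphic p H H' \<longleftrightarrow> lin_iso (Zp p) H H' \<noteq> {}"

definition zmod_iso_rel :: "nat \<Rightarrow> (zmod \<times> zmod) set" where
  "zmod_iso_rel p =
     {(H, H'). H \<in> rank1_modules p \<and> H' \<in> rank1_modules p \<and> zmod_isomorphic p H H'}"

definition X0 :: "nat \<Rightarrow> grp set set" where
  "X0 p = pgroups p // grp_iso_rel p"

definition X1 :: "nat \<Rightarrow> zmod set set" where
  "X1 p = rank1_modules p // zmod_iso_rel p"

text \<open>A representative of a class; everything below depends on it only up to isomorphism.\<close>

definition rep :: "'a set \<Rightarrow> 'a" where
  "rep c = (SOME x. x \<in> c)"


section \<open>Exact sequences\<close>

text \<open>The module structure that a finite abelian p-group \<open>G\<close> carries over the p-adic integers: if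
  \<open>G\<close> has order \<open>p ^ n\<close>, a p-adic integer acts through its residue modulo \<open>p ^ n\<close>.
  The fields \<open>mult\<close> and \<open>one\<close> of a module record are irrelevant.\<close>

definition pgroup_module :: "nat \<Rightarrow> grp \<Rightarrow> zmod" where
  "pgroup_module p G = \<lparr>carrier = carrier G, mult = mult G, one = one G, zero = one G, add = mult G,
     smult = (\<lambda>a g. g [^]\<^bsub>G\<^esub> a (multiplicity p (order G)))\<rparr>"

record exseq =
  middle :: zmod
  incl :: "padic \<Rightarrow> univ"
  quot :: grp
  proj :: "univ \<Rightarrow> univ"

text \<open>Short exact sequences of modules whose left term is the ring of p-adic integers and whose
  right term is a finite abelian p-group.\<close>

definition exact_seqs :: "nat \<Rightarrow> exseq set" where
  "exact_seqs p = {s. Module.module (Zp p) (middle s) \<and> quot s \<in> pgroups p \<and>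
     incl s \<in> lin_hom (Zp p) (Zp p) (middle s) \<and>
     proj s \<in> lin_hom (Zp p) (middle s) (pgroup_module p (quot s)) \<and>
     inj_on (incl s) (carrier (Zp p)) \<and>
     proj s ` carrier (middle s) = carrier (quot s) \<and>
     incl s ` carrier (Zp p) = kernel (add_monoid (middle s)) (quot s) (proj s)}"


section \<open>The random operators\<close>

text \<open>\<open>Ext(G, Zp)\<close> as the set of Yoneda classes of extensions: equivalences are the identity on both
  outer terms. Only the uniform distribution on it is needed, not the Baer sum.\<close>

definition extensions :: "nat \<Rightarrow> grp \<Rightarrow> exseq set" where
  "extensions p G = {s \<in> exact_seqs p. quot s = G}"

definition ext_equiv :: "nat \<Rightarrow> grp \<Rightarrow> (exseq \<times> exseq) set" where
  "ext_equiv p G = {(s, t). s \<in> extensions p G \<and> t \<in> extensions p G \<and>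
     (\<exists>\<phi> \<in> lin_iso (Zp p) (middle s) (middle t).
        (\<forall>a \<in> carrier (Zp p). \<phi> (incl s a) = incl t a) \<and>
        (\<forall>x \<in> carrier (middle s). proj t (\<phi> x) = proj s x))}"

definition Ext :: "nat \<Rightarrow> grp \<Rightarrow> exseq set set" where
  "Ext p G = extensions p G // ext_equiv p G"

definition prob_d_star :: "nat \<Rightarrow> grp \<Rightarrow> zmod \<Rightarrow> real" where
  "prob_d_star p G H =
     measure_pmf.prob (pmf_of_set (Ext p G)) {\<xi>. zmod_isomorphic p (middle (rep \<xi>)) H}"

text \<open>The p-adic topology, which is the canonical compact topology of a finitely generated module.\<close>

definition padic_topology :: "nat \<Rightarrow> zmod \<Rightarrow> univ topology" where
  "padic_topology p H = topology_generated_by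
     {(\<lambda>y. x \<oplus>\<^bsub>H\<^esub> [(p ^ n)] \<cdot>\<^bsub>H\<^esub> y) ` carrier H | x n. x \<in> carrier H}"

text \<open>The translation-invariant Borel probability measure; regularity is automatic here, as the
  topology is compact and metrizable.\<close>

definition haar :: "nat \<Rightarrow> zmod \<Rightarrow> univ measure" where
  "haar p H = (THE \<mu>. prob_space \<mu> \<and> space \<mu> = carrier H \<and>
     sets \<mu> = sets (sigma (carrier H) {U. openin (padic_topology p H) U}) \<and>
     (\<forall>x \<in> carrier H. distr \<mu> \<mu> (\<lambda>y. x \<oplus>\<^bsub>H\<^esub> y) = \<mu>))"

definition prob_d :: "nat \<Rightarrow> zmod \<Rightarrow> grp \<Rightarrow> real" where
  "prob_d p H G = measure (haar p H)
     {h \<in> carrier H. add_monoid H Mod gen_submodule (Zp p) H {h} \<cong> G}"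

fun transition :: "nat \<Rightarrow> grp set + zmod set \<Rightarrow> grp set + zmod set \<Rightarrow> real" where
  "transition p (Inl g) (Inr h) = prob_d_star p (rep g) (rep h)"
| "transition p (Inr h) (Inl g) = prob_d p (rep h) (rep g)"
| "transition p (Inl _) (Inl _) = 0"
| "transition p (Inr _) (Inr _) = 0"


section \<open>The weighted bipartite graph\<close>

definition seq_iso_rel :: "nat \<Rightarrow> (exseq \<times> exseq) set" where
  "seq_iso_rel p = {(s, t). s \<in> exact_seqs p \<and> t \<in> exact_seqs p \<and>
     (\<exists>\<phi> \<in> lin_iso (Zp p) (middle s) (middle t). \<exists>\<psi> \<in> iso (quot s) (quot t).
        (\<forall>a \<in> carrier (Zp p). \<phi> (incl s a) = incl t a) \<and>
        (\<forall>x \<in> carrier (middle s). proj t (\<phi> x) = \<psi> (proj s x)))}"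

definition edges :: "nat \<Rightarrow> exseq set set" where
  "edges p = {s \<in> exact_seqs p. middle s \<in> rank1_modules p} // seq_iso_rel p"

definition edge_ends :: "nat \<Rightarrow> exseq set \<Rightarrow> (grp set + zmod set) set" where
  "edge_ends p e = {Inl (grp_iso_rel p `` {quot (rep e)}), Inr (zmod_iso_rel p `` {middle (rep e)})}"

text \<open>Automorphisms of the middle term that preserve the given map from the p-adic integers;
  extensionality makes the set have the right cardinality.\<close>

definition Aut_incl :: "nat \<Rightarrow> exseq \<Rightarrow> (univ \<Rightarrow> univ) set" where
  "Aut_incl p s = {\<phi> \<in> extensional (carrier (middle s)).
     \<phi> \<in> lin_iso (Zp p) (middle s) (middle s) \<and>
     (\<forall>a \<in> carrier (Zp p). \<phi> (incl s a) = incl s a)}"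

definition edge_weight :: "nat \<Rightarrow> exseq set \<Rightarrow> real" where
  "edge_weight p e = 1 / (real (card (Aut_incl p (rep e))) * real (order (quot (rep e))))"

text \<open>A graph may have parallel edges and infinitely many edges at a vertex; for the random walk to
  make sense the total weight at each vertex must be finite and nonzero.\<close>

definition is_random_walk_on ::
  "'v set \<Rightarrow> 'e set \<Rightarrow> ('e \<Rightarrow> 'v set) \<Rightarrow> ('e \<Rightarrow> real) \<Rightarrow> ('v \<Rightarrow> 'v \<Rightarrow> real) \<Rightarrow> bool" where
  "is_random_walk_on V E ends w P \<longleftrightarrow>
     (\<forall>e\<in>E. ends e \<subseteq> V \<and> w e > 0) \<and>
     (\<forall>v\<in>V. w summable_on {e\<in>E. v \<in> ends e} \<and> (\<Sum>\<^sub>\<infinity>e\<in>{e\<in>E. v \<in> ends e}. w e) > 0) \<and>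
     (\<forall>v\<in>V. \<forall>u\<in>V. P v u =
        (\<Sum>\<^sub>\<infinity>e\<in>{e\<in>E. ends e = {v, u}}. w e) / (\<Sum>\<^sub>\<infinity>e\<in>{e\<in>E. v \<in> ends e}. w e))"

end

theory Submission
  imports Defs "HOL-Number_Theory.Cong" "HOL-Algebra.Multiplicative_Group" "HOL-Algebra.Sylow"
begin

text \<open>
Both halves of the theorem are orbit counts, and the weight of an edge is what makes the two counts
agree.

\<^bold>\<open>From a group.\<close> The edges at a finite abelian \<open>p\<close>-group \<open>G\<close> are the orbits of \<open>Aut(G)\<close> on
\<open>Ext(G, Zp)\<close>, where an automorphism changes the projection onto \<open>G\<close>. It fixes the class of
\<open>0 \<rightarrow> Zp \<rightarrow> H \<rightarrow> G \<rightarrow> 0\<close> exactly if it lifts to an automorphism of \<open>H\<close> that is the identity on \<open>Zp\<close>.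
The lift is unique, because every homomorphism from the finite group \<open>G\<close> to \<open>Zp\<close> is zero. Hence the
stabilizer is \<open>Aut(Zp \<rightarrow> H)\<close>, and the edge consists of \<open>|Aut(G)| / |Aut(Zp \<rightarrow> H)|\<close> classes of
extensions (\<open>card_Auts\<close>). This number is the weight of the edge multiplied by \<open>|Aut(G)| |G|\<close>, which
depends on \<open>G\<close> only. So drawing an edge at \<open>G\<close> with probability proportional to its weight is the
same as drawing a uniform element of \<open>Ext(G, Zp)\<close> (\<open>walk_from_group\<close>). For this \<open>Ext(G, Zp)\<close> has to be
finite: if \<open>|G| = p ^ N\<close>, then \<open>p ^ N x\<close> lies in \<open>Zp\<close> for all \<open>x\<close> in \<open>H\<close>, its residue modulo \<open>p ^ N\<close>
depends only on the image of \<open>x\<close> in \<open>G\<close>, and the function on \<open>G\<close> so obtained determines the extension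
(\<open>ext_equivI\<close>).

\<^bold>\<open>From a module.\<close> An injection of \<open>Zp\<close> into a module \<open>H\<close> of rank one is a nontorsion element of \<open>H\<close>,
the image \<open>h\<close> of \<open>1\<close>, and its cokernel is \<open>H / Zp h\<close>. The edges at \<open>H\<close> are therefore the orbits of
\<open>Aut(H)\<close> on the nontorsion elements, and the Haar measure of an orbit has to be found. Write
\<open>H = Zp e \<oplus> T\<close> with \<open>T\<close> finite (\<open>rank1_split_exists\<close>) and let \<open>\<pi>\<close> be the projection onto the first
coordinate. The automorphisms that preserve \<open>\<pi>\<close> form a finite group \<open>A\<close>, which contains the stabilizer
\<open>Aut(Zp \<rightarrow> H)\<close> of \<open>h\<close>; so the orbit of \<open>h\<close> under \<open>A\<close> has \<open>|A| / |Aut(Zp \<rightarrow> H)|\<close> elements. Every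
automorphism of \<open>H\<close> is an element of \<open>A\<close> followed by the multiplication by a unit, so the orbit under
\<open>Aut(H)\<close> is the disjoint union of the sets of unit multiples of these elements. For an element \<open>x\<close> with
\<open>H / Zp x \<cong> G\<close>, the submodule \<open>Zp x\<close> has measure \<open>1 / |G|\<close>, and \<open>p Zp x\<close> has \<open>1 / p\<close> of this; the unit
multiples of \<open>x\<close> are the difference. Altogether the orbit has measure \<open>|A| (1 - 1 / p)\<close> times the weight
of the edge (\<open>orbit_measure\<close>), with a factor that depends on \<open>H\<close> only. The torsion elements have measure
zero, so these measures add up to one (\<open>walk_from_module\<close>).

The Haar measure itself is the distribution of \<open>c e + t\<close>, where \<open>c\<close> has independent uniform digits
and \<open>t\<close> is uniform in \<open>T\<close>. It is unique because invariance determines the measure of each coset of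
\<open>p ^ n H\<close>, and these cosets generate the Borel sets.
\<close>

section \<open>The p-adic integers\<close>

locale padic =
  fixes p :: nat
  assumes prime: "prime p"
begin

abbreviation Z where "Z \<equiv> Zp p"

text \<open>The image of an integer under the unique ring homomorphism to the p-adic integers.\<close>

definition pint :: "int \<Rightarrow> padic" where "pint z = (\<lambda>n. z mod int p ^ n)"

lemma p_pos: "0 < int p ^ n" and p_gt_1: "1 < p"
  using prime prime_gt_0_nat[OF prime] prime_gt_1_nat[OF prime] by auto

lemma carrier_Z: "carrier Z = {x. \<forall>n. 0 \<le> x n \<and> x n < int p ^ n \<and> x (Suc n) mod int p ^ n = x n}"
  by (simp add: Zp_def)

lemma Z_mult: "x \<otimes>\<^bsub>Z\<^esub> y = (\<lambda>n. (x n * y n) mod int p ^ n)"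
  and Z_add: "x \<oplus>\<^bsub>Z\<^esub> y = (\<lambda>n. (x n + y n) mod int p ^ n)"
  and Z_one: "\<one>\<^bsub>Z\<^esub> = (\<lambda>n. 1 mod int p ^ n)"
  and Z_zero: "\<zero>\<^bsub>Z\<^esub> = (\<lambda>n. 0)"
  and Z_smult: "x \<odot>\<^bsub>Z\<^esub> y = x \<otimes>\<^bsub>Z\<^esub> y"
  by (simp_all add: Zp_def)

lemma Z_bounds: "x \<in> carrier Z \<Longrightarrow> 0 \<le> x n" "x \<in> carrier Z \<Longrightarrow> x n < int p ^ n"
  by (auto simp: carrier_Z)

lemma Z_mod_self: "x \<in> carrier Z \<Longrightarrow> x n mod int p ^ n = x n"
  by (simp add: Z_bounds)

lemma Z_compat: "x \<in> carrier Z \<Longrightarrow> n \<le> m \<Longrightarrow> x m mod int p ^ n = x n"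
proof (induction m)
  case 0 then show ?case using Z_mod_self[of x 0] by simp
next
  case (Suc m)
  show ?case
  proof (cases "n = Suc m")
    case True then show ?thesis using Suc Z_mod_self[of x "Suc m"] by simp
  next
    case False
    then have "n \<le> m" using Suc by simp
    then have "x (Suc m) mod int p ^ n = x (Suc m) mod int p ^ m mod int p ^ n"
      by (simp add: mod_mod_cancel le_imp_power_dvd)
    then show ?thesis using Suc \<open>n \<le> m\<close> by (simp add: carrier_Z)
  qed
qed

lemma Z_memI: "(\<And>n. x n = y n mod int p ^ n) \<Longrightarrow> (\<And>n. y (Suc n) mod int p ^ n = y n mod int p ^ n) \<Longrightarrow> x \<in> carrier Z"
  using p_pos by (simp add: carrier_Z mod_mod_cancel)

lemma Z_step: "x \<in> carrier Z \<Longrightarrow> x (Suc n) mod int p ^ n = x n"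
  by (simp add: carrier_Z)

lemma Z_cring: "cring Z"
proof (rule cringI)
  show "abelian_group Z"
  proof (rule abelian_groupI)
    fix x y assume xy: "x \<in> carrier Z" "y \<in> carrier Z"
    show "x \<oplus>\<^bsub>Z\<^esub> y \<in> carrier Z"
      unfolding Z_add by (rule Z_memI[OF refl], subst mod_add_eq[symmetric]) (use xy in \<open>simp add: Z_step\<close>)
    show "x \<oplus>\<^bsub>Z\<^esub> y = y \<oplus>\<^bsub>Z\<^esub> x" by (simp add: Z_add add.commute)
  next
    fix x y z assume "x \<in> carrier Z" "y \<in> carrier Z" "z \<in> carrier Z"
    show "x \<oplus>\<^bsub>Z\<^esub> y \<oplus>\<^bsub>Z\<^esub> z = x \<oplus>\<^bsub>Z\<^esub> (y \<oplus>\<^bsub>Z\<^esub> z)"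
      by (simp add: Z_add mod_simps add.assoc)
  next
    show "\<zero>\<^bsub>Z\<^esub> \<in> carrier Z" using p_pos by (simp add: Z_zero carrier_Z)
  next
    fix x assume x: "x \<in> carrier Z"
    show "\<zero>\<^bsub>Z\<^esub> \<oplus>\<^bsub>Z\<^esub> x = x" using x by (simp add: Z_zero Z_add Z_mod_self)
    have "(\<lambda>n. (- x n) mod int p ^ n) \<in> carrier Z"
    proof (rule Z_memI[OF refl])
      fix n show "(- x (Suc n)) mod int p ^ n = (- x n) mod int p ^ n"
        by (subst mod_minus_eq[symmetric]) (use x in \<open>simp add: Z_step\<close>)
    qed
    moreover have "(\<lambda>n. (- x n) mod int p ^ n) \<oplus>\<^bsub>Z\<^esub> x = \<zero>\<^bsub>Z\<^esub>"
      by (simp add: Z_zero Z_add mod_simps)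
    ultimately show "\<exists>y\<in>carrier Z. y \<oplus>\<^bsub>Z\<^esub> x = \<zero>\<^bsub>Z\<^esub>" by blast
  qed
next
  show "Group.comm_monoid Z"
  proof (rule comm_monoidI)
    fix x y assume xy: "x \<in> carrier Z" "y \<in> carrier Z"
    show "x \<otimes>\<^bsub>Z\<^esub> y \<in> carrier Z"
      unfolding Z_mult by (rule Z_memI[OF refl], subst mod_mult_eq[symmetric]) (use xy in \<open>simp add: Z_step\<close>)
    show "x \<otimes>\<^bsub>Z\<^esub> y = y \<otimes>\<^bsub>Z\<^esub> x" by (simp add: Z_mult mult.commute)
  next
    fix x y z assume "x \<in> carrier Z" "y \<in> carrier Z" "z \<in> carrier Z"
    show "x \<otimes>\<^bsub>Z\<^esub> y \<otimes>\<^bsub>Z\<^esub> z = x \<otimes>\<^bsub>Z\<^esub> (y \<otimes>\<^bsub>Z\<^esub> z)"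
      by (simp add: Z_mult mod_simps mult.assoc)
  next
    show "\<one>\<^bsub>Z\<^esub> \<in> carrier Z" unfolding Z_one by (rule Z_memI[OF refl]) simp
  next
    fix x assume x: "x \<in> carrier Z"
    show "\<one>\<^bsub>Z\<^esub> \<otimes>\<^bsub>Z\<^esub> x = x" using x by (simp add: Z_one Z_mult Z_mod_self mod_simps)
  qed
next
  fix x y z assume "x \<in> carrier Z" "y \<in> carrier Z" "z \<in> carrier Z"
  show "(x \<oplus>\<^bsub>Z\<^esub> y) \<otimes>\<^bsub>Z\<^esub> z = x \<otimes>\<^bsub>Z\<^esub> z \<oplus>\<^bsub>Z\<^esub> y \<otimes>\<^bsub>Z\<^esub> z"
    by (simp add: Z_mult Z_add mod_simps algebra_simps)
qed

sublocale Z: cring "Zp p" by (rule Z_cring)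

lemma pint_closed [simp, intro]: "pint z \<in> carrier Z"
  unfolding pint_def by (rule Z_memI[OF refl]) simp

lemma pint_add: "pint (a + b) = pint a \<oplus>\<^bsub>Z\<^esub> pint b"
  and pint_mult: "pint (a * b) = pint a \<otimes>\<^bsub>Z\<^esub> pint b"
  and pint_1: "pint 1 = \<one>\<^bsub>Z\<^esub>"
  and pint_0: "pint 0 = \<zero>\<^bsub>Z\<^esub>"
  by (simp_all add: pint_def Z_add Z_mult mod_simps Z_one Z_zero)

lemma pint_inj: "pint a = pint b \<Longrightarrow> a = b"
proof -
  assume eq: "pint a = pint b"
  obtain n where n: "\<bar>a - b\<bar> < int p ^ n"
  proof -
    obtain n where "real_of_int \<bar>a - b\<bar> < real p ^ n"
      using real_arch_pow[of "real p" "real_of_int \<bar>a - b\<bar>"] p_gt_1 by auto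
    then have "real_of_int \<bar>a - b\<bar> < real_of_int (int p ^ n)" by simp
    then have "\<bar>a - b\<bar> < int p ^ n" by (rule of_int_less_iff[THEN iffD1])
    then show thesis by (rule that)
  qed
  have "a mod int p ^ n = b mod int p ^ n" using eq by (metis pint_def)
  then have "int p ^ n dvd a - b" by (simp add: mod_eq_dvd_iff)
  then show "a = b" using n by (metis abs_of_pos dvd_imp_le_int eq_iff_diff_eq_0 p_pos linorder_not_le)
qed

text \<open>The quotient by \<open>p ^ n\<close> is the sequence of residues shifted by \<open>n\<close> places.\<close>

lemma divide_by_p_power:
  assumes "a \<in> carrier Z" "a n = 0"
  shows "\<exists>b\<in>carrier Z. a = pint (int p ^ n) \<otimes>\<^bsub>Z\<^esub> b"
proof
  define b where "b m = a (m + n) div int p ^ n" for m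
  have d: "int p ^ n dvd a (m + n)" for m
    using Z_compat[OF assms(1), of n "m + n"] assms(2) by (simp add: dvd_eq_mod_eq_0)
  have bm: "int p ^ n * b m = a (m + n)" for m
    using d[of m] by (simp add: b_def)
  show "b \<in> carrier Z"
    unfolding carrier_Z
  proof (safe)
    fix m
    show "0 \<le> b m" using Z_bounds(1)[OF assms(1)] by (simp only: b_def pos_imp_zdiv_nonneg_iff p_pos)
    show "b m < int p ^ m"
      using Z_bounds(2)[OF assms(1), of "m + n"] p_pos[of n] unfolding bm[symmetric]
      by (simp add: power_add mult.commute[of "int p ^ m"])
    have "int p ^ n * (b (Suc m) mod int p ^ m) = a (Suc m + n) mod (int p ^ n * int p ^ m)"
      by (simp only: mult_mod_right bm)
    also have "\<dots> = a (m + n)" using Z_compat[OF assms(1), of "m + n" "Suc m + n"]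
      by (simp add: power_add mult.commute)
    finally show "b (Suc m) mod int p ^ m = b m" using bm[of m] p_pos[of n] by (metis less_irrefl mult_cancel_left)
  qed
  show "a = pint (int p ^ n) \<otimes>\<^bsub>Z\<^esub> b"
  proof
    fix m
    have "(pint (int p ^ n) \<otimes>\<^bsub>Z\<^esub> b) m = (int p ^ n * b m) mod int p ^ m"
      by (simp add: Z_mult pint_def mod_simps)
    also have "\<dots> = a m" unfolding bm by (rule Z_compat[OF assms(1)]) simp
    finally show "a m = (pint (int p ^ n) \<otimes>\<^bsub>Z\<^esub> b) m" by simp
  qed
qed

text \<open>The residue of \<open>b\<close> modulo \<open>p ^ m\<close> can be recovered from that of \<open>p ^ n b\<close> modulo \<open>p ^ (m + n)\<close>.\<close>

lemma p_power_mult_eq_0: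
  assumes "b \<in> carrier Z" "pint (int p ^ n) \<otimes>\<^bsub>Z\<^esub> b = \<zero>\<^bsub>Z\<^esub>"
  shows "b = \<zero>\<^bsub>Z\<^esub>"
proof
  fix m
  have "(int p ^ n * b (m + n)) mod int p ^ (m + n) = 0"
    using fun_cong[OF assms(2), of "m + n"] by (simp add: Z_mult pint_def Z_zero mod_simps)
  then have "int p ^ m dvd b (m + n)" using p_gt_1
    by (simp add: power_add mult.commute[of "int p ^ m"] mod_eq_0_iff_dvd)
  then show "b m = \<zero>\<^bsub>Z\<^esub> m" using Z_compat[OF assms(1), of m "m + n"] by (simp add: Z_zero)
qed

lemma residue_decomposition:
  assumes "a \<in> carrier Z"
  shows "\<exists>b\<in>carrier Z. a = pint (a n) \<oplus>\<^bsub>Z\<^esub> pint (int p ^ n) \<otimes>\<^bsub>Z\<^esub> b"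
proof -
  let ?c = "a \<ominus>\<^bsub>Z\<^esub> pint (a n)"
  have a: "a = pint (a n) \<oplus>\<^bsub>Z\<^esub> ?c" using assms pint_closed[of "a n"]
    by (metis Z.minus_closed Z.minus_eq Z.r_neg1 Z.a_comm Z.add.inv_closed Z.add.m_lcomm Z.r_neg2)
  then have "a n = (a n + ?c n) mod int p ^ n"
    by (metis Z_add Z_mod_self assms pint_def)
  then have "int p ^ n dvd ?c n"
    by (metis Z_mod_self add_diff_cancel_left' assms mod_eq_dvd_iff)
  then have "?c n = 0" using Z_mod_self[of ?c n] assms by (simp add: dvd_eq_mod_eq_0)
  with divide_by_p_power[of ?c n] a assms show ?thesis by (metis Z.minus_closed pint_closed)
qed

text \<open>Inverses modulo \<open>p ^ n\<close> are unique, so those for different \<open>n\<close> are compatible.\<close>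

lemma Z_unit:
  assumes "a \<in> carrier Z" "a 1 \<noteq> 0"
  shows "\<exists>b\<in>carrier Z. a \<otimes>\<^bsub>Z\<^esub> b = \<one>\<^bsub>Z\<^esub>"
proof -
  have cop: "coprime (a n) (int p ^ n)" for n
  proof (cases "n = 0")
    case False
    have "a n mod int p ^ 1 = a 1" using False by (intro Z_compat assms(1)) simp
    then have "\<not> int p dvd a n" using assms(2) by (auto simp: dvd_eq_mod_eq_0)
    then show ?thesis using prime by (simp add: prime_imp_coprime coprime_commute)
  qed simp
  define b where "b n = (SOME c. [a n * c = 1] (mod int p ^ n)) mod int p ^ n" for n
  have b: "[a n * b n = 1] (mod int p ^ n)" for n
  proof -
    have "\<exists>b. [a n * b = 1] (mod int p ^ n)" using cop by (rule cong_solve_coprime_int)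
    from someI_ex[OF this] show ?thesis unfolding b_def by (simp add: cong_def mod_simps)
  qed
  have "b \<in> carrier Z"
  proof (rule Z_memI)
    fix n show "b n = b n mod int p ^ n" by (simp add: b_def)
    have "[a (Suc n) * b (Suc n) = 1] (mod int p ^ n)"
      by (rule cong_dvd_modulus[OF b]) (simp add: le_imp_power_dvd)
    moreover have "[a (Suc n) * b (Suc n) = a n * b (Suc n)] (mod int p ^ n)"
      using Z_step[OF assms(1)] by (intro cong_mult cong_refl) (simp add: cong_def Z_mod_self[OF assms(1)])
    ultimately have "[a n * b (Suc n) = a n * b n] (mod int p ^ n)"
      using b[of n] by (metis cong_sym cong_trans)
    then show "b (Suc n) mod int p ^ n = b n mod int p ^ n"
      using cop cong_mult_lcancel unfolding cong_def by blast
  qed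
  moreover have "a \<otimes>\<^bsub>Z\<^esub> b = \<one>\<^bsub>Z\<^esub>" using b by (auto simp: Z_mult Z_one cong_def)
  ultimately show ?thesis by blast
qed

text \<open>The exponent is the p-adic valuation: the last place at which the residue still vanishes.\<close>

lemma Z_factor:
  assumes "a \<in> carrier Z" "a \<noteq> \<zero>\<^bsub>Z\<^esub>"
  obtains n u where "u \<in> carrier Z" "u 1 \<noteq> 0" "a = pint (int p ^ n) \<otimes>\<^bsub>Z\<^esub> u"
proof -
  have ex: "\<exists>n. a n \<noteq> 0" using assms(2) by (auto simp: Z_zero)
  define n where "n = (LEAST n. a n \<noteq> 0)"
  have an: "a n \<noteq> 0" using LeastI_ex[OF ex] by (simp add: n_def)
  have "a 0 = 0" using Z_bounds[OF assms(1), of 0] by simp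
  then obtain k where k: "n = Suc k" using an by (cases n) auto
  have "a k = 0" using not_less_Least[of k "\<lambda>n. a n \<noteq> 0"] k by (auto simp: n_def)
  then obtain u where u: "u \<in> carrier Z" "a = pint (int p ^ k) \<otimes>\<^bsub>Z\<^esub> u" using divide_by_p_power assms(1) by blast
  have "u 1 \<noteq> 0"
  proof
    assume "u 1 = 0"
    then obtain v where "v \<in> carrier Z" "u = pint (int p ^ 1) \<otimes>\<^bsub>Z\<^esub> v" using divide_by_p_power u(1) by blast
    then have "a = pint (int p ^ n) \<otimes>\<^bsub>Z\<^esub> v" using u(2) k
      by (simp add: pint_mult Z.m_assoc[symmetric] mult.commute[of "int p"])
    then have "a n = 0" by (simp add: Z_mult pint_def)
    with an show False by simp
  qed
  with that u show thesis by blast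
qed

lemma Z_integral:
  assumes "a \<in> carrier Z" "b \<in> carrier Z" "a \<otimes>\<^bsub>Z\<^esub> b = \<zero>\<^bsub>Z\<^esub>"
  shows "a = \<zero>\<^bsub>Z\<^esub> \<or> b = \<zero>\<^bsub>Z\<^esub>"
proof (rule ccontr)
  assume "\<not> ?thesis"
  then obtain n u where u: "u \<in> carrier Z" "u 1 \<noteq> 0" "a = pint (int p ^ n) \<otimes>\<^bsub>Z\<^esub> u" and b0: "b \<noteq> \<zero>\<^bsub>Z\<^esub>"
    using Z_factor assms by metis
  obtain v where v: "v \<in> carrier Z" "u \<otimes>\<^bsub>Z\<^esub> v = \<one>\<^bsub>Z\<^esub>" using Z_unit u by blast
  have "pint (int p ^ n) \<otimes>\<^bsub>Z\<^esub> (u \<otimes>\<^bsub>Z\<^esub> b) = \<zero>\<^bsub>Z\<^esub>" using assms u by (simp add: Z.m_assoc)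
  then have "u \<otimes>\<^bsub>Z\<^esub> b = \<zero>\<^bsub>Z\<^esub>" using p_power_mult_eq_0 assms u by blast
  then have "v \<otimes>\<^bsub>Z\<^esub> (u \<otimes>\<^bsub>Z\<^esub> b) = \<zero>\<^bsub>Z\<^esub>" using v by simp
  then have "b = \<zero>\<^bsub>Z\<^esub>" using u v assms by (metis Z.l_one Z.m_assoc Z.m_comm)
  then show False using b0 by simp
qed

lemma Z_one_not_zero: "\<one>\<^bsub>Z\<^esub> \<noteq> \<zero>\<^bsub>Z\<^esub>"
proof
  assume "\<one>\<^bsub>Z\<^esub> = \<zero>\<^bsub>Z\<^esub>"
  then have "(1::int) mod int p ^ 1 = 0" unfolding Z_one Z_zero by metis
  then show False using p_gt_1 by simp
qed

sublocale Z: domain "Zp p"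
  by unfold_locales (use Z_one_not_zero Z_integral in auto)

lemma pint_eq_0: "pint z = \<zero>\<^bsub>Z\<^esub> \<longleftrightarrow> z = 0"
  using pint_inj pint_0 by metis

lemma pint_pow_nz: "pint (int p ^ n) \<noteq> \<zero>\<^bsub>Z\<^esub>"
  using p_pos[of n] by (simp add: pint_eq_0)

lemma pint_p_not_unit: "b \<in> carrier Z \<Longrightarrow> (pint (int p) \<otimes>\<^bsub>Z\<^esub> b) 1 = 0"
  by (simp add: Z_mult pint_def)

lemma Z_module: "Module.module Z Z"
  by (rule Module.moduleI) (auto simp: Z_smult Z.l_distr Z.r_distr Z.m_assoc intro: Z.is_cring Z.abelian_group_axioms)

end

section \<open>Finitely generated modules\<close>

locale padic_module = padic p + M: Module.module "Zp p" H
  for p and H :: "(padic, 'a, 'm) module_scheme" (structure)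
begin

lemma add_interchange:
  "\<lbrakk>a \<in> carrier H; b \<in> carrier H; c \<in> carrier H; d \<in> carrier H\<rbrakk> \<Longrightarrow>
     (a \<oplus> b) \<oplus> (c \<oplus> d) = (a \<oplus> c) \<oplus> (b \<oplus> d)"
  by (simp add: M.add.m_ac)

lemma add_pow_smult: "x \<in> carrier H \<Longrightarrow> [k] \<cdot>\<^bsub>H\<^esub> x = pint (int k) \<odot> x"
proof (induction k)
  case 0 then show ?case by (simp add: pint_0)
next
  case (Suc k)
  have "pint (int (Suc k)) = pint (int k) \<oplus>\<^bsub>Z\<^esub> \<one>\<^bsub>Z\<^esub>"
    using pint_add[of "int k" 1] by (simp add: pint_1 add.commute)
  then show ?case using Suc by (simp add: M.smult_l_distr)
qed

lemma gen_least: "submodule N Z H \<Longrightarrow> S \<subseteq> N \<Longrightarrow> gen_submodule Z H S \<subseteq> N"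
  by (auto simp: gen_submodule_def)

lemma gen_incl: "S \<subseteq> gen_submodule Z H S"
  by (auto simp: gen_submodule_def)

lemma gen_submodule_is_submodule:
  assumes "S \<subseteq> carrier H" shows "submodule (gen_submodule Z H S) Z H"
proof (rule M.submoduleI)
  show "gen_submodule Z H S \<subseteq> carrier H"
    by (rule gen_least[OF M.carrier_is_submodule assms])
  show "\<zero> \<in> gen_submodule Z H S"
    by (auto simp: gen_submodule_def submodule_def dest: subgroup.one_closed)
  show "\<And>a. a \<in> gen_submodule Z H S \<Longrightarrow> \<ominus> a \<in> gen_submodule Z H S"
    using M.submoduleE(3) by (auto simp: gen_submodule_def)
  show "\<And>a b. a \<in> gen_submodule Z H S \<Longrightarrow> b \<in> gen_submodule Z H S \<Longrightarrow> a \<oplus> b \<in> gen_submodule Z H S"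
    using M.submoduleE(5) by (auto simp: gen_submodule_def)
  show "\<And>a x. a \<in> carrier Z \<Longrightarrow> x \<in> gen_submodule Z H S \<Longrightarrow> a \<odot> x \<in> gen_submodule Z H S"
    using M.submoduleE(4) by (auto simp: gen_submodule_def)
qed

lemma gen_closed: "S \<subseteq> carrier H \<Longrightarrow> x \<in> gen_submodule Z H S \<Longrightarrow> x \<in> carrier H"
  using gen_least[OF M.carrier_is_submodule] by blast

lemma gen_empty: "gen_submodule Z H {} = {\<zero>}"
proof
  show "gen_submodule Z H {} \<subseteq> {\<zero>}"
    by (rule gen_least) (auto intro: M.submoduleI)
  show "{\<zero>} \<subseteq> gen_submodule Z H {}"
    by (auto simp: gen_submodule_def submodule_def dest: subgroup.one_closed)
qed

text \<open>Splits off one generator. Facts about finitely generated submodules then follow by induction on the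
set of generators, without writing elements as sums.\<close>

lemma gen_insert:
  assumes "g \<in> carrier H" "S \<subseteq> carrier H" "x \<in> gen_submodule Z H (insert g S)"
  shows "\<exists>c\<in>carrier Z. \<exists>y\<in>gen_submodule Z H S. x = c \<odot> g \<oplus> y"
proof -
  let ?G = "gen_submodule Z H S"
  let ?N = "{c \<odot> g \<oplus> y | c y. c \<in> carrier Z \<and> y \<in> ?G}"
  note G = gen_submodule_is_submodule[OF assms(2)]
  note Gc = gen_closed[OF assms(2)]
  have zG: "\<zero> \<in> ?G" using G by (auto simp: submodule_def dest: subgroup.one_closed)
  have "submodule ?N Z H"
  proof (rule M.submoduleI)
    show "?N \<subseteq> carrier H" using assms(1) Gc by auto
    have "\<zero> = \<zero>\<^bsub>Z\<^esub> \<odot> g \<oplus> \<zero>" using assms(1) by simp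
    then show "\<zero> \<in> ?N" using zG by blast
  next
    fix a assume "a \<in> ?N"
    then obtain c y where a: "a = c \<odot> g \<oplus> y" "c \<in> carrier Z" "y \<in> ?G" by blast
    have "\<ominus> a = (\<ominus>\<^bsub>Z\<^esub> c) \<odot> g \<oplus> (\<ominus> y)"
      using a assms(1) Gc by (simp add: M.smult_l_minus M.minus_add)
    then show "\<ominus> a \<in> ?N" using a M.submoduleE(3)[OF G] by blast
  next
    fix a b assume "a \<in> ?N" "b \<in> ?N"
    then obtain c y d z where a: "a = c \<odot> g \<oplus> y" "c \<in> carrier Z" "y \<in> ?G"
      and b: "b = d \<odot> g \<oplus> z" "d \<in> carrier Z" "z \<in> ?G" by blast
    have "a \<oplus> b = (c \<oplus>\<^bsub>Z\<^esub> d) \<odot> g \<oplus> (y \<oplus> z)"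
      using a b assms(1) Gc by (simp add: M.smult_l_distr M.add.m_ac)
    then show "a \<oplus> b \<in> ?N" using a b M.submoduleE(5)[OF G] by blast
  next
    fix r a assume r: "r \<in> carrier Z" and "a \<in> ?N"
    then obtain c y where a: "a = c \<odot> g \<oplus> y" "c \<in> carrier Z" "y \<in> ?G" by blast
    have "r \<odot> a = (r \<otimes>\<^bsub>Z\<^esub> c) \<odot> g \<oplus> (r \<odot> y)"
      using a r assms(1) Gc by (simp add: M.smult_r_distr M.smult_assoc1)
    then show "r \<odot> a \<in> ?N" using a r M.submoduleE(4)[OF G] by blast
  qed
  moreover have "insert g S \<subseteq> ?N"
  proof -
    have "g = \<one>\<^bsub>Z\<^esub> \<odot> g \<oplus> \<zero>" using assms(1) by simp
    then have "g \<in> ?N" using zG by blast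
    moreover have "s \<in> ?N" if "s \<in> S" for s
    proof -
      have "s = \<zero>\<^bsub>Z\<^esub> \<odot> g \<oplus> s" using assms(1,2) that by auto
      then show ?thesis using gen_incl that by blast
    qed
    ultimately show ?thesis by blast
  qed
  ultimately have "gen_submodule Z H (insert g S) \<subseteq> ?N" by (rule gen_least)
  then show ?thesis using assms(3) by blast
qed

lemma gen_singleton:
  assumes "h \<in> carrier H"
  shows "gen_submodule Z H {h} = (\<lambda>a. a \<odot> h) ` carrier Z"
proof
  show "gen_submodule Z H {h} \<subseteq> (\<lambda>a. a \<odot> h) ` carrier Z"
    using gen_insert[OF assms, of "{}"] assms by (auto simp: gen_empty)
  show "(\<lambda>a. a \<odot> h) ` carrier Z \<subseteq> gen_submodule Z H {h}"
    using M.submoduleE(4)[OF gen_submodule_is_submodule[of "{h}"]] gen_incl[of "{h}"] assms by auto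
qed

text \<open>Only the residue modulo \<open>p ^ k\<close> of the coefficient of a generator matters.\<close>

lemma gen_torsion_finite:
  assumes "finite S" "S \<subseteq> carrier H" "\<And>s. s \<in> S \<Longrightarrow> pint (int p ^ k) \<odot> s = \<zero>"
  shows "finite (gen_submodule Z H S)"
  using assms
proof (induction S)
  case empty then show ?case by (simp add: gen_empty)
next
  case (insert g S)
  have g: "g \<in> carrier H" "S \<subseteq> carrier H" using insert by auto
  have red: "c \<odot> g = pint (c k) \<odot> g" if c: "c \<in> carrier Z" for c
  proof -
    obtain b where b: "b \<in> carrier Z" "c = pint (c k) \<oplus>\<^bsub>Z\<^esub> pint (int p ^ k) \<otimes>\<^bsub>Z\<^esub> b"
      using residue_decomposition[OF c] by blast
    have "pint (int p ^ k) \<otimes>\<^bsub>Z\<^esub> b = b \<otimes>\<^bsub>Z\<^esub> pint (int p ^ k)" using b by (simp add: Z.m_comm)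
    then have "c \<odot> g = pint (c k) \<odot> g \<oplus> b \<odot> (pint (int p ^ k) \<odot> g)"
      using b g by (metis M.smult_assoc1 M.smult_l_distr Z.m_closed pint_closed)
    then show ?thesis using insert g b by simp
  qed
  have "gen_submodule Z H (insert g S) \<subseteq>
    (\<lambda>(i, y). pint i \<odot> g \<oplus> y) ` ({0..<int p ^ k} \<times> gen_submodule Z H S)"
  proof
    fix x assume "x \<in> gen_submodule Z H (insert g S)"
    from gen_insert[OF g this] obtain c y where cy: "c \<in> carrier Z" "y \<in> gen_submodule Z H S"
      "x = c \<odot> g \<oplus> y" by blast
    then have "x = pint (c k) \<odot> g \<oplus> y" using red[OF cy(1)] by simp
    then show "x \<in> (\<lambda>(i, y). pint i \<odot> g \<oplus> y) ` ({0..<int p ^ k} \<times> gen_submodule Z H S)"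
      using cy Z_bounds[of c k] by (intro image_eqI[of _ _ "(c k, y)"]) auto
  qed
  moreover have "finite (gen_submodule Z H S)" using insert by auto
  ultimately show ?case by (auto intro: finite_subset)
qed

lemma finsum_smult_rdistr:
  assumes "finite A" "f \<in> A \<rightarrow> carrier Z" "x \<in> carrier H"
  shows "(\<Oplus>\<^bsub>Z\<^esub>i\<in>A. f i) \<odot> x = (\<Oplus>i\<in>A. f i \<odot> x)"
  using assms by (induction A) (simp_all add: Pi_def M.smult_l_distr)

text \<open>More elements than generators satisfy a nontrivial relation, by Gaussian elimination over the domain of
p-adic integers: a generator is eliminated by means of a pivot, an element in which it occurs with
nonzero coefficient. Families instead of sets are needed because elimination may produce equal elements.\<close>

lemma dependent_family:
  assumes "finite G" "G \<subseteq> carrier H" "finite J" "card G < card J"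
    "\<And>j. j \<in> J \<Longrightarrow> f j \<in> gen_submodule Z H G"
  shows "\<exists>a\<in>J \<rightarrow> carrier Z. (\<exists>j\<in>J. a j \<noteq> \<zero>\<^bsub>Z\<^esub>) \<and> (\<Oplus>j\<in>J. a j \<odot> f j) = \<zero>"
  using assms
proof (induction G arbitrary: J f)
  case empty
  have "(\<Oplus>j\<in>J. \<one>\<^bsub>Z\<^esub> \<odot> f j) = \<zero>"
    using empty by (intro M.add.finprod_one_eqI) (simp add: gen_empty)
  moreover have "J \<noteq> {}" using empty by auto
  ultimately show ?case using Z.one_not_zero
    by (intro bexI[of _ "\<lambda>_. \<one>\<^bsub>Z\<^esub>"]) auto
next
  case (insert g G)
  have g: "g \<in> carrier H" "G \<subseteq> carrier H" using insert by auto
  note Gs = gen_submodule_is_submodule[OF g(2)]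
  have "\<forall>j\<in>J. \<exists>c y. c \<in> carrier Z \<and> y \<in> gen_submodule Z H G \<and> f j = c \<odot> g \<oplus> y"
  proof
    fix j assume "j \<in> J"
    then have "f j \<in> gen_submodule Z H (insert g G)" by (rule insert.prems)
    from gen_insert[OF g this]
    show "\<exists>c y. c \<in> carrier Z \<and> y \<in> gen_submodule Z H G \<and> f j = c \<odot> g \<oplus> y" by blast
  qed
  then obtain c y where cy: "\<And>j. j \<in> J \<Longrightarrow> c j \<in> carrier Z" "\<And>j. j \<in> J \<Longrightarrow> y j \<in> gen_submodule Z H G"
     "\<And>j. j \<in> J \<Longrightarrow> f j = c j \<odot> g \<oplus> y j"
  proof -
    assume *: "\<And>c y. (\<And>j. j \<in> J \<Longrightarrow> c j \<in> carrier Z) \<Longrightarrow>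
       (\<And>j. j \<in> J \<Longrightarrow> y j \<in> gen_submodule Z H G) \<Longrightarrow> (\<And>j. j \<in> J \<Longrightarrow> f j = c j \<odot> g \<oplus> y j) \<Longrightarrow> thesis"
    assume ex: "\<forall>j\<in>J. \<exists>c y. c \<in> carrier Z \<and> y \<in> gen_submodule Z H G \<and> f j = c \<odot> g \<oplus> y"
    obtain c where c: "\<forall>j\<in>J. \<exists>y. c j \<in> carrier Z \<and> y \<in> gen_submodule Z H G \<and> f j = c j \<odot> g \<oplus> y"
      using bchoice[OF ex] by blast
    obtain y where "\<forall>j\<in>J. c j \<in> carrier Z \<and> y j \<in> gen_submodule Z H G \<and> f j = c j \<odot> g \<oplus> y j"
      using bchoice[OF c] by blast
    then show thesis by (intro *[of c y]) auto
  qed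
  have yc: "j \<in> J \<Longrightarrow> y j \<in> carrier H" for j using cy gen_closed[OF g(2)] by blast
  have fc: "j \<in> J \<Longrightarrow> f j \<in> carrier H" for j using cy yc g by simp
  have lt: "card G < card J" using insert by simp
  show ?case
  proof (cases "\<forall>j\<in>J. c j = \<zero>\<^bsub>Z\<^esub>")
    case True
    then have "j \<in> J \<Longrightarrow> f j \<in> gen_submodule Z H G" for j using cy(2,3)[of j] yc g by simp
    then show ?thesis using insert.IH[OF g(2) \<open>finite J\<close> lt] by blast
  next
    case False
    then obtain o0 where o: "o0 \<in> J" "c o0 \<noteq> \<zero>\<^bsub>Z\<^esub>" by blast
    let ?J = "J - {o0}"
    \<comment> \<open>cross-multiplying with the pivot avoids division\<close>
    define f' where "f' j = c o0 \<odot> f j \<oplus> (\<ominus>\<^bsub>Z\<^esub> c j) \<odot> f o0" for j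
    have f'_eq: "f' j = c o0 \<odot> y j \<oplus> (\<ominus>\<^bsub>Z\<^esub> c j) \<odot> y o0" if "j \<in> J" for j
    proof -
      have "f' j = ((c o0 \<otimes>\<^bsub>Z\<^esub> c j) \<odot> g \<oplus> (\<ominus>\<^bsub>Z\<^esub> (c j \<otimes>\<^bsub>Z\<^esub> c o0)) \<odot> g) \<oplus> (c o0 \<odot> y j \<oplus> (\<ominus>\<^bsub>Z\<^esub> c j) \<odot> y o0)"
      proof -
        have "c o0 \<odot> f j = (c o0 \<otimes>\<^bsub>Z\<^esub> c j) \<odot> g \<oplus> c o0 \<odot> y j"
          using that o cy(1) yc g cy(3)[OF that] by (simp add: M.smult_r_distr M.smult_assoc1)
        moreover have "(\<ominus>\<^bsub>Z\<^esub> c j) \<odot> f o0 = (\<ominus>\<^bsub>Z\<^esub> (c j \<otimes>\<^bsub>Z\<^esub> c o0)) \<odot> g \<oplus> (\<ominus>\<^bsub>Z\<^esub> c j) \<odot> y o0"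
          using that o cy(1) yc g cy(3)[OF o(1)] by (simp add: M.smult_r_distr M.smult_assoc1 Z.l_minus[symmetric])
        ultimately show ?thesis
          unfolding f'_def using that o cy(1) yc g by (simp add: add_interchange)
      qed
      also have "(c o0 \<otimes>\<^bsub>Z\<^esub> c j) \<odot> g \<oplus> (\<ominus>\<^bsub>Z\<^esub> (c j \<otimes>\<^bsub>Z\<^esub> c o0)) \<odot> g = \<zero>"
        using that o cy(1) g by (simp add: M.smult_l_minus Z.m_comm M.r_neg)
      finally show ?thesis using that o cy(1) yc by simp
    qed
    have f'G: "f' j \<in> gen_submodule Z H G" if "j \<in> ?J" for j
      using that o cy f'_eq M.submoduleE(4,5)[OF Gs] by simp
    have "card G < card ?J" using insert o by simp
    moreover have "finite ?J" using insert.prems by simp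
    ultimately have "\<exists>a\<in>?J \<rightarrow> carrier Z. (\<exists>j\<in>?J. a j \<noteq> \<zero>\<^bsub>Z\<^esub>) \<and> (\<Oplus>j\<in>?J. a j \<odot> f' j) = \<zero>"
      using f'G by (intro insert.IH[OF g(2)])
    then obtain a' where a': "a' \<in> ?J \<rightarrow> carrier Z" "\<exists>j\<in>?J. a' j \<noteq> \<zero>\<^bsub>Z\<^esub>"
      "(\<Oplus>j\<in>?J. a' j \<odot> f' j) = \<zero>" by (rule bexE, elim conjE) (rule that)
    have a'c: "a' j \<in> carrier Z" if "j \<in> J" "j \<noteq> o0" for j using Pi_mem[OF a'(1)] that by simp
    \<comment> \<open>the coefficient of the pivot that makes the relation between the f' one between the f\<close>
    define w where "w = (\<Oplus>\<^bsub>Z\<^esub>j\<in>?J. \<ominus>\<^bsub>Z\<^esub> (a' j \<otimes>\<^bsub>Z\<^esub> c j))"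
    have wc: "w \<in> carrier Z" unfolding w_def using a'c cy(1) by (intro Z.finsum_closed) auto
    define a where "a j = (if j = o0 then w else c o0 \<otimes>\<^bsub>Z\<^esub> a' j)" for j
    have ac: "a \<in> J \<rightarrow> carrier Z" unfolding a_def using a'c wc cy(1) o by (intro Pi_I) auto
    have "\<exists>j\<in>J. a j \<noteq> \<zero>\<^bsub>Z\<^esub>"
    proof -
      from a'(2) obtain j where j: "j \<in> ?J" "a' j \<noteq> \<zero>\<^bsub>Z\<^esub>" by blast
      then have "a j \<noteq> \<zero>\<^bsub>Z\<^esub>" using o(2) Z.integral a'c cy(1)[OF o(1)] by (auto simp: a_def)
      with j show ?thesis by blast
    qed
    moreover have "(\<Oplus>j\<in>J. a j \<odot> f j) = \<zero>"
    proof -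
      have J: "J = insert o0 ?J" using o by blast
      have "(\<Oplus>j\<in>J. a j \<odot> f j) = a o0 \<odot> f o0 \<oplus> (\<Oplus>j\<in>?J. a j \<odot> f j)"
        by (subst J, rule M.finsum_insert) (use insert.prems ac fc o in \<open>auto simp: Pi_def\<close>)
      also have "a o0 \<odot> f o0 = (\<Oplus>j\<in>?J. (\<ominus>\<^bsub>Z\<^esub> (a' j \<otimes>\<^bsub>Z\<^esub> c j)) \<odot> f o0)"
        unfolding a_def w_def using insert.prems a'c cy(1) fc o
        by (simp, intro finsum_smult_rdistr) auto
      also have "(\<Oplus>j\<in>?J. a j \<odot> f j) = (\<Oplus>j\<in>?J. (c o0 \<otimes>\<^bsub>Z\<^esub> a' j) \<odot> f j)"
        by (rule M.finsum_cong') (use a'c cy(1) fc o in \<open>auto simp: a_def\<close>)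
      also have "(\<Oplus>j\<in>?J. (\<ominus>\<^bsub>Z\<^esub> (a' j \<otimes>\<^bsub>Z\<^esub> c j)) \<odot> f o0) \<oplus> (\<Oplus>j\<in>?J. (c o0 \<otimes>\<^bsub>Z\<^esub> a' j) \<odot> f j)
         = (\<Oplus>j\<in>?J. (\<ominus>\<^bsub>Z\<^esub> (a' j \<otimes>\<^bsub>Z\<^esub> c j)) \<odot> f o0 \<oplus> (c o0 \<otimes>\<^bsub>Z\<^esub> a' j) \<odot> f j)"
        by (rule M.finsum_addf[symmetric]) (use a'c cy(1) fc o in auto)
      also have "\<dots> = (\<Oplus>j\<in>?J. a' j \<odot> f' j)"
      proof (rule M.finsum_cong')
        show "(\<lambda>j. a' j \<odot> f' j) \<in> ?J \<rightarrow> carrier H"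
          using a'c cy(1) fc o by (auto simp: f'_def)
        fix j assume j: "j \<in> ?J"
        then have aj: "a' j \<in> carrier Z" "c j \<in> carrier Z" "c o0 \<in> carrier Z" "f j \<in> carrier H" "f o0 \<in> carrier H"
          using a'c cy(1) fc o by auto
        then show "(\<ominus>\<^bsub>Z\<^esub> (a' j \<otimes>\<^bsub>Z\<^esub> c j)) \<odot> f o0 \<oplus> (c o0 \<otimes>\<^bsub>Z\<^esub> a' j) \<odot> f j = a' j \<odot> f' j"
          unfolding f'_def by (simp add: M.smult_r_distr M.smult_assoc1[symmetric] Z.r_minus Z.m_comm M.a_comm)
      qed simp
      finally show ?thesis using a'(3) by simp
    qed
    ultimately show ?thesis using ac by blast
  qed
qed

lemma lin_indepD:
  assumes "lin_indep Z H S" "a \<in> S \<rightarrow> carrier Z" "(\<Oplus>s\<in>S. a s \<odot> s) = \<zero>" "s \<in> S"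
  shows "a s = \<zero>\<^bsub>Z\<^esub>"
proof -
  have "\<forall>a \<in> S \<rightarrow> carrier Z. (\<Oplus>s\<in>S. a s \<odot> s) = \<zero> \<longrightarrow> (\<forall>s\<in>S. a s = \<zero>\<^bsub>Z\<^esub>)"
    using assms(1) unfolding lin_indep_def by (elim conjE)
  from bspec[OF this assms(2)] show ?thesis using assms(3,4) by (elim impE bspec)
qed

text \<open>This bounds the set of cardinalities of which the rank is the maximum, so that the maximum is attained.\<close>

lemma lin_indep_bound:
  assumes "finite G" "G \<subseteq> carrier H" "gen_submodule Z H G = carrier H" "lin_indep Z H S"
  shows "card S \<le> card G"
proof (rule ccontr)
  assume "\<not> ?thesis"
  then have lt: "card G < card S" by simp
  have S: "finite S" "S \<subseteq> carrier H" using assms(4) by (auto simp: lin_indep_def)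
  have "\<And>s. s \<in> S \<Longrightarrow> s \<in> gen_submodule Z H G" using S assms by auto
  then have "\<exists>a\<in>S \<rightarrow> carrier Z. (\<exists>j\<in>S. a j \<noteq> \<zero>\<^bsub>Z\<^esub>) \<and> (\<Oplus>j\<in>S. a j \<odot> j) = \<zero>"
    by (rule dependent_family[OF assms(1,2) S(1) lt])
  then obtain a where
    "a \<in> S \<rightarrow> carrier Z" "\<exists>j\<in>S. a j \<noteq> \<zero>\<^bsub>Z\<^esub>" "(\<Oplus>j\<in>S. a j \<odot> j) = \<zero>" by (rule bexE, elim conjE) (rule that)
  then show False using lin_indepD[OF assms(4)] by blast
qed

lemma lin_indep_subset:
  assumes "lin_indep Z H S" "T \<subseteq> S" shows "lin_indep Z H T"
  unfolding lin_indep_def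
proof (intro conjI ballI impI)
  have S: "finite S" "S \<subseteq> carrier H" using assms(1) by (auto simp: lin_indep_def)
  show "finite T" "T \<subseteq> carrier H" using S assms(2) finite_subset by auto
  fix a t assume a: "a \<in> T \<rightarrow> carrier Z" and s: "(\<Oplus>s\<in>T. a s \<odot> s) = \<zero>" and t: "t \<in> T"
  define b where "b s = (if s \<in> T then a s else \<zero>\<^bsub>Z\<^esub>)" for s
  have b: "b \<in> S \<rightarrow> carrier Z" using a by (auto simp: b_def)
  have "(\<Oplus>s\<in>T. a s \<odot> s) = (\<Oplus>s\<in>S. b s \<odot> s)"
    using S assms(2) a by (intro M.add.finprod_mono_neutral_cong_left) (auto simp: b_def Pi_def subset_iff)
  then have sb: "(\<Oplus>s\<in>S. b s \<odot> s) = \<zero>" using s by simp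
  have "t \<in> S" using t assms(2) by blast
  then have "b t = \<zero>\<^bsub>Z\<^esub>" by (rule lin_indepD[OF assms(1) b sb])
  then show "a t = \<zero>\<^bsub>Z\<^esub>" using t by (simp add: b_def)
qed

definition nontorsion :: "'a \<Rightarrow> bool" where
  "nontorsion x \<longleftrightarrow> x \<in> carrier H \<and> (\<forall>a\<in>carrier Z. a \<odot> x = \<zero> \<longrightarrow> a = \<zero>\<^bsub>Z\<^esub>)"

lemma lin_indep_single: "lin_indep Z H {x} \<longleftrightarrow> nontorsion x"
proof
  assume l: "lin_indep Z H {x}"
  show "nontorsion x"
    unfolding nontorsion_def
  proof (intro conjI ballI impI)
    show "x \<in> carrier H" using l by (simp add: lin_indep_def)
    fix a assume a: "a \<in> carrier Z" "a \<odot> x = \<zero>"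
    then have "(\<Oplus>s\<in>{x}. a \<odot> s) = \<zero>" using \<open>x \<in> carrier H\<close> by simp
    then show "a = \<zero>\<^bsub>Z\<^esub>" using lin_indepD[OF l, of "\<lambda>_. a" x] a(1) by simp
  qed
next
  assume l: "nontorsion x"
  then show "lin_indep Z H {x}" by (auto simp: lin_indep_def nontorsion_def Pi_def)
qed

lemma rank_1I:
  assumes e: "nontorsion e"
    and dep: "\<And>x. x \<in> carrier H \<Longrightarrow> \<exists>a\<in>carrier Z. \<exists>b\<in>carrier Z. a \<noteq> \<zero>\<^bsub>Z\<^esub> \<and> a \<odot> x = b \<odot> e"
  shows "module_rank Z H = 1"
proof -
  have ec: "e \<in> carrier H" using e by (simp add: nontorsion_def)
  have le: "card S \<le> 1" if S: "lin_indep Z H S" for S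
  proof (rule ccontr)
    assume "\<not> ?thesis"
    then obtain x y where xy: "x \<in> S" "y \<in> S" "x \<noteq> y" by (metis S card_le_Suc0_iff_eq lin_indep_def One_nat_def)
    have l2: "lin_indep Z H {x, y}" and lx: "nontorsion x"
      using lin_indep_subset[OF S, of "{x,y}"] lin_indep_subset[OF S, of "{x}"] xy by (auto simp: lin_indep_single)
    have c: "x \<in> carrier H" "y \<in> carrier H" using l2 by (auto simp: lin_indep_def)
    obtain a b where ab: "a \<in> carrier Z" "b \<in> carrier Z" "a \<noteq> \<zero>\<^bsub>Z\<^esub>" "a \<odot> x = b \<odot> e" using dep[OF c(1)] by blast
    obtain a' b' where ab': "a' \<in> carrier Z" "b' \<in> carrier Z" "a' \<noteq> \<zero>\<^bsub>Z\<^esub>" "a' \<odot> y = b' \<odot> e" using dep[OF c(2)] by blast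
    define f where "f s = (if s = x then b' \<otimes>\<^bsub>Z\<^esub> a else \<ominus>\<^bsub>Z\<^esub> (b \<otimes>\<^bsub>Z\<^esub> a'))" for s
    have f: "f \<in> {x,y} \<rightarrow> carrier Z" using ab ab' by (auto simp: f_def)
    have "(\<Oplus>s\<in>{x,y}. f s \<odot> s) = (b' \<otimes>\<^bsub>Z\<^esub> a) \<odot> x \<oplus> (\<ominus>\<^bsub>Z\<^esub> (b \<otimes>\<^bsub>Z\<^esub> a')) \<odot> y"
      using xy f c by (simp add: f_def Pi_def)
    also have "\<dots> = (b' \<otimes>\<^bsub>Z\<^esub> b) \<odot> e \<oplus> (\<ominus>\<^bsub>Z\<^esub> (b \<otimes>\<^bsub>Z\<^esub> b')) \<odot> e"
      using ab ab' c ec by (simp add: M.smult_assoc1 M.smult_l_minus)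
    also have "\<dots> = \<zero>" using ab ab' ec by (simp add: Z.m_comm M.smult_l_minus M.r_neg)
    finally have "f y = \<zero>\<^bsub>Z\<^esub>" by (rule lin_indepD[OF l2 f]) simp
    then have "b \<otimes>\<^bsub>Z\<^esub> a' = \<zero>\<^bsub>Z\<^esub>" using xy ab ab' by (simp add: f_def)
    then have "b = \<zero>\<^bsub>Z\<^esub>" using Z.integral ab ab' by blast
    then have "a \<odot> x = \<zero>" using ab ec by simp
    then show False using lx ab by (auto simp: nontorsion_def)
  qed
  have "lin_indep Z H {e}" using e by (simp add: lin_indep_single)
  then have "1 \<in> {card S |S. lin_indep Z H S}" by force
  moreover have "finite {card S |S. lin_indep Z H S}" by (rule finite_subset[of _ "{..1}"]) (use le in auto)
  ultimately show ?thesis unfolding module_rank_def using le by (intro Max_eqI) auto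
qed

lemma rank_1D:
  assumes fg: "fin_gen Z H" and rk: "module_rank Z H = 1"
  obtains e where "nontorsion e"
    "\<And>x. x \<in> carrier H \<Longrightarrow> \<exists>a\<in>carrier Z. \<exists>b\<in>carrier Z. a \<noteq> \<zero>\<^bsub>Z\<^esub> \<and> a \<odot> x = b \<odot> e"
proof -
  let ?A = "{card S |S. lin_indep Z H S}"
  obtain G where G: "finite G" "G \<subseteq> carrier H" "gen_submodule Z H G = carrier H" using fg by (auto simp: fin_gen_def)
  have fin: "finite ?A" by (rule finite_subset[of _ "{..card G}"]) (use lin_indep_bound[OF G] in auto)
  have "lin_indep Z H {}" by (simp add: lin_indep_def)
  then have ne: "?A \<noteq> {}" by blast
  have "1 \<in> ?A" using Max_in[OF fin ne] rk by (simp add: module_rank_def)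
  then obtain S where "lin_indep Z H S" "card S = 1" by auto
  then obtain e where e: "lin_indep Z H {e}" by (metis card_1_singletonE)
  then have ee: "nontorsion e" by (simp add: lin_indep_single)
  then have ec: "e \<in> carrier H" by (simp add: nontorsion_def)
  have le: "card S \<le> 1" if "lin_indep Z H S" for S
    using Max_ge[OF fin] that rk by (auto simp: module_rank_def)
  show thesis
  proof (rule that[OF ee])
    fix x assume x: "x \<in> carrier H"
    show "\<exists>a\<in>carrier Z. \<exists>b\<in>carrier Z. a \<noteq> \<zero>\<^bsub>Z\<^esub> \<and> a \<odot> x = b \<odot> e"
    proof (cases "x = e")
      case True then show ?thesis using Z.one_not_zero Z.one_closed by blast
    next
      case False
      then have "\<not> lin_indep Z H {x, e}" using le[of "{x,e}"] by auto
      then obtain a where a: "a \<in> {x,e} \<rightarrow> carrier Z" "(\<Oplus>s\<in>{x,e}. a s \<odot> s) = \<zero>" "a x \<noteq> \<zero>\<^bsub>Z\<^esub> \<or> a e \<noteq> \<zero>\<^bsub>Z\<^esub>"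
        using x ec unfolding lin_indep_def by auto
      have ac: "a x \<in> carrier Z" "a e \<in> carrier Z" using a(1) by auto
      have s: "a x \<odot> x \<oplus> a e \<odot> e = \<zero>" using a(2) False x ec ac by (simp add: Pi_def)
      have "a x \<noteq> \<zero>\<^bsub>Z\<^esub>"
      proof
        assume "a x = \<zero>\<^bsub>Z\<^esub>"
        then have "a e \<odot> e = \<zero>" using s x ec ac by simp
        then have "a e = \<zero>\<^bsub>Z\<^esub>" using ee ac by (auto simp: nontorsion_def)
        then show False using a(3) \<open>a x = \<zero>\<^bsub>Z\<^esub>\<close> by simp
      qed
      moreover have "a x \<odot> x = (\<ominus>\<^bsub>Z\<^esub> a e) \<odot> e"
        using s x ec ac by (simp add: M.smult_l_minus M.minus_equality[symmetric] M.a_comm)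
      ultimately show ?thesis using ac by blast
    qed
  qed
qed

end

section \<open>Linear maps\<close>

lemma lin_hom_iff:
  "f \<in> lin_hom R M N \<longleftrightarrow> (\<forall>x\<in>carrier M. f x \<in> carrier N) \<and>
     (\<forall>x\<in>carrier M. \<forall>y\<in>carrier M. f (x \<oplus>\<^bsub>M\<^esub> y) = f x \<oplus>\<^bsub>N\<^esub> f y) \<and>
     (\<forall>a\<in>carrier R. \<forall>x\<in>carrier M. f (a \<odot>\<^bsub>M\<^esub> x) = a \<odot>\<^bsub>N\<^esub> f x)"
  by (auto simp: lin_hom_def hom_def)

lemma lin_homD:
  assumes "f \<in> lin_hom R M N"
  shows "x \<in> carrier M \<Longrightarrow> f x \<in> carrier N"
    "x \<in> carrier M \<Longrightarrow> y \<in> carrier M \<Longrightarrow> f (x \<oplus>\<^bsub>M\<^esub> y) = f x \<oplus>\<^bsub>N\<^esub> f y"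
    "a \<in> carrier R \<Longrightarrow> x \<in> carrier M \<Longrightarrow> f (a \<odot>\<^bsub>M\<^esub> x) = a \<odot>\<^bsub>N\<^esub> f x"
  using assms by (auto simp: lin_hom_iff)

lemma lin_isoD:
  assumes "f \<in> lin_iso R M N"
  shows "f \<in> lin_hom R M N" "inj_on f (carrier M)" "f ` carrier M = carrier N" "bij_betw f (carrier M) (carrier N)"
  using assms by (auto simp: lin_iso_def bij_betw_def)

lemma lin_isoI:
  "f \<in> lin_hom R M N \<Longrightarrow> inj_on f (carrier M) \<Longrightarrow> f ` carrier M = carrier N \<Longrightarrow> f \<in> lin_iso R M N"
  by (auto simp: lin_iso_def bij_betw_def)

lemma lin_iso_id: "(\<lambda>x. x) \<in> lin_iso R M M"
  by (auto simp: lin_iso_def lin_hom_iff bij_betw_def)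

lemma lin_hom_comp:
  "f \<in> lin_hom R L M \<Longrightarrow> g \<in> lin_hom R M N \<Longrightarrow> (\<lambda>x. g (f x)) \<in> lin_hom R L N"
  by (simp add: lin_hom_iff)

lemma lin_iso_comp:
  "f \<in> lin_iso R L M \<Longrightarrow> g \<in> lin_iso R M N \<Longrightarrow> (\<lambda>x. g (f x)) \<in> lin_iso R L N"
  using bij_betw_trans[of f "carrier L" "carrier M" g "carrier N"]
  by (auto simp: lin_iso_def o_def intro: lin_hom_comp)

lemma lin_iso_inv:
  assumes "Module.module R M" "f \<in> lin_iso R M N"
  shows "inv_into (carrier M) f \<in> lin_iso R N M"
proof -
  interpret M: Module.module R M by fact
  note f = lin_homD[OF lin_isoD(1)[OF assms(2)]] lin_isoD(2-4)[OF assms(2)]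
  let ?g = "inv_into (carrier M) f"
  have b: "bij_betw ?g (carrier N) (carrier M)" using f(6) by (rule bij_betw_inv_into)
  have gc: "x \<in> carrier N \<Longrightarrow> ?g x \<in> carrier M" for x using b by (auto simp: bij_betw_def)
  have fg: "x \<in> carrier N \<Longrightarrow> f (?g x) = x" for x using f(5) by (metis f_inv_into_f)
  have "?g \<in> lin_hom R N M"
    unfolding lin_hom_iff
  proof (intro conjI ballI)
    fix x y assume xy: "x \<in> carrier N" "y \<in> carrier N"
    then show "?g (x \<oplus>\<^bsub>N\<^esub> y) = ?g x \<oplus>\<^bsub>M\<^esub> ?g y"
      by (intro inv_into_f_eq) (use f gc fg in auto)
  next
    fix a x assume ax: "a \<in> carrier R" "x \<in> carrier N"
    then show "?g (a \<odot>\<^bsub>N\<^esub> x) = a \<odot>\<^bsub>M\<^esub> ?g x"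
      by (intro inv_into_f_eq) (use f gc fg in auto)
  qed (use gc in auto)
  then show ?thesis using b by (simp add: lin_iso_def)
qed

section \<open>Modules of rank one\<close>

context padic_module begin

lemma lin_hom_zero:
  assumes "f \<in> lin_hom Z H N" "Module.module Z N"
  shows "f \<zero> = \<zero>\<^bsub>N\<^esub>"
proof -
  interpret N: Module.module Z N by fact
  have "f (\<zero>\<^bsub>Z\<^esub> \<odot> \<zero>) = \<zero>\<^bsub>Z\<^esub> \<odot>\<^bsub>N\<^esub> f \<zero>" using assms(1) by (intro lin_homD(3)) auto
  then show ?thesis using lin_homD(1)[OF assms(1)] by simp
qed

lemma lin_hom_minus:
  assumes "f \<in> lin_hom Z H N" "Module.module Z N" "x \<in> carrier H"
  shows "f (\<ominus> x) = \<ominus>\<^bsub>N\<^esub> f x"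
proof -
  interpret N: Module.module Z N by fact
  have "f (\<ominus> x) \<oplus>\<^bsub>N\<^esub> f x = \<zero>\<^bsub>N\<^esub>"
    using assms(3) lin_homD(2)[OF assms(1), of "\<ominus> x" x] lin_hom_zero[OF assms(1,2)] by (simp add: M.l_neg)
  then show ?thesis using lin_homD(1)[OF assms(1)] assms(3) N.minus_equality by simp
qed

lemma lin_hom_diff:
  assumes "f \<in> lin_hom Z H N" "Module.module Z N" "x \<in> carrier H" "y \<in> carrier H"
  shows "f (x \<ominus> y) = f x \<ominus>\<^bsub>N\<^esub> f y"
  using assms lin_hom_minus[OF assms(1,2)] lin_homD(2)[OF assms(1)] by (simp add: a_minus_def)

lemma smult_commute:
  "a \<in> carrier Z \<Longrightarrow> r \<in> carrier Z \<Longrightarrow> x \<in> carrier H \<Longrightarrow> a \<odot> (r \<odot> x) = r \<odot> (a \<odot> x)"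
  using M.smult_assoc1[of a r x] M.smult_assoc1[of r a x] Z.m_comm[of a r] by simp

lemma submodule_multiple_in_cyclic:
  assumes e: "e \<in> carrier H" and a: "a \<in> carrier Z"
  shows "submodule {x \<in> carrier H. \<exists>b\<in>carrier Z. a \<odot> x = b \<odot> e} Z H"
proof (rule M.submoduleI)
  let ?N = "{x \<in> carrier H. \<exists>b\<in>carrier Z. a \<odot> x = b \<odot> e}"
  show "?N \<subseteq> carrier H" by blast
  have "a \<odot> \<zero> = \<zero>\<^bsub>Z\<^esub> \<odot> e" using a e by simp
  then show "\<zero> \<in> ?N" by blast
next
  let ?N = "{x \<in> carrier H. \<exists>b\<in>carrier Z. a \<odot> x = b \<odot> e}"
  fix x assume "x \<in> ?N"
  then obtain b where b: "b \<in> carrier Z" "a \<odot> x = b \<odot> e" "x \<in> carrier H" by blast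
  then have "a \<odot> (\<ominus> x) = (\<ominus>\<^bsub>Z\<^esub> b) \<odot> e" using a e by (simp add: M.smult_r_minus M.smult_l_minus)
  then show "\<ominus> x \<in> ?N" using b by blast
next
  let ?N = "{x \<in> carrier H. \<exists>b\<in>carrier Z. a \<odot> x = b \<odot> e}"
  fix x y assume "x \<in> ?N" "y \<in> ?N"
  then obtain b c where b: "b \<in> carrier Z" "a \<odot> x = b \<odot> e" "x \<in> carrier H"
    "c \<in> carrier Z" "a \<odot> y = c \<odot> e" "y \<in> carrier H" by blast
  then have "a \<odot> (x \<oplus> y) = (b \<oplus>\<^bsub>Z\<^esub> c) \<odot> e" using a e by (simp add: M.smult_r_distr M.smult_l_distr)
  then show "x \<oplus> y \<in> ?N" using b by blast
next
  let ?N = "{x \<in> carrier H. \<exists>b\<in>carrier Z. a \<odot> x = b \<odot> e}"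
  fix r x assume r: "r \<in> carrier Z" and "x \<in> ?N"
  then obtain b where b: "b \<in> carrier Z" "a \<odot> x = b \<odot> e" "x \<in> carrier H" by blast
  have "a \<odot> (r \<odot> x) = r \<odot> (a \<odot> x)" using a r b by (intro smult_commute)
  also have "\<dots> = (r \<otimes>\<^bsub>Z\<^esub> b) \<odot> e" using r b e by (simp add: M.smult_assoc1)
  finally show "r \<odot> x \<in> ?N" using r b by blast
qed

text \<open>In a relation \<open>a x = b e\<close> the coefficient \<open>a\<close> is a power of \<open>p\<close> up to a unit, and the unit can be moved
to the other side.\<close>

lemma common_exponent:
  assumes "nontorsion e" "finite S" "S \<subseteq> carrier H"
    and dep: "\<And>x. x \<in> carrier H \<Longrightarrow> \<exists>a\<in>carrier Z. \<exists>b\<in>carrier Z. a \<noteq> \<zero>\<^bsub>Z\<^esub> \<and> a \<odot> x = b \<odot> e"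
  shows "\<exists>k. \<forall>x\<in>S. \<exists>b\<in>carrier Z. pint (int p ^ k) \<odot> x = b \<odot> e"
  using assms(2,3)
proof (induction S)
  case (insert x S)
  have e: "e \<in> carrier H" using assms(1) by (simp add: nontorsion_def)
  obtain k where k: "\<forall>x\<in>S. \<exists>b\<in>carrier Z. pint (int p ^ k) \<odot> x = b \<odot> e" using insert by auto
  have x: "x \<in> carrier H" "S \<subseteq> carrier H" using insert by auto
  obtain a b where ab: "a \<in> carrier Z" "b \<in> carrier Z" "a \<noteq> \<zero>\<^bsub>Z\<^esub>" "a \<odot> x = b \<odot> e" using dep[OF x(1)] by blast
  obtain n u where u: "u \<in> carrier Z" "u 1 \<noteq> 0" "a = pint (int p ^ n) \<otimes>\<^bsub>Z\<^esub> u" using Z_factor ab by blast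
  obtain v where v: "v \<in> carrier Z" "u \<otimes>\<^bsub>Z\<^esub> v = \<one>\<^bsub>Z\<^esub>" using Z_unit u by blast
  have pn: "pint (int p ^ n) = v \<otimes>\<^bsub>Z\<^esub> a" using u v by (metis Z.m_assoc Z.m_comm Z.r_one pint_closed)
  then have n: "pint (int p ^ n) \<odot> x = (v \<otimes>\<^bsub>Z\<^esub> b) \<odot> e"
    using v ab x e by (simp add: M.smult_assoc1)
  have up: "\<exists>b\<in>carrier Z. pint (int p ^ (i + j)) \<odot> y = b \<odot> e"
    if hb: "\<exists>b\<in>carrier Z. pint (int p ^ j) \<odot> y = b \<odot> e" and "y \<in> carrier H" for i j y
  proof -
    obtain b where "b \<in> carrier Z" "pint (int p ^ j) \<odot> y = b \<odot> e" using hb by blast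
    then have "pint (int p ^ (i + j)) \<odot> y = (pint (int p ^ i) \<otimes>\<^bsub>Z\<^esub> b) \<odot> e"
      using that e by (simp add: power_add pint_mult M.smult_assoc1)
    then show ?thesis using \<open>b \<in> carrier Z\<close> by blast
  qed
  show ?case
  proof (intro exI[of _ "n + k"] ballI)
    fix y assume "y \<in> insert x S"
    then consider "y = x" | "y \<in> S" by blast
    then show "\<exists>b\<in>carrier Z. pint (int p ^ (n + k)) \<odot> y = b \<odot> e"
    proof cases
      case 1 then show ?thesis using up[of n x k] n x v ab Z.m_closed by (metis add.commute)
    next
      case 2 then show ?thesis using up[of k y n] k x by blast
    qed
  qed
qed auto

text \<open>The decomposition \<open>H = Zp e \<oplus> T\<close> with finite torsion part \<open>T\<close>, given by its first coordinate \<open>\<pi>\<close>;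
\<open>T\<close> is the kernel of \<open>\<pi>\<close>, and \<open>p ^ k\<close> annihilates it.\<close>

definition rank1_split :: "('a \<Rightarrow> padic) \<Rightarrow> 'a \<Rightarrow> nat \<Rightarrow> bool" where
  "rank1_split \<pi> e k \<longleftrightarrow> \<pi> \<in> lin_hom Z H Z \<and> e \<in> carrier H \<and> \<pi> e = \<one>\<^bsub>Z\<^esub> \<and>
     finite {x \<in> carrier H. \<pi> x = \<zero>\<^bsub>Z\<^esub>} \<and>
     (\<forall>x\<in>carrier H. \<pi> x = \<zero>\<^bsub>Z\<^esub> \<longrightarrow> pint (int p ^ k) \<odot> x = \<zero>)"

text \<open>Some power \<open>p ^ k\<close> carries \<open>H\<close> into the free module on a nontorsion element \<open>e0\<close>. The image is a nonzero
ideal, hence generated by an element of least valuation, and dividing by this generator gives a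
surjection \<open>\<pi>\<close> onto the p-adic integers. It splits, and the second coordinates \<open>x - \<pi>(x) e\<close> form a
finitely generated module annihilated by \<open>p ^ k\<close>.\<close>

lemma rank1_split_exists:
  assumes fg: "fin_gen Z H" and rk: "module_rank Z H = 1"
  shows "\<exists>\<pi> e k. rank1_split \<pi> e k"
proof -
  obtain e0 where e0: "nontorsion e0"
    and dep: "\<And>x. x \<in> carrier H \<Longrightarrow> \<exists>a\<in>carrier Z. \<exists>b\<in>carrier Z. a \<noteq> \<zero>\<^bsub>Z\<^esub> \<and> a \<odot> x = b \<odot> e0"
    using rank_1D[OF fg rk] by blast
  have e0c: "e0 \<in> carrier H" and e0t: "\<And>a. a \<in> carrier Z \<Longrightarrow> a \<odot> e0 = \<zero> \<Longrightarrow> a = \<zero>\<^bsub>Z\<^esub>"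
    using e0 by (auto simp: nontorsion_def)
  obtain G where G: "finite G" "G \<subseteq> carrier H" "gen_submodule Z H G = carrier H" using fg by (auto simp: fin_gen_def)
  obtain k where k: "\<forall>x\<in>G. \<exists>b\<in>carrier Z. pint (int p ^ k) \<odot> x = b \<odot> e0"
    using common_exponent[OF e0 G(1,2) dep] by blast
  have "gen_submodule Z H G \<subseteq> {x \<in> carrier H. \<exists>b\<in>carrier Z. pint (int p ^ k) \<odot> x = b \<odot> e0}"
    by (rule gen_least[OF submodule_multiple_in_cyclic[OF e0c]]) (use G k in auto)
  then have kall: "\<exists>b\<in>carrier Z. pint (int p ^ k) \<odot> x = b \<odot> e0" if "x \<in> carrier H" for x
    using G that by blast
  \<comment> \<open>n is the least valuation that occurs among the coordinates of p ^ k x with respect to e0\<close>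
  let ?P = "\<lambda>n. \<exists>x\<in>carrier H. \<exists>u\<in>carrier Z. u 1 \<noteq> 0 \<and> pint (int p ^ k) \<odot> x = (pint (int p ^ n) \<otimes>\<^bsub>Z\<^esub> u) \<odot> e0"
  have "?P k"
  proof (intro bexI conjI)
    show "\<one>\<^bsub>Z\<^esub> 1 \<noteq> 0" using p_gt_1 by (simp add: Z_one)
    show "pint (int p ^ k) \<odot> e0 = (pint (int p ^ k) \<otimes>\<^bsub>Z\<^esub> \<one>\<^bsub>Z\<^esub>) \<odot> e0" by simp
  qed (use e0c in auto)
  define n where "n = (LEAST n. ?P n)"
  have "?P n" unfolding n_def by (rule LeastI[of ?P]) (rule \<open>?P k\<close>)
  then obtain x1 u where x1: "x1 \<in> carrier H" "u \<in> carrier Z" "u 1 \<noteq> 0"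
    "pint (int p ^ k) \<odot> x1 = (pint (int p ^ n) \<otimes>\<^bsub>Z\<^esub> u) \<odot> e0" by blast
  have least: "?P m \<Longrightarrow> n \<le> m" for m unfolding n_def by (rule Least_le)
  have ex: "\<exists>c\<in>carrier Z. pint (int p ^ k) \<odot> x = (pint (int p ^ n) \<otimes>\<^bsub>Z\<^esub> c) \<odot> e0" if x: "x \<in> carrier H" for x
  proof -
    obtain b where b: "b \<in> carrier Z" "pint (int p ^ k) \<odot> x = b \<odot> e0" using kall[OF x] by blast
    show ?thesis
    proof (cases "b = \<zero>\<^bsub>Z\<^esub>")
      case True then have "pint (int p ^ k) \<odot> x = (pint (int p ^ n) \<otimes>\<^bsub>Z\<^esub> \<zero>\<^bsub>Z\<^esub>) \<odot> e0" using b by simp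
      then show ?thesis by blast
    next
      case False
      then obtain m w where w: "w \<in> carrier Z" "w 1 \<noteq> 0" "b = pint (int p ^ m) \<otimes>\<^bsub>Z\<^esub> w" using Z_factor b by blast
      then have "n \<le> m" using least[of m] b x by blast
      then have "pint (int p ^ m) = pint (int p ^ n) \<otimes>\<^bsub>Z\<^esub> pint (int p ^ (m - n))"
        by (simp add: pint_mult[symmetric] power_add[symmetric])
      then have "b = pint (int p ^ n) \<otimes>\<^bsub>Z\<^esub> (pint (int p ^ (m - n)) \<otimes>\<^bsub>Z\<^esub> w)" using w by (simp add: Z.m_assoc)
      then show ?thesis using b w by (metis Z.m_closed pint_closed)
    qed
  qed
  have uniq: "c = d" if "c \<in> carrier Z" "d \<in> carrier Z"
    "(pint (int p ^ n) \<otimes>\<^bsub>Z\<^esub> c) \<odot> e0 = (pint (int p ^ n) \<otimes>\<^bsub>Z\<^esub> d) \<odot> e0" for c d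
  proof -
    have "(pint (int p ^ n) \<otimes>\<^bsub>Z\<^esub> (c \<oplus>\<^bsub>Z\<^esub> (\<ominus>\<^bsub>Z\<^esub> d))) \<odot> e0 = \<zero>"
      using that e0c by (simp add: Z.r_distr M.smult_l_distr Z.r_minus M.smult_l_minus M.r_neg)
    then have "pint (int p ^ n) \<otimes>\<^bsub>Z\<^esub> (c \<oplus>\<^bsub>Z\<^esub> (\<ominus>\<^bsub>Z\<^esub> d)) = \<zero>\<^bsub>Z\<^esub>" by (rule e0t[rotated]) (use that in simp)
    then have "c \<oplus>\<^bsub>Z\<^esub> (\<ominus>\<^bsub>Z\<^esub> d) = \<zero>\<^bsub>Z\<^esub>" by (rule p_power_mult_eq_0[rotated]) (use that in simp)
    then show ?thesis using that Z.minus_equality[of c "\<ominus>\<^bsub>Z\<^esub> d"] by simp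
  qed
  define \<pi> where "\<pi> x = (THE c. c \<in> carrier Z \<and> pint (int p ^ k) \<odot> x = (pint (int p ^ n) \<otimes>\<^bsub>Z\<^esub> c) \<odot> e0)" for x
  have piI: "\<pi> x = c" if "c \<in> carrier Z" "pint (int p ^ k) \<odot> x = (pint (int p ^ n) \<otimes>\<^bsub>Z\<^esub> c) \<odot> e0" for x c
    unfolding \<pi>_def by (rule the_equality) (use that uniq in auto)
  have pic: "\<pi> x \<in> carrier Z" and pieq: "pint (int p ^ k) \<odot> x = (pint (int p ^ n) \<otimes>\<^bsub>Z\<^esub> \<pi> x) \<odot> e0"
    if "x \<in> carrier H" for x using ex[OF that] piI by auto
  have hom: "\<pi> \<in> lin_hom Z H Z"
    unfolding lin_hom_iff Z_smult
  proof (intro conjI ballI)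
    fix x y assume xy: "x \<in> carrier H" "y \<in> carrier H"
    show "\<pi> (x \<oplus> y) = \<pi> x \<oplus>\<^bsub>Z\<^esub> \<pi> y"
      by (rule piI) (use xy pic pieq e0c in \<open>simp_all add: M.smult_r_distr Z.r_distr M.smult_l_distr\<close>)
  next
    fix a x assume ax: "a \<in> carrier Z" "x \<in> carrier H"
    have "pint (int p ^ k) \<odot> (a \<odot> x) = a \<odot> (pint (int p ^ k) \<odot> x)"
      using ax by (intro smult_commute) auto
    also have "\<dots> = (pint (int p ^ n) \<otimes>\<^bsub>Z\<^esub> (a \<otimes>\<^bsub>Z\<^esub> \<pi> x)) \<odot> e0"
      using ax pic e0c by (simp add: pieq M.smult_assoc1[symmetric] Z.m_lcomm)
    finally show "\<pi> (a \<odot> x) = a \<otimes>\<^bsub>Z\<^esub> \<pi> x" using ax pic by (intro piI) auto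
  qed (use pic in auto)
  obtain v where v: "v \<in> carrier Z" "u \<otimes>\<^bsub>Z\<^esub> v = \<one>\<^bsub>Z\<^esub>" using Z_unit x1 by blast
  define e where "e = v \<odot> x1"
  have ec: "e \<in> carrier H" using v x1 by (simp add: e_def)
  have "\<pi> x1 = u" by (rule piI) (use x1 in auto)
  then have pie: "\<pi> e = \<one>\<^bsub>Z\<^esub>" using lin_homD(3)[OF hom v(1) x1(1)] v x1 by (simp add: e_def Z_smult Z.m_comm)
  have kill: "pint (int p ^ k) \<odot> x = \<zero>" if "x \<in> carrier H" "\<pi> x = \<zero>\<^bsub>Z\<^esub>" for x
    using pieq[OF that(1)] that e0c by simp
  \<comment> \<open>the projection onto the torsion part; it maps generators to generators\<close>
  define \<tau> where "\<tau> x = x \<ominus> \<pi> x \<odot> e" for x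
  have tc: "\<tau> x \<in> carrier H" if "x \<in> carrier H" for x using that pic ec by (simp add: \<tau>_def)
  have tk: "\<pi> (\<tau> x) = \<zero>\<^bsub>Z\<^esub>" if "x \<in> carrier H" for x
  proof -
    have "\<pi> (\<tau> x) = \<pi> x \<ominus>\<^bsub>Z\<^esub> \<pi> (\<pi> x \<odot> e)"
      unfolding \<tau>_def using that pic ec by (intro lin_hom_diff[OF hom Z_module]) auto
    also have "\<pi> (\<pi> x \<odot> e) = \<pi> x"
      using that pic ec pie by (simp add: lin_homD(3)[OF hom] Z_smult)
    finally show ?thesis using that pic by (simp add: a_minus_def Z.r_neg)
  qed
  have "finite (\<tau> ` G)" using G by simp
  moreover have tGc: "\<tau> ` G \<subseteq> carrier H" using tc G by auto
  moreover have "pint (int p ^ k) \<odot> s = \<zero>" if "s \<in> \<tau> ` G" for s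
    using that kill[OF tc tk] G by auto
  ultimately have fin: "finite (gen_submodule Z H (\<tau> ` G))" by (rule gen_torsion_finite)
  have tau_add: "\<tau> (x \<oplus> y) = \<tau> x \<oplus> \<tau> y" if "x \<in> carrier H" "y \<in> carrier H" for x y
    using that pic ec lin_homD(2)[OF hom] by (simp add: \<tau>_def a_minus_def M.smult_l_distr M.minus_add M.add.m_ac)
  have tau_smult: "\<tau> (a \<odot> x) = a \<odot> \<tau> x" if "a \<in> carrier Z" "x \<in> carrier H" for a x
    using that pic ec lin_homD(3)[OF hom]
    by (simp add: \<tau>_def a_minus_def Z_smult M.smult_r_distr M.smult_r_minus M.smult_assoc1)
  let ?N = "{x \<in> carrier H. \<tau> x \<in> gen_submodule Z H (\<tau> ` G)}"
  note GS = gen_submodule_is_submodule[OF tGc]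
  have "submodule ?N Z H"
  proof (rule M.submoduleI)
    have "\<tau> (\<zero>\<^bsub>Z\<^esub> \<odot> \<zero>) = \<zero>\<^bsub>Z\<^esub> \<odot> \<tau> \<zero>" by (rule tau_smult) auto
    then have "\<tau> \<zero> = \<zero>" using tc by simp
    then show "\<zero> \<in> ?N" using GS by (auto simp: submodule_def dest: subgroup.one_closed)
  next
    fix a assume a: "a \<in> ?N"
    have "\<tau> (\<ominus> a) = \<tau> ((\<ominus>\<^bsub>Z\<^esub> \<one>\<^bsub>Z\<^esub>) \<odot> a)" using a by (simp add: M.smult_l_minus)
    also have "\<dots> = (\<ominus>\<^bsub>Z\<^esub> \<one>\<^bsub>Z\<^esub>) \<odot> \<tau> a" using a by (simp add: tau_smult)
    finally show "\<ominus> a \<in> ?N" using a M.submoduleE(4)[OF GS] by simp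
  qed (use tau_add tau_smult M.submoduleE(4,5)[OF GS] in auto)
  then have "gen_submodule Z H G \<subseteq> ?N" by (rule gen_least) (use G(2) gen_incl[of "\<tau> ` G"] in blast)
  then have "carrier H \<subseteq> ?N" using G by simp
  then have "{x \<in> carrier H. \<pi> x = \<zero>\<^bsub>Z\<^esub>} \<subseteq> gen_submodule Z H (\<tau> ` G)"
  proof (safe)
    fix x assume x: "x \<in> carrier H" "\<pi> x = \<zero>\<^bsub>Z\<^esub>" and "carrier H \<subseteq> ?N"
    then have "\<tau> x \<in> gen_submodule Z H (\<tau> ` G)" by blast
    moreover have "\<tau> x = x" using x ec by (simp add: \<tau>_def a_minus_def)
    ultimately show "x \<in> gen_submodule Z H (\<tau> ` G)" by simp
  qed
  then have "finite {x \<in> carrier H. \<pi> x = \<zero>\<^bsub>Z\<^esub>}" using fin finite_subset by blast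
  then show ?thesis using hom ec pie kill unfolding rank1_split_def by blast
qed

end

section \<open>Exact sequences\<close>

context padic begin

lemma pgroupD:
  assumes "G \<in> pgroups p"
  shows "comm_group G" "group G" "finite (carrier G)" "order G = p ^ multiplicity p (order G)"
proof -
  show "comm_group G" "finite (carrier G)" using assms by (auto simp: pgroups_def)
  then show "group G" by (simp add: comm_group_def)
  obtain n where "order G = p ^ n" using assms by (auto simp: pgroups_def)
  then show "order G = p ^ multiplicity p (order G)" using prime p_gt_1 by (simp add: multiplicity_same_power)
qed

lemma pgroup_pow_mod:
  assumes "G \<in> pgroups p" "x \<in> carrier G"
  shows "x [^]\<^bsub>G\<^esub> (z mod int p ^ multiplicity p (order G)) = x [^]\<^bsub>G\<^esub> z"
proof -
  interpret group G using pgroupD assms by blast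
  have "int (ord x) dvd int p ^ multiplicity p (order G)"
    using ord_dvd_group_order[OF assms(2)] pgroupD(4)[OF assms(1)] by (metis of_nat_dvd_iff of_nat_power)
  moreover have "int p ^ multiplicity p (order G) dvd z - z mod int p ^ multiplicity p (order G)"
    by (simp add: minus_mod_eq_mult_div)
  ultimately show ?thesis using int_pow_eq[OF assms(2)] dvd_trans by blast
qed

lemma pgroup_module_simps [simp]:
  "carrier (pgroup_module p G) = carrier G" "x \<oplus>\<^bsub>pgroup_module p G\<^esub> y = x \<otimes>\<^bsub>G\<^esub> y"
  "\<zero>\<^bsub>pgroup_module p G\<^esub> = \<one>\<^bsub>G\<^esub>"
  "a \<odot>\<^bsub>pgroup_module p G\<^esub> x = x [^]\<^bsub>G\<^esub> a (multiplicity p (order G))"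
  by (simp_all add: pgroup_module_def)

lemma pgroup_module_is_module:
  assumes G: "G \<in> pgroups p"
  shows "Module.module Z (pgroup_module p G)"
proof -
  interpret comm_group G using pgroupD(1)[OF G] .
  let ?N = "multiplicity p (order G)"
  note mo = pgroup_pow_mod[OF G]
  have ab: "abelian_group (pgroup_module p G)"
    by (rule abelian_groupI) (simp_all add: m_ac l_inv_ex)
  show ?thesis
  proof (rule Module.moduleI[OF Z_cring ab], unfold pgroup_module_def, simp_all)
    fix a b x assume "a \<in> carrier Z" "b \<in> carrier Z" "x \<in> carrier G"
    then show "x [^]\<^bsub>G\<^esub> (a \<oplus>\<^bsub>Z\<^esub> b) ?N = x [^]\<^bsub>G\<^esub> a ?N \<otimes>\<^bsub>G\<^esub> x [^]\<^bsub>G\<^esub> b ?N"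
      by (simp add: Z_add mo int_pow_mult)
    show "x [^]\<^bsub>G\<^esub> (a \<otimes>\<^bsub>Z\<^esub> b) ?N = (x [^]\<^bsub>G\<^esub> b ?N) [^]\<^bsub>G\<^esub> a ?N"
      using \<open>x \<in> carrier G\<close> by (simp add: Z_mult mo int_pow_pow mult.commute)
  next
    fix a x y assume "a \<in> carrier Z" "x \<in> carrier G" "y \<in> carrier G"
    then show "(x \<otimes>\<^bsub>G\<^esub> y) [^]\<^bsub>G\<^esub> a ?N = x [^]\<^bsub>G\<^esub> a ?N \<otimes>\<^bsub>G\<^esub> y [^]\<^bsub>G\<^esub> a ?N"
      by (intro int_pow_distrib)
  next
    fix x assume "x \<in> carrier G"
    then show "x [^]\<^bsub>G\<^esub> \<one>\<^bsub>Z\<^esub> ?N = x" by (simp add: Z_one mo)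
  qed
qed

text \<open>A p-adic integer differs from a natural number by a multiple of the order of \<open>G\<close>, and that multiple acts
trivially on \<open>G\<close>.\<close>

lemma hom_pgroup_linear:
  fixes H :: "(padic, 'a, 'm) module_scheme"
  assumes H: "Module.module Z H" and G: "G \<in> pgroups p" and f: "f \<in> hom (add_monoid H) G"
  shows "f \<in> lin_hom Z H (pgroup_module p G)"
proof -
  interpret padic_module p H by (intro padic_module.intro padic_axioms H)
  interpret G: comm_group G using pgroupD(1)[OF G] .
  let ?N = "multiplicity p (order G)"
  have fc: "f x \<in> carrier G" if "x \<in> carrier H" for x using f that by (auto simp: hom_def)
  have fadd: "f (x \<oplus>\<^bsub>H\<^esub> y) = f x \<otimes>\<^bsub>G\<^esub> f y" if "x \<in> carrier H" "y \<in> carrier H" for x y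
    using f that by (auto simp: hom_def)
  have fpow: "f (pint (int k) \<odot>\<^bsub>H\<^esub> x) = f x [^]\<^bsub>G\<^esub> k" if "x \<in> carrier H" for k x
    using hom_nat_pow[OF f, of x k] that M.a_group G.is_group by (simp add: add_pow_smult[symmetric] add_pow_def)
  have "f (a \<odot>\<^bsub>H\<^esub> x) = f x [^]\<^bsub>G\<^esub> a ?N" if a: "a \<in> carrier Z" and x: "x \<in> carrier H" for a x
  proof -
    obtain b where b: "b \<in> carrier Z" "a = pint (a ?N) \<oplus>\<^bsub>Z\<^esub> pint (int p ^ ?N) \<otimes>\<^bsub>Z\<^esub> b" using residue_decomposition[OF a] by blast
    have k: "a ?N = int (nat (a ?N))" using Z_bounds(1)[OF a] by simp
    have "a \<odot>\<^bsub>H\<^esub> x = pint (int (nat (a ?N))) \<odot>\<^bsub>H\<^esub> x \<oplus>\<^bsub>H\<^esub> pint (int (p ^ ?N)) \<odot>\<^bsub>H\<^esub> (b \<odot>\<^bsub>H\<^esub> x)"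
      using b(1) x by (subst b(2), subst k) (simp add: M.smult_l_distr M.smult_assoc1)
    then have "f (a \<odot>\<^bsub>H\<^esub> x) = f x [^]\<^bsub>G\<^esub> nat (a ?N) \<otimes>\<^bsub>G\<^esub> f (b \<odot>\<^bsub>H\<^esub> x) [^]\<^bsub>G\<^esub> (p ^ ?N)"
      using b(1) x by (simp only: fadd fpow M.smult_closed pint_closed)
    also have "f (b \<odot>\<^bsub>H\<^esub> x) [^]\<^bsub>G\<^esub> (p ^ ?N) = \<one>\<^bsub>G\<^esub>"
      using G.pow_order_eq_1[of "f (b \<odot>\<^bsub>H\<^esub> x)"] fc b(1) x pgroupD(4)[OF G] by simp
    also have "f x [^]\<^bsub>G\<^esub> nat (a ?N) = f x [^]\<^bsub>G\<^esub> a ?N" by (metis k int_pow_int)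
    finally show ?thesis using fc x by simp
  qed
  then show ?thesis using fc fadd by (simp add: lin_hom_iff pgroup_module_def)
qed

lemma exact_seqI:
  assumes "Module.module Z H" "G \<in> pgroups p" "i \<in> lin_hom Z Z H" "q \<in> hom (add_monoid H) G"
    "inj_on i (carrier Z)" "q ` carrier H = carrier G"
    "\<And>x. x \<in> carrier H \<Longrightarrow> q x = \<one>\<^bsub>G\<^esub> \<longleftrightarrow> x \<in> i ` carrier Z"
  shows "\<lparr>middle = H, incl = i, quot = G, proj = q\<rparr> \<in> exact_seqs p"
proof -
  have "i ` carrier Z \<subseteq> carrier H" using assms(3) by (auto simp: lin_hom_iff)
  then have "i ` carrier Z = kernel (add_monoid H) G q"
    using assms(7) by (auto simp: kernel_def)
  then show ?thesis using assms hom_pgroup_linear[OF assms(1,2,4)] by (simp add: exact_seqs_def)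
qed

end

locale exact_sequence = padic p for p +
  fixes s :: exseq
  assumes s: "s \<in> exact_seqs p"
begin

sublocale padic_module p "middle s"
  using s by (intro padic_module.intro padic_axioms) (simp add: exact_seqs_def)

abbreviation "H \<equiv> middle s"
abbreviation "i \<equiv> incl s"
abbreviation "q \<equiv> proj s"
abbreviation "G \<equiv> quot s"
abbreviation "N \<equiv> multiplicity p (order G)"

lemma G_pgroup: "G \<in> pgroups p" and i_lin: "i \<in> lin_hom Z Z H" and q_lin: "q \<in> lin_hom Z H (pgroup_module p G)"
  and i_inj: "inj_on i (carrier Z)" and q_surj: "q ` carrier H = carrier G"
  and q_ker: "x \<in> carrier H \<Longrightarrow> q x = \<one>\<^bsub>G\<^esub> \<longleftrightarrow> x \<in> i ` carrier Z"
  using s by (auto simp: exact_seqs_def kernel_def)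

lemma i_closed [simp]: "a \<in> carrier Z \<Longrightarrow> i a \<in> carrier H"
  and q_closed [simp]: "x \<in> carrier H \<Longrightarrow> q x \<in> carrier G"
  using lin_homD(1)[OF i_lin] lin_homD(1)[OF q_lin] by auto

sublocale G: comm_group "quot s" by (rule pgroupD(1)[OF G_pgroup])

lemma q_add: "x \<in> carrier H \<Longrightarrow> y \<in> carrier H \<Longrightarrow> q (x \<oplus>\<^bsub>H\<^esub> y) = q x \<otimes>\<^bsub>G\<^esub> q y"
  and q_smult: "a \<in> carrier Z \<Longrightarrow> x \<in> carrier H \<Longrightarrow> q (a \<odot>\<^bsub>H\<^esub> x) = q x [^]\<^bsub>G\<^esub> a N"
  using lin_homD(2,3)[OF q_lin] by auto

lemma q_hom: "q \<in> hom (add_monoid H) G"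
  using q_add by (simp add: hom_def)

lemma q_zero: "q \<zero>\<^bsub>H\<^esub> = \<one>\<^bsub>G\<^esub>"
  using lin_hom_zero[OF q_lin pgroup_module_is_module[OF G_pgroup]] by simp

lemma q_i [simp]: "a \<in> carrier Z \<Longrightarrow> q (i a) = \<one>\<^bsub>G\<^esub>"
  using q_ker[of "i a"] by simp

lemma i_eq: "a \<in> carrier Z \<Longrightarrow> i a = a \<odot>\<^bsub>H\<^esub> i \<one>\<^bsub>Z\<^esub>"
  using lin_homD(3)[OF i_lin, of a "\<one>\<^bsub>Z\<^esub>"] by (simp add: Z_smult)

lemma i_add: "a \<in> carrier Z \<Longrightarrow> b \<in> carrier Z \<Longrightarrow> i (a \<oplus>\<^bsub>Z\<^esub> b) = i a \<oplus>\<^bsub>H\<^esub> i b"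
  and i_mult: "a \<in> carrier Z \<Longrightarrow> b \<in> carrier Z \<Longrightarrow> i (a \<otimes>\<^bsub>Z\<^esub> b) = a \<odot>\<^bsub>H\<^esub> i b"
  using lin_homD(2,3)[OF i_lin] by (auto simp: Z_smult)

lemma i_image: "i ` carrier Z = gen_submodule Z H {i \<one>\<^bsub>Z\<^esub>}"
proof -
  have "i ` carrier Z = (\<lambda>a. a \<odot>\<^bsub>H\<^esub> i \<one>\<^bsub>Z\<^esub>) ` carrier Z"
    by (rule image_cong[OF refl]) (rule i_eq)
  then show ?thesis by (simp add: gen_singleton)
qed

lemma i_zero: "i \<zero>\<^bsub>Z\<^esub> = \<zero>\<^bsub>H\<^esub>"
  using i_eq[of "\<zero>\<^bsub>Z\<^esub>"] by simp

lemma i_one_nontorsion: "nontorsion (i \<one>\<^bsub>Z\<^esub>)"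
  unfolding nontorsion_def
proof (intro conjI ballI impI)
  fix a assume a: "a \<in> carrier Z" "a \<odot>\<^bsub>H\<^esub> i \<one>\<^bsub>Z\<^esub> = \<zero>\<^bsub>H\<^esub>"
  then have "i a = i \<zero>\<^bsub>Z\<^esub>" using i_eq[OF a(1)] i_zero by simp
  then show "a = \<zero>\<^bsub>Z\<^esub>" using i_inj a(1) by (auto dest: inj_onD)
qed simp

lemma q_eq_iff:
  assumes "x \<in> carrier H" "y \<in> carrier H"
  shows "q x = q y \<longleftrightarrow> (\<exists>a\<in>carrier Z. x = y \<oplus>\<^bsub>H\<^esub> i a)"
proof
  assume "q x = q y"
  let ?d = "\<ominus>\<^bsub>H\<^esub> y \<oplus>\<^bsub>H\<^esub> x"
  have "q ?d = \<one>\<^bsub>G\<^esub>"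
    using assms \<open>q x = q y\<close> q_add[of "\<ominus>\<^bsub>H\<^esub> y" x] q_add[of "\<ominus>\<^bsub>H\<^esub> y" y] q_zero by (simp add: M.l_neg)
  then obtain a where "a \<in> carrier Z" "?d = i a" using q_ker[of ?d] assms by auto
  then have "x = y \<oplus>\<^bsub>H\<^esub> i a" using assms by (metis M.r_neg2 M.add.inv_closed M.r_neg1 M.r_neg M.a_assoc M.l_zero)
  then show "\<exists>a\<in>carrier Z. x = y \<oplus>\<^bsub>H\<^esub> i a" using \<open>a \<in> carrier Z\<close> by blast
next
  assume "\<exists>a\<in>carrier Z. x = y \<oplus>\<^bsub>H\<^esub> i a"
  then show "q x = q y" using assms by (auto simp: q_add)
qed

text \<open>The power \<open>p ^ N\<close> is the order of \<open>G\<close> and annihilates \<open>G\<close>.\<close>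

lemma pN_in_image:
  assumes "x \<in> carrier H" shows "\<exists>a\<in>carrier Z. i a = pint (int p ^ N) \<odot>\<^bsub>H\<^esub> x"
proof -
  have "q (pint (int p ^ N) \<odot>\<^bsub>H\<^esub> x) = \<one>\<^bsub>G\<^esub>"
  proof -
    have "pint (int p ^ N) N = 0" by (simp add: pint_def)
    then show ?thesis using assms by (simp add: q_smult)
  qed
  then show ?thesis using q_ker[of "pint (int p ^ N) \<odot>\<^bsub>H\<^esub> x"] assms by auto
qed

text \<open>The image of \<open>1\<close> and lifts of the elements of \<open>G\<close> generate; and as \<open>p ^ N\<close> maps the middle term into
the image of the p-adic integers, any element depends on the image of \<open>1\<close>.\<close>

lemma middle_rank1: "H \<in> rank1_modules p"
proof -
  have "module_rank Z H = 1"
  proof (rule rank_1I[OF i_one_nontorsion])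
    fix x assume "x \<in> carrier H"
    then show "\<exists>a\<in>carrier Z. \<exists>b\<in>carrier Z. a \<noteq> \<zero>\<^bsub>Z\<^esub> \<and> a \<odot>\<^bsub>H\<^esub> x = b \<odot>\<^bsub>H\<^esub> i \<one>\<^bsub>Z\<^esub>"
      using pN_in_image[of x] i_eq pint_pow_nz[of N] by (metis pint_closed)
  qed
  moreover have "fin_gen Z H"
  proof -
    define \<sigma> where "\<sigma> = inv_into (carrier H) q"
    have \<sigma>: "\<sigma> g \<in> carrier H" "q (\<sigma> g) = g" if "g \<in> carrier G" for g
      using that q_surj by (simp_all add: \<sigma>_def inv_into_into f_inv_into_f)
    let ?S = "insert (i \<one>\<^bsub>Z\<^esub>) (\<sigma> ` carrier G)"
    have S: "?S \<subseteq> carrier H" using \<sigma> by auto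
    note sm = gen_submodule_is_submodule[OF S]
    have "x \<in> gen_submodule Z H ?S" if x: "x \<in> carrier H" for x
    proof -
      have "q x = q (\<sigma> (q x))" using \<sigma> x by simp
      then obtain a where a: "a \<in> carrier Z" "x = \<sigma> (q x) \<oplus>\<^bsub>H\<^esub> i a" using q_eq_iff[of x "\<sigma> (q x)"] \<sigma> x by auto
      have "\<sigma> (q x) \<in> gen_submodule Z H ?S" using gen_incl[of ?S] x by auto
      moreover have "i a \<in> gen_submodule Z H ?S"
        using M.submoduleE(4)[OF sm a(1), of "i \<one>\<^bsub>Z\<^esub>"] gen_incl[of ?S] i_eq[OF a(1)] by auto
      ultimately show ?thesis using M.submoduleE(5)[OF sm] a(2) by metis
    qed
    then have "gen_submodule Z H ?S = carrier H" using gen_closed[OF S] by blast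
    moreover have "finite ?S" using pgroupD(3)[OF G_pgroup] by simp
    ultimately show ?thesis using S unfolding fin_gen_def by blast
  qed
  ultimately show ?thesis using M.module_axioms by (simp add: rank1_modules_def)
qed

text \<open>The p-adic integer \<open>p ^ N x\<close>. Divided by \<open>p ^ N\<close> it is the unique extension of the inclusion of the p-adic
integers in their field of fractions to a linear map on the middle term.\<close>

definition lam :: "univ \<Rightarrow> padic" where
  "lam x = (THE a. a \<in> carrier Z \<and> i a = pint (int p ^ N) \<odot>\<^bsub>H\<^esub> x)"

lemma lamI:
  assumes "x \<in> carrier H" "a \<in> carrier Z" "i a = pint (int p ^ N) \<odot>\<^bsub>H\<^esub> x"
  shows "lam x = a"
  unfolding lam_def
proof (rule the_equality)
  show "a \<in> carrier Z \<and> i a = pint (int p ^ N) \<odot>\<^bsub>H\<^esub> x" using assms by blast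
  fix b assume b: "b \<in> carrier Z \<and> i b = pint (int p ^ N) \<odot>\<^bsub>H\<^esub> x"
  then have "i b = i a" using assms(3) by (elim conjE) (rule trans, assumption, rule sym)
  then show "b = a" using inj_onD[OF i_inj] assms(2) b by blast
qed

lemma lam_closed: "x \<in> carrier H \<Longrightarrow> lam x \<in> carrier Z"
  and lam_eq: "x \<in> carrier H \<Longrightarrow> i (lam x) = pint (int p ^ N) \<odot>\<^bsub>H\<^esub> x"
  using pN_in_image[of x] lamI[of x] by auto

lemma lam_lin: "lam \<in> lin_hom Z H Z"
  unfolding lin_hom_iff Z_smult
proof (intro conjI ballI)
  fix x y assume "x \<in> carrier H" "y \<in> carrier H"
  then show "lam (x \<oplus>\<^bsub>H\<^esub> y) = lam x \<oplus>\<^bsub>Z\<^esub> lam y"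
    by (intro lamI) (auto simp: lam_closed lam_eq i_add M.smult_r_distr)
next
  fix a x assume "a \<in> carrier Z" "x \<in> carrier H"
  then show "lam (a \<odot>\<^bsub>H\<^esub> x) = a \<otimes>\<^bsub>Z\<^esub> lam x"
    by (intro lamI) (auto simp: lam_closed lam_eq i_mult smult_commute)
qed (rule lam_closed)

lemma lam_i: "a \<in> carrier Z \<Longrightarrow> lam (i a) = pint (int p ^ N) \<otimes>\<^bsub>Z\<^esub> a"
  by (rule lamI) (auto simp: i_mult)

text \<open>Two elements with the same image in \<open>G\<close> differ by a p-adic integer \<open>a\<close>, and \<open>lam\<close> sees \<open>p ^ N a\<close>.\<close>

lemma lam_q_inj:
  assumes "x \<in> carrier H" "y \<in> carrier H" "lam x = lam y" "q x = q y" shows "x = y"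
proof -
  obtain a where a: "a \<in> carrier Z" "x = y \<oplus>\<^bsub>H\<^esub> i a" using q_eq_iff assms by blast
  then have "lam x = lam y \<oplus>\<^bsub>Z\<^esub> pint (int p ^ N) \<otimes>\<^bsub>Z\<^esub> a"
    using lin_homD(2)[OF lam_lin assms(2)] lam_i by simp
  then have "lam y \<oplus>\<^bsub>Z\<^esub> pint (int p ^ N) \<otimes>\<^bsub>Z\<^esub> a = lam y" using assms(3) by simp
  then have "pint (int p ^ N) \<otimes>\<^bsub>Z\<^esub> a = \<zero>\<^bsub>Z\<^esub>"
    using lam_closed[OF assms(2)] a(1) by simp
  then have "a = \<zero>\<^bsub>Z\<^esub>" using p_power_mult_eq_0 a by blast
  then show ?thesis using a assms i_zero by simp
qed

lemma lam_mod:
  assumes "x \<in> carrier H" "y \<in> carrier H" "q x = q y" shows "lam x N = lam y N"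
proof -
  obtain a where a: "a \<in> carrier Z" "x = y \<oplus>\<^bsub>H\<^esub> i a" using q_eq_iff assms by blast
  then have "lam x = lam y \<oplus>\<^bsub>Z\<^esub> pint (int p ^ N) \<otimes>\<^bsub>Z\<^esub> a"
    using lin_homD(2)[OF lam_lin assms(2)] lam_i by simp
  then show ?thesis using Z_mod_self[OF lam_closed[OF assms(2)]] by (simp add: Z_add Z_mult pint_def)
qed

text \<open>Together with \<open>lam_q_inj\<close> and \<open>lam_mod\<close> this identifies the middle term with the set of pairs \<open>(a, g)\<close> in
which \<open>g\<close> prescribes the residue of \<open>a\<close> modulo \<open>p ^ N\<close>.\<close>

lemma lam_lift:
  assumes "y \<in> carrier H" "a \<in> carrier Z" "a N = lam y N"
  shows "\<exists>x\<in>carrier H. q x = q y \<and> lam x = a"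
proof -
  obtain b where b: "b \<in> carrier Z" "a = pint (a N) \<oplus>\<^bsub>Z\<^esub> pint (int p ^ N) \<otimes>\<^bsub>Z\<^esub> b" using residue_decomposition assms by blast
  obtain c where c: "c \<in> carrier Z" "lam y = pint (a N) \<oplus>\<^bsub>Z\<^esub> pint (int p ^ N) \<otimes>\<^bsub>Z\<^esub> c"
    using residue_decomposition[OF lam_closed[OF assms(1)], of N] assms(3) by auto
  let ?d = "b \<ominus>\<^bsub>Z\<^esub> c" let ?x = "y \<oplus>\<^bsub>H\<^esub> i ?d"
  have "lam ?x = lam y \<oplus>\<^bsub>Z\<^esub> pint (int p ^ N) \<otimes>\<^bsub>Z\<^esub> ?d"
    using lin_homD(2)[OF lam_lin assms(1)] lam_i b c by simp
  also have "\<dots> = pint (a N) \<oplus>\<^bsub>Z\<^esub> (pint (int p ^ N) \<otimes>\<^bsub>Z\<^esub> (c \<oplus>\<^bsub>Z\<^esub> ?d))"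
    using b c(1) by (subst c(2)) (simp add: Z.a_assoc Z.r_distr)
  also have "c \<oplus>\<^bsub>Z\<^esub> ?d = b" using b c
    by (simp add: a_minus_def Z.a_lcomm Z.r_neg)
  also have "pint (a N) \<oplus>\<^bsub>Z\<^esub> (pint (int p ^ N) \<otimes>\<^bsub>Z\<^esub> b) = a" using b(2) by simp
  finally show ?thesis using assms b c by (intro bexI[of _ ?x]) (auto simp: q_add)
qed

end

section \<open>Isomorphism classes\<close>

lemma rep_in_class:
  assumes "equiv A r" "c \<in> A // r"
  shows "rep c \<in> c" "rep c \<in> A" "c = r `` {rep c}"
proof -
  obtain x where x: "c = r `` {x}" "x \<in> A" using assms(2) by (rule quotientE)
  then have "x \<in> c" using equiv_class_self[OF assms(1)] by simp
  then show c: "rep c \<in> c" unfolding rep_def by (rule someI)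
  then show "rep c \<in> A" using x assms(1) by (auto simp: equiv_def)
  show "c = r `` {rep c}" using c x equiv_class_eq[OF assms(1), of x "rep c"] by simp
qed

context padic begin

lemma grp_iso_equiv: "equiv (pgroups p) (grp_iso_rel p)"
proof (rule equivI)
  show "grp_iso_rel p \<subseteq> pgroups p \<times> pgroups p" by (auto simp: grp_iso_rel_def)
  show "refl_on (pgroups p) (grp_iso_rel p)" by (auto simp: refl_on_def grp_iso_rel_def)
  show "sym (grp_iso_rel p)" using group.iso_sym pgroupD(2) by (fastforce simp: sym_def grp_iso_rel_def)
  show "trans (grp_iso_rel p)" by (auto simp: trans_def grp_iso_rel_def intro: iso_trans)
qed

lemma rank1D:
  assumes "H \<in> rank1_modules p"
  shows "Module.module Z H" "fin_gen Z H" "module_rank Z H = 1" "padic_module p H"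
  using assms padic_axioms by (auto simp: rank1_modules_def intro: padic_module.intro)

lemma zmod_isomorphic_sym: "Module.module Z H \<Longrightarrow> zmod_isomorphic p H H' \<Longrightarrow> zmod_isomorphic p H' H"
  using lin_iso_inv by (fastforce simp: zmod_isomorphic_def)

lemma zmod_isomorphic_trans: "zmod_isomorphic p H H' \<Longrightarrow> zmod_isomorphic p H' K \<Longrightarrow> zmod_isomorphic p H K"
  using lin_iso_comp by (fastforce simp: zmod_isomorphic_def)

lemma zmod_iso_equiv: "equiv (rank1_modules p) (zmod_iso_rel p)"
proof (rule equivI)
  show "zmod_iso_rel p \<subseteq> rank1_modules p \<times> rank1_modules p" by (auto simp: zmod_iso_rel_def)
  show "refl_on (rank1_modules p) (zmod_iso_rel p)"
    using lin_iso_id by (fastforce simp: refl_on_def zmod_iso_rel_def zmod_isomorphic_def)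
  show "sym (zmod_iso_rel p)" using zmod_isomorphic_sym rank1D(1) by (fastforce simp: sym_def zmod_iso_rel_def)
  show "trans (zmod_iso_rel p)" using zmod_isomorphic_trans by (fastforce simp: trans_def zmod_iso_rel_def)
qed

lemma exact_sequenceI: "s \<in> exact_seqs p \<Longrightarrow> exact_sequence p s"
  by (intro exact_sequence.intro padic_axioms exact_sequence_axioms.intro)

text \<open>The kernels of both projections are the images of the p-adic integers, which the isomorphism of the middle
terms matches.\<close>

lemma middle_iso_descends:
  assumes s: "s \<in> exact_seqs p" and t: "t \<in> exact_seqs p"
    and \<phi>: "\<phi> \<in> lin_iso Z (middle s) (middle t)"
    and \<phi>i: "\<And>a. a \<in> carrier Z \<Longrightarrow> \<phi> (incl s a) = incl t a"
  shows "\<exists>\<psi>\<in>iso (quot s) (quot t). \<psi> \<in> extensional (carrier (quot s)) \<and> (\<forall>x\<in>carrier (middle s). \<psi> (proj s x) = proj t (\<phi> x))"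
proof -
  interpret S: exact_sequence p s using s by (rule exact_sequenceI)
  interpret T: exact_sequence p t using t by (rule exact_sequenceI)
  note f = lin_homD[OF lin_isoD(1)[OF \<phi>]] and finj = lin_isoD(2)[OF \<phi>] and fsurj = lin_isoD(3)[OF \<phi>]
  have eq: "S.q x = S.q y \<longleftrightarrow> T.q (\<phi> x) = T.q (\<phi> y)" if xy: "x \<in> carrier S.H" "y \<in> carrier S.H" for x y
  proof -
    have "\<phi> (y \<oplus>\<^bsub>S.H\<^esub> S.i a) = \<phi> y \<oplus>\<^bsub>T.H\<^esub> T.i a" if "a \<in> carrier Z" for a
      using f(2)[OF xy(2) S.i_closed[OF that]] \<phi>i[OF that] by simp
    moreover have "x = y \<oplus>\<^bsub>S.H\<^esub> S.i a \<longleftrightarrow> \<phi> x = \<phi> (y \<oplus>\<^bsub>S.H\<^esub> S.i a)" if "a \<in> carrier Z" for a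
      using inj_on_eq_iff[OF finj xy(1), of "y \<oplus>\<^bsub>S.H\<^esub> S.i a"] xy that by simp
    ultimately show ?thesis using S.q_eq_iff[OF xy] T.q_eq_iff[OF f(1)[OF xy(1)] f(1)[OF xy(2)]] by simp
  qed
  define \<sigma> where "\<sigma> = inv_into (carrier S.H) S.q"
  have \<sigma>: "\<sigma> g \<in> carrier S.H" "S.q (\<sigma> g) = g" if "g \<in> carrier S.G" for g
    using that S.q_surj by (simp_all add: \<sigma>_def inv_into_into f_inv_into_f)
  define \<psi> where "\<psi> = (\<lambda>g\<in>carrier S.G. T.q (\<phi> (\<sigma> g)))"
  have psi: "\<psi> (S.q x) = T.q (\<phi> x)" if "x \<in> carrier S.H" for x
  proof -
    have "S.q (\<sigma> (S.q x)) = S.q x" using \<sigma> that by simp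
    then have "T.q (\<phi> (\<sigma> (S.q x))) = T.q (\<phi> x)" using eq[of "\<sigma> (S.q x)" x] \<sigma> that by simp
    then show ?thesis using that by (simp add: \<psi>_def)
  qed
  have cs: "\<exists>x\<in>carrier S.H. g = S.q x" if "g \<in> carrier S.G" for g using \<sigma>[OF that] by metis
  have "\<psi> \<in> hom S.G T.G"
  proof (rule homI)
    fix g assume "g \<in> carrier S.G"
    then obtain x where "x \<in> carrier S.H" "g = S.q x" using cs by blast
    then show "\<psi> g \<in> carrier T.G" using psi f(1) by simp
  next
    fix g h assume "g \<in> carrier S.G" "h \<in> carrier S.G"
    then obtain x y where xy: "x \<in> carrier S.H" "g = S.q x" "y \<in> carrier S.H" "h = S.q y" using cs by meson
    then have "\<psi> (g \<otimes>\<^bsub>S.G\<^esub> h) = \<psi> (S.q (x \<oplus>\<^bsub>S.H\<^esub> y))" by (simp add: S.q_add)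
    also have "\<dots> = \<psi> g \<otimes>\<^bsub>T.G\<^esub> \<psi> h" using xy psi[of "x \<oplus>\<^bsub>S.H\<^esub> y"] psi f(1,2) T.q_add by simp
    finally show "\<psi> (g \<otimes>\<^bsub>S.G\<^esub> h) = \<psi> g \<otimes>\<^bsub>T.G\<^esub> \<psi> h" .
  qed
  moreover have "inj_on \<psi> (carrier S.G)"
  proof (rule inj_onI)
    fix g h assume "g \<in> carrier S.G" "h \<in> carrier S.G" and e: "\<psi> g = \<psi> h"
    then obtain x y where xy: "x \<in> carrier S.H" "g = S.q x" "y \<in> carrier S.H" "h = S.q y" using cs by meson
    then show "g = h" using e psi eq by simp
  qed
  moreover have "\<psi> ` carrier S.G = carrier T.G"
  proof -
    have "\<psi> ` carrier S.G = (\<lambda>x. \<psi> (S.q x)) ` carrier S.H" unfolding S.q_surj[symmetric] image_image ..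
    also have "\<dots> = (\<lambda>x. T.q (\<phi> x)) ` carrier S.H" by (rule image_cong[OF refl psi])
    also have "\<dots> = carrier T.G" using fsurj T.q_surj by (metis image_image)
    finally show ?thesis .
  qed
  ultimately have "\<psi> \<in> iso S.G T.G" by (simp add: iso_iff)
  then show ?thesis using psi by (intro bexI[of _ \<psi>]) (auto simp: \<psi>_def)
qed

text \<open>By \<open>middle_iso_descends\<close> the isomorphism of the quotients comes for free: an edge is an isomorphism class
of inclusions.\<close>

lemma seq_iso_iff:
  "(s, t) \<in> seq_iso_rel p \<longleftrightarrow> s \<in> exact_seqs p \<and> t \<in> exact_seqs p \<and>
     (\<exists>\<phi>\<in>lin_iso Z (middle s) (middle t). \<forall>a\<in>carrier Z. \<phi> (incl s a) = incl t a)"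
proof
  assume "s \<in> exact_seqs p \<and> t \<in> exact_seqs p \<and>
     (\<exists>\<phi>\<in>lin_iso Z (middle s) (middle t). \<forall>a\<in>carrier Z. \<phi> (incl s a) = incl t a)"
  then obtain \<phi> where st: "s \<in> exact_seqs p" "t \<in> exact_seqs p"
    and \<phi>: "\<phi>\<in>lin_iso Z (middle s) (middle t)" "\<And>a. a\<in>carrier Z \<Longrightarrow> \<phi> (incl s a) = incl t a" by blast
  from middle_iso_descends[OF st \<phi>] obtain \<psi> where
    \<psi>: "\<psi>\<in>iso (quot s) (quot t)" "\<forall>x\<in>carrier (middle s). \<psi> (proj s x) = proj t (\<phi> x)" by blast
  show "(s, t) \<in> seq_iso_rel p" unfolding seq_iso_rel_def mem_Collect_eq prod.case
    by (intro conjI bexI[OF _ \<phi>(1)] bexI[OF _ \<psi>(1)] ballI) (use st \<phi>(2) \<psi>(2) in auto)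
qed (auto simp: seq_iso_rel_def)

lemma seq_iso_quot: "(s, t) \<in> seq_iso_rel p \<Longrightarrow> quot s \<cong> quot t"
  and seq_iso_middle: "(s, t) \<in> seq_iso_rel p \<Longrightarrow> zmod_isomorphic p (middle s) (middle t)"
  by (auto simp: seq_iso_rel_def is_iso_def zmod_isomorphic_def)

lemma exact_seq_module: "s \<in> exact_seqs p \<Longrightarrow> Module.module Z (middle s)"
  by (simp add: exact_seqs_def)

lemma exact_seq_incl: "s \<in> exact_seqs p \<Longrightarrow> a \<in> carrier Z \<Longrightarrow> incl s a \<in> carrier (middle s)"
  by (simp add: exact_seqs_def lin_hom_iff)

lemma seq_iso_equiv: "equiv (exact_seqs p) (seq_iso_rel p)"
proof (rule equivI)
  show "seq_iso_rel p \<subseteq> exact_seqs p \<times> exact_seqs p" by (auto simp: seq_iso_rel_def)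
  show "refl_on (exact_seqs p) (seq_iso_rel p)"
    using lin_iso_id by (fastforce simp: refl_on_def seq_iso_iff)
  show "sym (seq_iso_rel p)"
  proof (rule symI)
    fix s t assume "(s, t) \<in> seq_iso_rel p"
    then obtain \<phi> where st: "s \<in> exact_seqs p" "t \<in> exact_seqs p"
      and \<phi>: "\<phi>\<in>lin_iso Z (middle s) (middle t)" "\<And>a. a\<in>carrier Z \<Longrightarrow> \<phi> (incl s a) = incl t a"
      unfolding seq_iso_iff by blast
    have "inv_into (carrier (middle s)) \<phi> (incl t a) = incl s a" if "a \<in> carrier Z" for a
      using \<phi>(2)[OF that] lin_isoD(2)[OF \<phi>(1)] exact_seq_incl[OF st(1) that] by (metis inv_into_f_f)
    then show "(t, s) \<in> seq_iso_rel p"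
      unfolding seq_iso_iff using st lin_iso_inv[OF exact_seq_module[OF st(1)] \<phi>(1)] by blast
  qed
  show "trans (seq_iso_rel p)"
  proof (rule transI)
    fix s t u assume "(s, t) \<in> seq_iso_rel p" "(t, u) \<in> seq_iso_rel p"
    then obtain \<phi> \<phi>' where st: "s \<in> exact_seqs p" "t \<in> exact_seqs p" "u \<in> exact_seqs p"
      and \<phi>: "\<phi>\<in>lin_iso Z (middle s) (middle t)" "\<And>a. a\<in>carrier Z \<Longrightarrow> \<phi> (incl s a) = incl t a"
      and \<phi>': "\<phi>'\<in>lin_iso Z (middle t) (middle u)" "\<And>a. a\<in>carrier Z \<Longrightarrow> \<phi>' (incl t a) = incl u a"
      unfolding seq_iso_iff by blast
    then show "(s, u) \<in> seq_iso_rel p"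
      unfolding seq_iso_iff by (auto intro!: bexI[OF _ lin_iso_comp[OF \<phi>(1) \<phi>'(1)]])
  qed
qed

lemma edges_eq: "edges p = exact_seqs p // seq_iso_rel p"
proof -
  have "middle s \<in> rank1_modules p" if "s \<in> exact_seqs p" for s
    using exact_sequence.middle_rank1[OF exact_sequenceI[OF that]] .
  then have "{s \<in> exact_seqs p. middle s \<in> rank1_modules p} = exact_seqs p" by blast
  then show ?thesis by (simp add: edges_def)
qed

lemma edge_rep:
  assumes "e \<in> edges p"
  shows "rep e \<in> e" "rep e \<in> exact_seqs p" "e = seq_iso_rel p `` {rep e}"
  using rep_in_class[OF seq_iso_equiv] assms by (simp_all add: edges_eq)

lemma edge_member:
  assumes "e \<in> edges p" "t \<in> e"
  shows "t \<in> exact_seqs p" "(rep e, t) \<in> seq_iso_rel p" "e = seq_iso_rel p `` {t}"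
proof -
  show r: "(rep e, t) \<in> seq_iso_rel p" using edge_rep(3)[OF assms(1)] assms(2) by blast
  then show "t \<in> exact_seqs p" by (simp add: seq_iso_rel_def)
  show "e = seq_iso_rel p `` {t}" using edge_rep(3)[OF assms(1)] equiv_class_eq[OF seq_iso_equiv r] by simp
qed

lemma edge_ends_eq:
  assumes "e \<in> edges p" "t \<in> e"
  shows "edge_ends p e = {Inl (grp_iso_rel p `` {quot t}), Inr (zmod_iso_rel p `` {middle t})}"
proof -
  note m = edge_member[OF assms]
  have "s \<in> exact_seqs p \<Longrightarrow> quot s \<in> pgroups p \<and> middle s \<in> rank1_modules p" for s
    using exact_sequence.middle_rank1[OF exact_sequenceI] by (simp add: exact_seqs_def)
  then have "(quot (rep e), quot t) \<in> grp_iso_rel p" "(middle (rep e), middle t) \<in> zmod_iso_rel p"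
    using m(1) edge_rep(2)[OF assms(1)] seq_iso_quot[OF m(2)] seq_iso_middle[OF m(2)]
    by (auto simp: grp_iso_rel_def zmod_iso_rel_def)
  then show ?thesis unfolding edge_ends_def
    using equiv_class_eq[OF grp_iso_equiv] equiv_class_eq[OF zmod_iso_equiv] by simp
qed

lemma X0_rep:
  assumes "g \<in> X0 p" shows "rep g \<in> g" "rep g \<in> pgroups p" "g = grp_iso_rel p `` {rep g}"
  using rep_in_class[OF grp_iso_equiv] assms by (simp_all add: X0_def)

lemma X1_rep:
  assumes "h \<in> X1 p" shows "rep h \<in> h" "rep h \<in> rank1_modules p" "h = zmod_iso_rel p `` {rep h}"
  using rep_in_class[OF zmod_iso_equiv] assms by (simp_all add: X1_def)

lemma exact_seq_ends:
  assumes "t \<in> exact_seqs p" shows "quot t \<in> pgroups p" "middle t \<in> rank1_modules p"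
  using assms exact_sequence.middle_rank1[OF exact_sequenceI] by (simp_all add: exact_seqs_def)

lemma Inl_edge_ends_iff:
  assumes "g \<in> X0 p" "e \<in> edges p" "t \<in> e"
  shows "Inl g \<in> edge_ends p e \<longleftrightarrow> quot t \<cong> rep g"
proof -
  note q = exact_seq_ends(1)[OF edge_member(1)[OF assms(2,3)]]
  have "Inl g \<in> edge_ends p e \<longleftrightarrow> grp_iso_rel p `` {rep g} = grp_iso_rel p `` {quot t}"
    using X0_rep(3)[OF assms(1)] by (auto simp: edge_ends_eq[OF assms(2,3)])
  also have "\<dots> \<longleftrightarrow> (quot t, rep g) \<in> grp_iso_rel p"
    using eq_equiv_class_iff[OF grp_iso_equiv q X0_rep(2)[OF assms(1)]] by auto
  also have "\<dots> \<longleftrightarrow> quot t \<cong> rep g" using q X0_rep(2)[OF assms(1)] by (simp add: grp_iso_rel_def)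
  finally show ?thesis .
qed

lemma Inr_edge_ends_iff:
  assumes "h \<in> X1 p" "e \<in> edges p" "t \<in> e"
  shows "Inr h \<in> edge_ends p e \<longleftrightarrow> zmod_isomorphic p (middle t) (rep h)"
proof -
  note q = exact_seq_ends(2)[OF edge_member(1)[OF assms(2,3)]]
  have "Inr h \<in> edge_ends p e \<longleftrightarrow> zmod_iso_rel p `` {rep h} = zmod_iso_rel p `` {middle t}"
    using X1_rep(3)[OF assms(1)] by (auto simp: edge_ends_eq[OF assms(2,3)])
  also have "\<dots> \<longleftrightarrow> (middle t, rep h) \<in> zmod_iso_rel p"
    using eq_equiv_class_iff[OF zmod_iso_equiv q X1_rep(2)[OF assms(1)]] by auto
  also have "\<dots> \<longleftrightarrow> zmod_isomorphic p (middle t) (rep h)" using q X1_rep(2)[OF assms(1)] by (simp add: zmod_iso_rel_def)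
  finally show ?thesis .
qed

lemma edge_ends_pair_iff:
  assumes "e \<in> edges p"
  shows "edge_ends p e = {Inl g, Inr h} \<longleftrightarrow> Inl g \<in> edge_ends p e \<and> Inr h \<in> edge_ends p e"
proof -
  have "{Inl a, Inr b} = {Inl g, Inr h} \<longleftrightarrow> Inl g \<in> {Inl a, Inr b} \<and> Inr h \<in> {Inl a, Inr b}" for a b
    by (auto simp: doubleton_eq_iff)
  then show ?thesis unfolding edge_ends_def .
qed

lemma edge_ends_subset: "e \<in> edges p \<Longrightarrow> edge_ends p e \<subseteq> X0 p <+> X1 p"
  using exact_seq_ends[OF edge_rep(2)] by (auto simp: edge_ends_def X0_def X1_def intro: quotientI)

text \<open>Within an edge, the quotient can be made equal to any given group of its isomorphism class.\<close>

lemma change_quot: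
  assumes s: "s \<in> exact_seqs p" and G: "G \<in> pgroups p" and \<psi>: "\<psi> \<in> iso (quot s) G"
  shows "s\<lparr>quot := G, proj := (\<lambda>x. \<psi> (proj s x))\<rparr> \<in> exact_seqs p"
    "(s, s\<lparr>quot := G, proj := (\<lambda>x. \<psi> (proj s x))\<rparr>) \<in> seq_iso_rel p"
proof -
  interpret S: exact_sequence p s using s by (rule exact_sequenceI)
  interpret G: comm_group G using pgroupD(1)[OF G] .
  have h: "\<psi> \<in> hom S.G G" and b: "\<psi> ` carrier S.G = carrier G" "inj_on \<psi> (carrier S.G)" using \<psi> by (auto simp: iso_iff)
  have one: "\<psi> \<one>\<^bsub>S.G\<^esub> = \<one>\<^bsub>G\<^esub>" using hom_one[OF h] S.G.is_group G.is_group by blast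
  have "\<lparr>middle = S.H, incl = S.i, quot = G, proj = (\<lambda>x. \<psi> (S.q x))\<rparr> \<in> exact_seqs p"
  proof (rule exact_seqI)
    show "Module.module Z S.H" using exact_seq_module[OF s] .
    show "(\<lambda>x. \<psi> (S.q x)) \<in> hom (add_monoid S.H) G"
      using hom_compose[OF S.q_hom h] by (simp add: o_def)
    show "(\<lambda>x. \<psi> (S.q x)) ` carrier S.H = carrier G"
      using S.q_surj b by (metis image_image)
    fix x assume x: "x \<in> carrier S.H"
    have "\<psi> (S.q x) = \<one>\<^bsub>G\<^esub> \<longleftrightarrow> S.q x = \<one>\<^bsub>S.G\<^esub>"
      using inj_on_eq_iff[OF b(2), of "S.q x" "\<one>\<^bsub>S.G\<^esub>"] x one by simp
    then show "\<psi> (S.q x) = \<one>\<^bsub>G\<^esub> \<longleftrightarrow> x \<in> S.i ` carrier Z" using S.q_ker[OF x] by simp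
  qed (use G S.i_lin S.i_inj in auto)
  then show 1: "s\<lparr>quot := G, proj := (\<lambda>x. \<psi> (proj s x))\<rparr> \<in> exact_seqs p" by (cases s) simp
  show "(s, s\<lparr>quot := G, proj := (\<lambda>x. \<psi> (proj s x))\<rparr>) \<in> seq_iso_rel p"
    unfolding seq_iso_iff using s 1 by (auto intro!: bexI[OF _ lin_iso_id])
qed

text \<open>Within an edge, the middle term can be made equal to any given module of its isomorphism class.\<close>

lemma change_middle:
  assumes s: "s \<in> exact_seqs p" and H: "Module.module Z H" and \<phi>: "\<phi> \<in> lin_iso Z (middle s) H"
  shows "\<exists>t. (s, t) \<in> seq_iso_rel p \<and> middle t = H \<and> quot t = quot s \<and> incl t = (\<lambda>a. \<phi> (incl s a))"
proof -
  interpret S: exact_sequence p s using s by (rule exact_sequenceI)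
  let ?g = "inv_into (carrier S.H) \<phi>"
  note gi = lin_iso_inv[OF exact_seq_module[OF s] \<phi>]
  note g = lin_homD[OF lin_isoD(1)[OF gi]] and f = lin_homD[OF lin_isoD(1)[OF \<phi>]]
  have gf: "?g (\<phi> x) = x" if "x \<in> carrier S.H" for x using lin_isoD(2)[OF \<phi>] that by (rule inv_into_f_f)
  have fg: "\<phi> (?g y) = y" if "y \<in> carrier H" for y using that lin_isoD(3)[OF \<phi>] by (simp add: f_inv_into_f)
  let ?t = "\<lparr>middle = H, incl = (\<lambda>a. \<phi> (S.i a)), quot = S.G, proj = (\<lambda>x. S.q (?g x))\<rparr>"
  have t: "?t \<in> exact_seqs p"
  proof (rule exact_seqI[OF H S.G_pgroup])
    show "(\<lambda>a. \<phi> (S.i a)) \<in> lin_hom Z Z H" using lin_hom_comp[OF S.i_lin lin_isoD(1)[OF \<phi>]] .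
    show "(\<lambda>x. S.q (?g x)) \<in> hom (add_monoid H) S.G"
      using g by (auto simp: hom_def S.q_add)
    show "inj_on (\<lambda>a. \<phi> (S.i a)) (carrier Z)"
      by (rule inj_onI) (use inj_onD[OF S.i_inj] inj_onD[OF lin_isoD(2)[OF \<phi>]] S.i_closed in blast)
    have "(\<lambda>x. S.q (?g x)) ` carrier H = S.q ` (?g ` carrier H)" by (simp add: image_image)
    then show "(\<lambda>x. S.q (?g x)) ` carrier H = carrier S.G" using S.q_surj lin_isoD(3)[OF gi] by simp
    fix x assume x: "x \<in> carrier H"
    have "S.q (?g x) = \<one>\<^bsub>S.G\<^esub> \<longleftrightarrow> ?g x \<in> S.i ` carrier Z" using S.q_ker g(1)[OF x] by simp
    also have "\<dots> \<longleftrightarrow> x \<in> (\<lambda>a. \<phi> (S.i a)) ` carrier Z"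
    proof
      assume "?g x \<in> S.i ` carrier Z"
      then obtain a where "a \<in> carrier Z" "?g x = S.i a" by blast
      then show "x \<in> (\<lambda>a. \<phi> (S.i a)) ` carrier Z" using fg[OF x] by (metis imageI)
    next
      assume "x \<in> (\<lambda>a. \<phi> (S.i a)) ` carrier Z"
      then obtain a where "a \<in> carrier Z" "x = \<phi> (S.i a)" by blast
      then show "?g x \<in> S.i ` carrier Z" using gf[OF S.i_closed] by auto
    qed
    finally show "S.q (?g x) = \<one>\<^bsub>S.G\<^esub> \<longleftrightarrow> x \<in> (\<lambda>a. \<phi> (S.i a)) ` carrier Z" .
  qed
  then have "(s, ?t) \<in> seq_iso_rel p" unfolding seq_iso_iff using s \<phi> by auto
  then show ?thesis by (intro exI[of _ ?t]) simp
qed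

end

section \<open>The group of extensions\<close>

lemma finite_quotient_if_finite_invariant:
  assumes "equiv A r" "\<And>x. x \<in> A \<Longrightarrow> F x \<in> V" "finite V"
    "\<And>x y. x \<in> A \<Longrightarrow> y \<in> A \<Longrightarrow> F x = F y \<Longrightarrow> (x, y) \<in> r"
  shows "finite (A // r)"
proof -
  have "A // r \<subseteq> (\<lambda>v. r `` {SOME x. x \<in> A \<and> F x = v}) ` V"
  proof
    fix c assume "c \<in> A // r"
    then obtain x where x: "c = r `` {x}" "x \<in> A" by (rule quotientE)
    have "\<exists>y. y \<in> A \<and> F y = F x" using x by blast
    from someI_ex[OF this] have "r `` {x} = r `` {SOME y. y \<in> A \<and> F y = F x}"
      using x assms(4) by (intro equiv_class_eq[OF assms(1)]) auto
    then show "c \<in> (\<lambda>v. r `` {SOME x. x \<in> A \<and> F x = v}) ` V" using x assms(2) by blast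
  qed
  then show ?thesis using assms(3) finite_surj by blast
qed

context padic begin

lemma ext_equiv_equiv: "equiv (extensions p G) (ext_equiv p G)"
proof (rule equivI)
  show "ext_equiv p G \<subseteq> extensions p G \<times> extensions p G" by (auto simp: ext_equiv_def)
  show "refl_on (extensions p G) (ext_equiv p G)"
    using lin_iso_id by (fastforce simp: refl_on_def ext_equiv_def)
  show "sym (ext_equiv p G)"
  proof (rule symI)
    fix s t assume "(s, t) \<in> ext_equiv p G"
    then obtain \<phi> where st: "s \<in> extensions p G" "t \<in> extensions p G"
      and \<phi>: "\<phi>\<in>lin_iso Z (middle s) (middle t)" "\<And>a. a\<in>carrier Z \<Longrightarrow> \<phi> (incl s a) = incl t a"
        "\<And>x. x \<in> carrier (middle s) \<Longrightarrow> proj t (\<phi> x) = proj s x"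
      unfolding ext_equiv_def by blast
    have s: "s \<in> exact_seqs p" using st by (simp add: extensions_def)
    let ?g = "inv_into (carrier (middle s)) \<phi>"
    have "?g (incl t a) = incl s a" if "a \<in> carrier Z" for a
      using \<phi>(2)[OF that] lin_isoD(2)[OF \<phi>(1)] exact_seq_incl[OF s that] by (metis inv_into_f_f)
    moreover have "proj s (?g y) = proj t y" if "y \<in> carrier (middle t)" for y
      using \<phi>(3)[of "?g y"] that lin_isoD(3)[OF \<phi>(1)] by (simp add: f_inv_into_f inv_into_into)
    ultimately show "(t, s) \<in> ext_equiv p G"
      unfolding ext_equiv_def using st lin_iso_inv[OF exact_seq_module[OF s] \<phi>(1)] by blast
  qed
  show "trans (ext_equiv p G)"
  proof (rule transI)
    fix s t u assume "(s, t) \<in> ext_equiv p G" "(t, u) \<in> ext_equiv p G"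
    then obtain \<phi> \<phi>' where st: "s \<in> extensions p G" "t \<in> extensions p G" "u \<in> extensions p G"
      and \<phi>: "\<phi>\<in>lin_iso Z (middle s) (middle t)" "\<And>a. a\<in>carrier Z \<Longrightarrow> \<phi> (incl s a) = incl t a"
        "\<And>x. x \<in> carrier (middle s) \<Longrightarrow> proj t (\<phi> x) = proj s x"
      and \<phi>': "\<phi>'\<in>lin_iso Z (middle t) (middle u)" "\<And>a. a\<in>carrier Z \<Longrightarrow> \<phi>' (incl t a) = incl u a"
        "\<And>x. x \<in> carrier (middle t) \<Longrightarrow> proj u (\<phi>' x) = proj t x"
      unfolding ext_equiv_def by blast
    have "\<And>x. x \<in> carrier (middle s) \<Longrightarrow> proj u (\<phi>' (\<phi> x)) = proj s x"
      using \<phi>(3) \<phi>'(3) lin_homD(1)[OF lin_isoD(1)[OF \<phi>(1)]] by simp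
    then have "(\<forall>a\<in>carrier Z. \<phi>' (\<phi> (incl s a)) = incl u a) \<and> (\<forall>x\<in>carrier (middle s). proj u (\<phi>' (\<phi> x)) = proj s x)"
      using \<phi>(2) \<phi>'(2) by simp
    then show "(s, u) \<in> ext_equiv p G"
      unfolding ext_equiv_def mem_Collect_eq prod.case
      using st by (intro conjI bexI[OF _ lin_iso_comp[OF \<phi>(1) \<phi>'(1)]]) auto
  qed
qed

lemma extensionsD: "s \<in> extensions p G \<Longrightarrow> s \<in> exact_seqs p" "s \<in> extensions p G \<Longrightarrow> quot s = G"
  by (simp_all add: extensions_def)

text \<open>The extension is determined by the residues of \<open>lam\<close> modulo \<open>p ^ N\<close> as a function on \<open>G\<close>; this is the
injectivity of the map from \<open>Ext(G, Zp)\<close> to \<open>Hom(G, Qp / Zp)\<close>. Indeed the middle term is a set of pairs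
\<open>(a, g)\<close> described by these residues; elements with equal pairs correspond to each other.\<close>

lemma ext_equivI:
  assumes s: "s \<in> extensions p G" and t: "t \<in> extensions p G"
    and lam: "\<And>x y. x \<in> carrier (middle s) \<Longrightarrow> y \<in> carrier (middle t) \<Longrightarrow> proj s x = proj t y \<Longrightarrow>
      exact_sequence.lam p s x (multiplicity p (order G)) = exact_sequence.lam p t y (multiplicity p (order G))"
  shows "(s, t) \<in> ext_equiv p G"
proof -
  interpret S: exact_sequence p s using extensionsD(1)[OF s] by (rule exact_sequenceI)
  interpret T: exact_sequence p t using extensionsD(1)[OF t] by (rule exact_sequenceI)
  have qs: "S.G = G" and qt: "T.G = G" using extensionsD(2) s t by auto
  have ex: "\<exists>y\<in>carrier T.H. T.q y = S.q x \<and> T.lam y = S.lam x" if x: "x \<in> carrier S.H" for x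
  proof -
    have "S.q x \<in> T.q ` carrier T.H" using S.q_closed[OF x] qs qt T.q_surj by simp
    then obtain y0 where y0: "y0 \<in> carrier T.H" "T.q y0 = S.q x" by auto
    have "S.lam x T.N = T.lam y0 T.N" using lam[OF x y0(1)] y0(2) qt by simp
    from T.lam_lift[OF y0(1) S.lam_closed[OF x] this] y0 show ?thesis by auto
  qed
  define \<phi> where "\<phi> x = (SOME y. y \<in> carrier T.H \<and> T.q y = S.q x \<and> T.lam y = S.lam x)" for x
  have phi: "\<phi> x \<in> carrier T.H" "T.q (\<phi> x) = S.q x" "T.lam (\<phi> x) = S.lam x" if "x \<in> carrier S.H" for x
  proof -
    have "\<exists>y. y \<in> carrier T.H \<and> T.q y = S.q x \<and> T.lam y = S.lam x" using ex[OF that] by blast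
    from someI_ex[OF this] show "\<phi> x \<in> carrier T.H" "T.q (\<phi> x) = S.q x" "T.lam (\<phi> x) = S.lam x"
      unfolding \<phi>_def by auto
  qed
  have phi_eq: "\<phi> x = y" if "x \<in> carrier S.H" "y \<in> carrier T.H" "T.q y = S.q x" "T.lam y = S.lam x" for x y
    by (rule T.lam_q_inj) (use phi[OF that(1)] that in auto)
  have hom: "\<phi> \<in> lin_hom Z S.H T.H"
    unfolding lin_hom_iff
  proof (intro conjI ballI)
    fix x y assume xy: "x \<in> carrier S.H" "y \<in> carrier S.H"
    show "\<phi> (x \<oplus>\<^bsub>S.H\<^esub> y) = \<phi> x \<oplus>\<^bsub>T.H\<^esub> \<phi> y"
    proof (rule phi_eq)
      show "T.q (\<phi> x \<oplus>\<^bsub>T.H\<^esub> \<phi> y) = S.q (x \<oplus>\<^bsub>S.H\<^esub> y)"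
        using xy phi by (simp add: T.q_add S.q_add qs qt)
      show "T.lam (\<phi> x \<oplus>\<^bsub>T.H\<^esub> \<phi> y) = S.lam (x \<oplus>\<^bsub>S.H\<^esub> y)"
        using xy phi lin_homD(2)[OF T.lam_lin] lin_homD(2)[OF S.lam_lin] by simp
    qed (use xy phi in auto)
  next
    fix a x assume ax: "a \<in> carrier Z" "x \<in> carrier S.H"
    show "\<phi> (a \<odot>\<^bsub>S.H\<^esub> x) = a \<odot>\<^bsub>T.H\<^esub> \<phi> x"
    proof (rule phi_eq)
      show "T.q (a \<odot>\<^bsub>T.H\<^esub> \<phi> x) = S.q (a \<odot>\<^bsub>S.H\<^esub> x)"
        using ax phi by (simp add: T.q_smult S.q_smult qs qt)
      show "T.lam (a \<odot>\<^bsub>T.H\<^esub> \<phi> x) = S.lam (a \<odot>\<^bsub>S.H\<^esub> x)"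
        using ax phi lin_homD(3)[OF T.lam_lin] lin_homD(3)[OF S.lam_lin] by simp
    qed (use ax phi in auto)
  qed (use phi in auto)
  moreover have "inj_on \<phi> (carrier S.H)"
    by (rule inj_onI, rule S.lam_q_inj) (use phi in \<open>metis+\<close>)
  moreover have "\<phi> ` carrier S.H = carrier T.H"
  proof
    show "\<phi> ` carrier S.H \<subseteq> carrier T.H" using phi by auto
    show "carrier T.H \<subseteq> \<phi> ` carrier S.H"
    proof
      fix y assume y: "y \<in> carrier T.H"
      have "T.q y \<in> S.q ` carrier S.H" using T.q_closed[OF y] qs qt S.q_surj by simp
      then obtain x0 where x0: "x0 \<in> carrier S.H" "S.q x0 = T.q y" by auto
      have "T.lam y S.N = S.lam x0 S.N" using lam[OF x0(1) y] x0(2) qs by simp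
      from S.lam_lift[OF x0(1) T.lam_closed[OF y] this] x0 obtain x where
        "x \<in> carrier S.H" "S.q x = T.q y" "S.lam x = T.lam y" by auto
      then have "\<phi> x = y" using y by (intro phi_eq) auto
      then show "y \<in> \<phi> ` carrier S.H" using \<open>x \<in> carrier S.H\<close> by blast
    qed
  qed
  ultimately have "\<phi> \<in> lin_iso Z S.H T.H" by (rule lin_isoI)
  moreover have "\<phi> (S.i a) = T.i a" if "a \<in> carrier Z" for a
    by (rule phi_eq) (use that S.lam_i T.lam_i qs qt in auto)
  ultimately show ?thesis unfolding ext_equiv_def using s t phi by blast
qed

lemma finite_Ext:
  assumes G: "G \<in> pgroups p"
  shows "finite (Ext p G)"
  unfolding Ext_def
proof (rule finite_quotient_if_finite_invariant[OF ext_equiv_equiv])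
  let ?N = "multiplicity p (order G)"
  let ?F = "\<lambda>s. \<lambda>g\<in>carrier G. exact_sequence.lam p s (inv_into (carrier (middle s)) (proj s) g) ?N"
  show "finite (carrier G \<rightarrow>\<^sub>E {0..<int p ^ ?N})" using pgroupD(3)[OF G] by (intro finite_PiE) auto
  fix s assume s: "s \<in> extensions p G"
  interpret S: exact_sequence p s using extensionsD(1)[OF s] by (rule exact_sequenceI)
  have qs: "S.G = G" using extensionsD(2) s by auto
  have sec: "inv_into (carrier S.H) S.q g \<in> carrier S.H" "S.q (inv_into (carrier S.H) S.q g) = g" if "g \<in> carrier G" for g
    using that S.q_surj qs by (simp_all add: inv_into_into f_inv_into_f)
  show "?F s \<in> carrier G \<rightarrow>\<^sub>E {0..<int p ^ ?N}"
    using Z_bounds[OF S.lam_closed[OF sec(1)]] by auto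
  fix t assume t: "t \<in> extensions p G" and F: "?F s = ?F t"
  interpret T: exact_sequence p t using extensionsD(1)[OF t] by (rule exact_sequenceI)
  have qt: "T.G = G" using extensionsD(2) t by auto
  have sect: "inv_into (carrier T.H) T.q g \<in> carrier T.H" "T.q (inv_into (carrier T.H) T.q g) = g" if "g \<in> carrier G" for g
    using that T.q_surj qt by (simp_all add: inv_into_into f_inv_into_f)
  show "(s, t) \<in> ext_equiv p G"
  proof (rule ext_equivI[OF s t])
    fix x y assume x: "x \<in> carrier S.H" and y: "y \<in> carrier T.H" and e: "S.q x = T.q y"
    let ?g = "S.q x"
    have g: "?g \<in> carrier G" using S.q_closed[OF x] qs by simp
    have "S.lam x ?N = S.lam (inv_into (carrier S.H) S.q ?g) ?N"
      using S.lam_mod[OF x sec(1)[OF g]] sec(2)[OF g] qs by simp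
    also have "\<dots> = T.lam (inv_into (carrier T.H) T.q ?g) ?N"
      using fun_cong[OF F, of ?g] g by simp
    also have "\<dots> = T.lam y ?N"
      using T.lam_mod[OF sect(1)[OF g] y] sect(2)[OF g] qt e by simp
    finally show "S.lam x ?N = T.lam y ?N" .
  qed
qed

subsection \<open>The split extension\<close>

text \<open>Interleaving places pairs in the type in which all modules live.\<close>

definition enc :: "padic \<Rightarrow> univ \<Rightarrow> univ" where
  "enc x g = (\<lambda>n. if even n then x (n div 2) else g (n div 2))"
definition dec1 :: "univ \<Rightarrow> padic" where "dec1 y = (\<lambda>n. y (2 * n))"
definition dec2 :: "univ \<Rightarrow> univ" where "dec2 y = (\<lambda>n. y (2 * n + 1))"

lemma dec_enc [simp]: "dec1 (enc x g) = x" "dec2 (enc x g) = g"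
  by (simp_all add: dec1_def dec2_def enc_def)

text \<open>The direct sum of the p-adic integers and \<open>N\<close>, on codes of pairs.\<close>

definition Zp_dsum :: "zmod \<Rightarrow> zmod" where
  "Zp_dsum N = \<lparr>carrier = (\<lambda>(x, g). enc x g) ` (carrier Z \<times> carrier N),
     mult = (\<lambda>u v. u), one = enc \<zero>\<^bsub>Z\<^esub> \<zero>\<^bsub>N\<^esub>, zero = enc \<zero>\<^bsub>Z\<^esub> \<zero>\<^bsub>N\<^esub>,
     add = (\<lambda>u v. enc (dec1 u \<oplus>\<^bsub>Z\<^esub> dec1 v) (dec2 u \<oplus>\<^bsub>N\<^esub> dec2 v)),
     smult = (\<lambda>a u. enc (a \<otimes>\<^bsub>Z\<^esub> dec1 u) (a \<odot>\<^bsub>N\<^esub> dec2 u))\<rparr>"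

lemma Zp_dsum_simps:
  "carrier (Zp_dsum N) = (\<lambda>(x, g). enc x g) ` (carrier Z \<times> carrier N)" "\<zero>\<^bsub>Zp_dsum N\<^esub> = enc \<zero>\<^bsub>Z\<^esub> \<zero>\<^bsub>N\<^esub>"
  "u \<oplus>\<^bsub>Zp_dsum N\<^esub> v = enc (dec1 u \<oplus>\<^bsub>Z\<^esub> dec1 v) (dec2 u \<oplus>\<^bsub>N\<^esub> dec2 v)"
  "a \<odot>\<^bsub>Zp_dsum N\<^esub> u = enc (a \<otimes>\<^bsub>Z\<^esub> dec1 u) (a \<odot>\<^bsub>N\<^esub> dec2 u)"
  by (simp_all add: Zp_dsum_def)

lemma Zp_dsum_module:
  assumes N: "Module.module Z N" shows "Module.module Z (Zp_dsum N)"
proof -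
  interpret N: padic_module p N by (intro padic_module.intro padic_axioms N)
  have "abelian_group (Zp_dsum N)"
  proof (rule abelian_groupI)
    fix x assume "x \<in> carrier (Zp_dsum N)"
    then obtain a g where ag: "x = enc a g" "a \<in> carrier Z" "g \<in> carrier N" by (auto simp: Zp_dsum_simps)
    then show "\<exists>y\<in>carrier (Zp_dsum N). y \<oplus>\<^bsub>Zp_dsum N\<^esub> x = \<zero>\<^bsub>Zp_dsum N\<^esub>"
      by (intro bexI[of _ "enc (\<ominus>\<^bsub>Z\<^esub> a) (\<ominus>\<^bsub>N\<^esub> g)"]) (auto simp: Zp_dsum_simps Z.l_neg N.M.l_neg)
  qed (auto simp: Zp_dsum_simps Z.a_ac N.M.a_ac)
  then show ?thesis
    by (rule Module.moduleI[OF Z_cring]) (auto simp: Zp_dsum_simps Z.l_distr Z.r_distr N.M.smult_l_distr N.M.smult_r_distr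
       Z.m_assoc N.M.smult_assoc1)
qed

lemma Ext_nonempty:
  assumes G: "G \<in> pgroups p"
  shows "Ext p G \<noteq> {}"
proof -
  let ?P = "pgroup_module p G"
  note P = pgroup_module_is_module[OF G]
  interpret P: padic_module p ?P by (intro padic_module.intro padic_axioms P)
  let ?s = "\<lparr>middle = Zp_dsum ?P, incl = (\<lambda>a. enc a \<zero>\<^bsub>?P\<^esub>), quot = G, proj = dec2\<rparr>"
  have "?s \<in> exact_seqs p"
  proof (rule exact_seqI[OF Zp_dsum_module[OF P] G])
    have "a \<odot>\<^bsub>?P\<^esub> \<zero>\<^bsub>?P\<^esub> = \<zero>\<^bsub>?P\<^esub>" if "a \<in> carrier Z" for a using P.M.smult_r_null[OF that] .
    moreover have "\<zero>\<^bsub>?P\<^esub> \<oplus>\<^bsub>?P\<^esub> \<zero>\<^bsub>?P\<^esub> = \<zero>\<^bsub>?P\<^esub>" using P.M.l_zero[OF P.M.zero_closed] .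
    ultimately show "(\<lambda>a. enc a \<zero>\<^bsub>?P\<^esub>) \<in> lin_hom Z Z (Zp_dsum ?P)"
      unfolding lin_hom_iff Zp_dsum_simps Z_smult dec_enc using P.M.zero_closed by (auto simp: image_iff)
    show "dec2 \<in> hom (add_monoid (Zp_dsum ?P)) G"
      by (auto simp: hom_def Zp_dsum_simps)
    show "inj_on (\<lambda>a. enc a \<zero>\<^bsub>?P\<^esub>) (carrier Z)" by (rule inj_onI) (metis dec_enc(1))
    show "dec2 ` carrier (Zp_dsum ?P) = carrier G" using Z.zero_closed by (force simp: Zp_dsum_simps image_iff)
    show "dec2 x = \<one>\<^bsub>G\<^esub> \<longleftrightarrow> x \<in> (\<lambda>a. enc a \<zero>\<^bsub>?P\<^esub>) ` carrier Z" if "x \<in> carrier (Zp_dsum ?P)" for x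
      using that by (auto simp: Zp_dsum_simps)
  qed
  then have "?s \<in> extensions p G" by (simp add: extensions_def)
  then show ?thesis unfolding Ext_def quotient_def by blast
qed

end

section \<open>The walk from a finite group\<close>

lemma card_eq_fibre_times_image:
  assumes "finite A" "\<And>a. a \<in> A \<Longrightarrow> card {b \<in> A. f b = f a} = c"
  shows "card A = c * card (f ` A)"
proof -
  have "card A = (\<Sum>y\<in>f ` A. \<Sum>x\<in>{x \<in> A. f x = y}. 1)"
    using sum.image_gen[OF assms(1), of "\<lambda>_. 1::nat" f] by simp
  also have "\<dots> = (\<Sum>y\<in>f ` A. c)"
    by (rule sum.cong) (use assms(2) in auto)
  finally show ?thesis by (simp add: mult.commute)
qed

text \<open>Extensionality makes this set have the cardinality of the automorphism group.\<close>

definition Auts :: "('a, 'b) monoid_scheme \<Rightarrow> ('a \<Rightarrow> 'a) set" where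
  "Auts G = {\<psi> \<in> extensional (carrier G). \<psi> \<in> iso G G}"

lemma finite_Auts:
  assumes "finite (carrier G)" shows "finite (Auts G)"
proof (rule finite_subset)
  show "Auts G \<subseteq> carrier G \<rightarrow>\<^sub>E carrier G" by (auto simp: Auts_def PiE_def iso_def hom_def)
  show "finite (carrier G \<rightarrow>\<^sub>E carrier G)" using assms by (intro finite_PiE) auto
qed

lemma lin_iso_cong:
  assumes "Module.module R M" "f \<in> lin_iso R M N" "\<And>x. x \<in> carrier M \<Longrightarrow> g x = f x"
  shows "g \<in> lin_iso R M N"
proof -
  interpret Module.module R M by fact
  have "bij_betw g (carrier M) (carrier N)"
    using lin_isoD(4)[OF assms(2)] bij_betw_cong[of "carrier M" g f "carrier N"] assms(3) by simp
  moreover have "g \<in> lin_hom R M N"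
    unfolding lin_hom_iff using lin_homD[OF lin_isoD(1)[OF assms(2)]] assms(3) by simp
  ultimately show ?thesis by (simp add: lin_iso_def)
qed

context exact_sequence begin

text \<open>The automorphism fixes \<open>p ^ N x\<close>, which lies in the image of the p-adic integers.\<close>

lemma lam_aut:
  assumes "\<phi> \<in> lin_iso Z H H" "\<And>a. a \<in> carrier Z \<Longrightarrow> \<phi> (i a) = i a" "x \<in> carrier H"
  shows "lam (\<phi> x) = lam x"
proof (rule lamI)
  note f = lin_homD[OF lin_isoD(1)[OF assms(1)]]
  show "\<phi> x \<in> carrier H" using f assms by simp
  show "lam x \<in> carrier Z" using lam_closed assms by simp
  have "i (lam x) = \<phi> (i (lam x))" using assms(2)[OF lam_closed[OF assms(3)]] by simp
  also have "\<dots> = pint (int p ^ N) \<odot>\<^bsub>H\<^esub> \<phi> x"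
    unfolding lam_eq[OF assms(3)] using f(3) assms(3) by simp
  finally show "i (lam x) = pint (int p ^ N) \<odot>\<^bsub>H\<^esub> \<phi> x" .
qed

text \<open>This is the uniqueness of lifts: \<open>lam\<close> is preserved by \<open>lam_aut\<close>, and an element is determined by its
value under \<open>lam\<close> and its image in \<open>G\<close>.\<close>

lemma Aut_incl_ext:
  assumes "\<phi> \<in> Aut_incl p s" "\<phi>' \<in> Aut_incl p s" "\<And>x. x \<in> carrier H \<Longrightarrow> q (\<phi> x) = q (\<phi>' x)"
  shows "\<phi> = \<phi>'"
proof (rule extensionalityI)
  show "\<phi> \<in> extensional (carrier H)" "\<phi>' \<in> extensional (carrier H)" using assms by (auto simp: Aut_incl_def)
  fix x assume x: "x \<in> carrier H"
  have l: "\<phi> \<in> lin_iso Z H H" "\<And>a. a \<in> carrier Z \<Longrightarrow> \<phi> (i a) = i a"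
    "\<phi>' \<in> lin_iso Z H H" "\<And>a. a \<in> carrier Z \<Longrightarrow> \<phi>' (i a) = i a" using assms(1,2) by (auto simp: Aut_incl_def)
  show "\<phi> x = \<phi>' x"
    by (rule lam_q_inj)
      (use lin_homD(1)[OF lin_isoD(1)[OF l(1)] x] lin_homD(1)[OF lin_isoD(1)[OF l(3)] x] lam_aut[OF l(1,2) x] lam_aut[OF l(3,4) x] assms(3)[OF x] in auto)
qed

abbreviation "twist \<psi> \<equiv> s\<lparr>proj := (\<lambda>x. \<psi> (proj s x))\<rparr>"

lemma twist:
  assumes "\<psi> \<in> Auts G"
  shows "twist \<psi> \<in> extensions p G" "(s, twist \<psi>) \<in> seq_iso_rel p"
proof -
  have "\<psi> \<in> iso G G" using assms by (simp add: Auts_def)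
  from change_quot[OF s G_pgroup this] show "twist \<psi> \<in> extensions p G" "(s, twist \<psi>) \<in> seq_iso_rel p"
    by (simp_all add: extensions_def)
qed

lemma iso_q_surj: "g \<in> carrier G \<Longrightarrow> \<exists>x\<in>carrier H. q x = g"
  unfolding q_surj[symmetric] by blast

text \<open>The orbit of an extension class under \<open>Aut(G)\<close> is the set of classes in one edge: an isomorphism between
two extensions of \<open>G\<close> induces an automorphism of \<open>G\<close>, which accounts for the difference.\<close>

lemma twist_image:
  "(\<lambda>\<psi>. ext_equiv p G `` {twist \<psi>}) ` Auts G = {\<eta> \<in> Ext p G. \<eta> \<subseteq> seq_iso_rel p `` {s}}"
proof
  show "(\<lambda>\<psi>. ext_equiv p G `` {twist \<psi>}) ` Auts G \<subseteq> {\<eta> \<in> Ext p G. \<eta> \<subseteq> seq_iso_rel p `` {s}}"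
  proof (rule image_subsetI)
    fix \<psi> assume psi: "\<psi> \<in> Auts G"
    have "ext_equiv p G `` {twist \<psi>} \<in> Ext p G" unfolding Ext_def by (rule quotientI) (rule twist(1)[OF psi])
    moreover have "ext_equiv p G `` {twist \<psi>} \<subseteq> seq_iso_rel p `` {s}"
    proof
      fix t assume "t \<in> ext_equiv p G `` {twist \<psi>}"
      then have "(twist \<psi>, t) \<in> seq_iso_rel p" unfolding seq_iso_iff by (auto simp: ext_equiv_def extensions_def)
      then have "(s, t) \<in> seq_iso_rel p"
        using twist(2)[OF psi] seq_iso_equiv unfolding equiv_def by (blast dest: transD)
      then show "t \<in> seq_iso_rel p `` {s}" by simp
    qed
    ultimately show "ext_equiv p G `` {twist \<psi>} \<in> {\<eta> \<in> Ext p G. \<eta> \<subseteq> seq_iso_rel p `` {s}}" by simp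
  qed
  show "{\<eta> \<in> Ext p G. \<eta> \<subseteq> seq_iso_rel p `` {s}} \<subseteq> (\<lambda>\<psi>. ext_equiv p G `` {twist \<psi>}) ` Auts G"
  proof
    fix \<eta> assume "\<eta> \<in> {\<eta> \<in> Ext p G. \<eta> \<subseteq> seq_iso_rel p `` {s}}"
    then have eta: "\<eta> \<in> extensions p G // ext_equiv p G" "\<eta> \<subseteq> seq_iso_rel p `` {s}" by (auto simp: Ext_def)
    define t where "t = rep \<eta>"
    have t: "t \<in> \<eta>" "t \<in> extensions p G" "\<eta> = ext_equiv p G `` {t}"
      using rep_in_class[OF ext_equiv_equiv eta(1)] by (simp_all add: t_def)
    then have "(s, t) \<in> seq_iso_rel p" using eta(2) by blast
    then obtain \<phi> where \<phi>: "\<phi> \<in> lin_iso Z (middle s) (middle t)" "\<And>a. a\<in>carrier Z \<Longrightarrow> \<phi> (incl s a) = incl t a"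
      unfolding seq_iso_iff by blast
    have qt: "quot t = G" using extensionsD(2)[OF t(2)] .
    from middle_iso_descends[OF s extensionsD(1)[OF t(2)] \<phi>] obtain \<psi> where
      psi: "\<psi> \<in> Auts G" "\<forall>x\<in>carrier H. \<psi> (q x) = proj t (\<phi> x)" unfolding qt Auts_def by blast
    have "(twist \<psi>, t) \<in> ext_equiv p G"
      unfolding ext_equiv_def mem_Collect_eq prod.case
      by (intro conjI twist(1)[OF psi(1)] t(2) bexI[of _ \<phi>]) (use \<phi> psi(2) in auto)
    then have "\<eta> = ext_equiv p G `` {twist \<psi>}" using equiv_class_eq[OF ext_equiv_equiv] t(3) by simp
    then show "\<eta> \<in> (\<lambda>\<psi>. ext_equiv p G `` {twist \<psi>}) ` Auts G" using psi(1) by blast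
  qed
qed

text \<open>Two twists are equivalent exactly if they differ by an automorphism of \<open>G\<close> that lifts to an element of
\<open>Aut_incl\<close>; the lift is unique by \<open>Aut_incl_ext\<close>.\<close>

lemma twist_fibre:
  assumes psi0: "\<psi>0 \<in> Auts G"
  shows "\<exists>D. bij_betw D (Aut_incl p s)
    {\<psi> \<in> Auts G. ext_equiv p G `` {twist \<psi>} = ext_equiv p G `` {twist \<psi>0}}" (is "\<exists>D. bij_betw D _ ?F")
proof -
  have p0: "\<psi>0 \<in> iso G G" using psi0 by (simp add: Auts_def)
  then have p0inj: "inj_on \<psi>0 (carrier G)" by (simp add: iso_iff)
  have mem: "\<psi> \<in> ?F \<longleftrightarrow> \<psi> \<in> Auts G \<and> (\<exists>\<phi>\<in>Aut_incl p s. \<forall>x\<in>carrier H. \<psi> (q x) = \<psi>0 (q (\<phi> x)))" for \<psi>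
  proof (cases "\<psi> \<in> Auts G")
    case True
    have "ext_equiv p G `` {twist \<psi>} = ext_equiv p G `` {twist \<psi>0} \<longleftrightarrow> (twist \<psi>, twist \<psi>0) \<in> ext_equiv p G"
      using eq_equiv_class_iff[OF ext_equiv_equiv twist(1)[OF True] twist(1)[OF psi0]] .
    also have "\<dots> \<longleftrightarrow> (\<exists>\<phi>\<in>lin_iso Z H H. (\<forall>a\<in>carrier Z. \<phi> (i a) = i a) \<and> (\<forall>x\<in>carrier H. \<psi>0 (q (\<phi> x)) = \<psi> (q x)))"
      unfolding ext_equiv_def using twist(1)[OF True] twist(1)[OF psi0] by simp
    also have "\<dots> \<longleftrightarrow> (\<exists>\<phi>\<in>Aut_incl p s. \<forall>x\<in>carrier H. \<psi> (q x) = \<psi>0 (q (\<phi> x)))"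
    proof
      assume "\<exists>\<phi>\<in>lin_iso Z H H. (\<forall>a\<in>carrier Z. \<phi> (i a) = i a) \<and> (\<forall>x\<in>carrier H. \<psi>0 (q (\<phi> x)) = \<psi> (q x))"
      then obtain \<phi> where \<phi>: "\<phi> \<in> lin_iso Z H H" "\<forall>a\<in>carrier Z. \<phi> (i a) = i a" "\<forall>x\<in>carrier H. \<psi>0 (q (\<phi> x)) = \<psi> (q x)" by blast
      have "restrict \<phi> (carrier H) \<in> lin_iso Z H H" by (rule lin_iso_cong[OF exact_seq_module[OF s] \<phi>(1)]) simp
      then have "restrict \<phi> (carrier H) \<in> Aut_incl p s" using \<phi>(2) by (simp add: Aut_incl_def)
      then show "\<exists>\<phi>\<in>Aut_incl p s. \<forall>x\<in>carrier H. \<psi> (q x) = \<psi>0 (q (\<phi> x))"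
        by (rule bexI[rotated]) (use \<phi>(3) in auto)
    next
      assume "\<exists>\<phi>\<in>Aut_incl p s. \<forall>x\<in>carrier H. \<psi> (q x) = \<psi>0 (q (\<phi> x))"
      then obtain \<phi> where "\<phi>\<in>Aut_incl p s" "\<forall>x\<in>carrier H. \<psi> (q x) = \<psi>0 (q (\<phi> x))" by blast
      then show "\<exists>\<phi>\<in>lin_iso Z H H. (\<forall>a\<in>carrier Z. \<phi> (i a) = i a) \<and> (\<forall>x\<in>carrier H. \<psi>0 (q (\<phi> x)) = \<psi> (q x))"
        by (intro bexI[of _ \<phi>]) (auto simp: Aut_incl_def)
    qed
    finally show ?thesis using True by simp
  qed simp
  have uniq: "\<psi> = \<psi>'" if "\<psi> \<in> Auts G" "\<psi>' \<in> Auts G" "\<And>x. x \<in> carrier H \<Longrightarrow> \<psi> (q x) = \<psi>' (q x)" for \<psi> \<psi>'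
  proof (rule extensionalityI)
    show "\<psi> \<in> extensional (carrier G)" "\<psi>' \<in> extensional (carrier G)" using that by (auto simp: Auts_def)
    fix g assume "g \<in> carrier G"
    then obtain x where "x \<in> carrier H" "q x = g" using iso_q_surj by blast
    then show "\<psi> g = \<psi>' g" using that(3) by blast
  qed
  have ex: "\<exists>\<psi>. \<psi> \<in> Auts G \<and> (\<forall>x\<in>carrier H. \<psi> (q x) = \<psi>0 (q (\<phi> x)))" if "\<phi> \<in> Aut_incl p s" for \<phi>
  proof -
    have "\<phi> \<in> lin_iso Z (middle s) (middle (twist \<psi>0))" "\<And>a. a \<in> carrier Z \<Longrightarrow> \<phi> (i a) = incl (twist \<psi>0) a"
      using that by (auto simp: Aut_incl_def)
    from middle_iso_descends[OF s extensionsD(1)[OF twist(1)[OF psi0]] this] obtain \<psi> where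
      "\<psi> \<in> iso G G" "\<psi> \<in> extensional (carrier G)" "\<forall>x\<in>carrier H. \<psi> (q x) = \<psi>0 (q (\<phi> x))" by auto
    then show ?thesis unfolding Auts_def by blast
  qed
  define D where "D \<phi> = (SOME \<psi>. \<psi> \<in> Auts G \<and> (\<forall>x\<in>carrier H. \<psi> (q x) = \<psi>0 (q (\<phi> x))))" for \<phi>
  have D: "D \<phi> \<in> Auts G" "x \<in> carrier H \<Longrightarrow> D \<phi> (q x) = \<psi>0 (q (\<phi> x))" if "\<phi> \<in> Aut_incl p s" for \<phi> x
    using someI_ex[OF ex[OF that]] unfolding D_def by auto
  have "bij_betw D (Aut_incl p s) ?F"
  proof (rule bij_betw_imageI)
    show "inj_on D (Aut_incl p s)"
    proof (rule inj_onI)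
      fix \<phi> \<phi>' assume a: "\<phi> \<in> Aut_incl p s" "\<phi>' \<in> Aut_incl p s" "D \<phi> = D \<phi>'"
      show "\<phi> = \<phi>'"
      proof (rule Aut_incl_ext[OF a(1,2)])
        fix x assume x: "x \<in> carrier H"
        have "\<psi>0 (q (\<phi> x)) = \<psi>0 (q (\<phi>' x))" using D(2)[OF a(1) x] D(2)[OF a(2) x] a(3) by simp
        moreover have "\<phi> x \<in> carrier H" "\<phi>' x \<in> carrier H"
          using a(1,2) x by (auto simp: Aut_incl_def dest!: lin_isoD(1) dest: lin_homD(1))
        ultimately show "q (\<phi> x) = q (\<phi>' x)" using inj_onD[OF p0inj] by simp
      qed
    qed
    show "D ` Aut_incl p s = ?F"
    proof
      show "D ` Aut_incl p s \<subseteq> ?F"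
      proof (rule image_subsetI)
        fix \<phi> assume "\<phi> \<in> Aut_incl p s"
        then show "D \<phi> \<in> ?F" using D unfolding mem by blast
      qed
      show "?F \<subseteq> D ` Aut_incl p s"
      proof
        fix \<psi> assume "\<psi> \<in> ?F"
        then obtain \<phi> where 1: "\<psi> \<in> Auts G" "\<phi>\<in>Aut_incl p s" "\<forall>x\<in>carrier H. \<psi> (q x) = \<psi>0 (q (\<phi> x))" unfolding mem by blast
        have "\<psi> = D \<phi>" by (rule uniq) (use 1 D[OF 1(2)] in auto)
        then show "\<psi> \<in> D ` Aut_incl p s" using 1(2) by blast
      qed
    qed
  qed
  then show ?thesis by blast
qed

lemma id_Auts: "restrict (\<lambda>x. x) (carrier G) \<in> Auts G"
  using G.iso_eq[OF iso_set_refl, of "restrict (\<lambda>x. x) (carrier G)"] by (simp add: Auts_def)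

lemma finite_Aut_incl: "finite (Aut_incl p s)" and card_Aut_incl_pos: "0 < card (Aut_incl p s)"
proof -
  from twist_fibre[OF id_Auts] obtain D where D: "bij_betw D (Aut_incl p s)
    {\<psi> \<in> Auts G. ext_equiv p G `` {twist \<psi>} = ext_equiv p G `` {twist (restrict (\<lambda>x. x) (carrier G))}}" by blast
  show f: "finite (Aut_incl p s)"
    using bij_betw_finite[OF D] finite_Auts[OF pgroupD(3)[OF G_pgroup]] by simp
  have "restrict (\<lambda>x. x) (carrier H) \<in> Aut_incl p s"
    using lin_iso_cong[OF exact_seq_module[OF s] lin_iso_id, of "restrict (\<lambda>x. x) (carrier H)"] by (simp add: Aut_incl_def)
  then show "0 < card (Aut_incl p s)" using f card_gt_0_iff by blast
qed

text \<open>The orbit-stabilizer theorem for the action of \<open>Aut(G)\<close> on \<open>Ext(G, Zp)\<close>.\<close>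

lemma card_Auts:
  "card (Auts G) = card (Aut_incl p s) * card {\<eta> \<in> Ext p G. \<eta> \<subseteq> seq_iso_rel p `` {s}}"
  unfolding twist_image[symmetric]
proof (rule card_eq_fibre_times_image)
  show "finite (Auts G)" using finite_Auts[OF pgroupD(3)[OF G_pgroup]] .
  fix \<psi>0 assume "\<psi>0 \<in> Auts G"
  from twist_fibre[OF this] show "card {\<psi> \<in> Auts G. ext_equiv p G `` {twist \<psi>} = ext_equiv p G `` {twist \<psi>0}} = card (Aut_incl p s)"
    by (elim exE) (rule bij_betw_same_card[symmetric])
qed

end

context padic begin

text \<open>Conjugation with an isomorphism of the middle terms. As the relation is symmetric, equality follows.\<close>

lemma card_Aut_incl_le:
  assumes st: "(s, t) \<in> seq_iso_rel p"
  shows "card (Aut_incl p s) \<le> card (Aut_incl p t)"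
proof -
  obtain f where s: "s \<in> exact_seqs p" and t: "t \<in> exact_seqs p" and f: "f \<in> lin_iso Z (middle s) (middle t)"
    and fi: "\<And>a. a \<in> carrier Z \<Longrightarrow> f (incl s a) = incl t a" using st unfolding seq_iso_iff by blast
  let ?g = "inv_into (carrier (middle s)) f"
  have gf: "?g (f x) = x" if "x \<in> carrier (middle s)" for x using lin_isoD(2)[OF f] that by (rule inv_into_f_f)
  note fc = lin_homD(1)[OF lin_isoD(1)[OF f]]
  let ?C = "\<lambda>\<phi>. restrict (\<lambda>y. f (\<phi> (?g y))) (carrier (middle t))"
  have "?C ` Aut_incl p s \<subseteq> Aut_incl p t"
  proof (rule image_subsetI)
    fix \<phi> assume "\<phi> \<in> Aut_incl p s"
    then have \<phi>: "\<phi> \<in> lin_iso Z (middle s) (middle s)" "\<And>a. a \<in> carrier Z \<Longrightarrow> \<phi> (incl s a) = incl s a" by (auto simp: Aut_incl_def)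
    have "(\<lambda>y. f (\<phi> (?g y))) \<in> lin_iso Z (middle t) (middle t)"
      using lin_iso_comp[OF lin_iso_comp[OF lin_iso_inv[OF exact_seq_module[OF s] f] \<phi>(1)] f] .
    then have "?C \<phi> \<in> lin_iso Z (middle t) (middle t)" by (rule lin_iso_cong[OF exact_seq_module[OF t]]) simp
    moreover have "?C \<phi> (incl t a) = incl t a" if a: "a \<in> carrier Z" for a
      using gf[OF exact_seq_incl[OF s a]] fi[OF a] \<phi>(2)[OF a] exact_seq_incl[OF t a] by simp
    ultimately show "?C \<phi> \<in> Aut_incl p t" by (simp add: Aut_incl_def)
  qed
  moreover have "inj_on ?C (Aut_incl p s)"
  proof (rule inj_onI)
    fix \<phi> \<phi>' assume a: "\<phi> \<in> Aut_incl p s" "\<phi>' \<in> Aut_incl p s" "?C \<phi> = ?C \<phi>'"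
    then have l: "\<phi> \<in> lin_iso Z (middle s) (middle s)" "\<phi>' \<in> lin_iso Z (middle s) (middle s)" by (auto simp: Aut_incl_def)
    show "\<phi> = \<phi>'"
    proof (rule extensionalityI)
      show "\<phi> \<in> extensional (carrier (middle s))" "\<phi>' \<in> extensional (carrier (middle s))" using a by (auto simp: Aut_incl_def)
      fix x assume x: "x \<in> carrier (middle s)"
      have "f (\<phi> x) = f (\<phi>' x)" using fun_cong[OF a(3), of "f x"] fc[OF x] gf[OF x] by simp
      then show "\<phi> x = \<phi>' x"
        using inj_onD[OF lin_isoD(2)[OF f]] lin_homD(1)[OF lin_isoD(1)[OF l(1)] x] lin_homD(1)[OF lin_isoD(1)[OF l(2)] x] by simp
    qed
  qed
  ultimately show ?thesis using card_inj_on_le exact_sequence.finite_Aut_incl[OF exact_sequenceI[OF t]] by blast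
qed

lemma edge_weight_eq:
  assumes "e \<in> edges p" "t \<in> e"
  shows "edge_weight p e = 1 / (real (card (Aut_incl p t)) * real (order (quot t)))"
proof -
  note r = edge_member(2)[OF assms]
  then have r': "(t, rep e) \<in> seq_iso_rel p" using seq_iso_equiv by (auto simp: equiv_def dest: symD)
  have "card (Aut_incl p (rep e)) = card (Aut_incl p t)"
    using card_Aut_incl_le[OF r] card_Aut_incl_le[OF r'] by simp
  moreover have "order (quot (rep e)) = order (quot t)"
    using seq_iso_quot[OF r] by (simp add: order_def iso_same_card)
  ultimately show ?thesis by (simp add: edge_weight_def)
qed

lemma order_pos: "G \<in> pgroups p \<Longrightarrow> 0 < order G"
  using pgroupD[of G] by (simp add: order_def card_gt_0_iff group.is_monoid monoid.carrier_not_empty)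

lemma edge_weight_pos:
  assumes "e \<in> edges p" shows "0 < edge_weight p e"
  unfolding edge_weight_def
  using exact_sequence.card_Aut_incl_pos[OF exact_sequenceI[OF edge_rep(2)[OF assms]]]
    order_pos[OF exact_seq_ends(1)[OF edge_rep(2)[OF assms]]] by simp

text \<open>By \<open>card_Auts\<close>, applied to a representative of the edge with quotient \<open>G\<close>.\<close>

lemma edge_weight_group:
  assumes e: "e \<in> edges p" "t \<in> e" "quot t \<cong> G" and G: "G \<in> pgroups p"
  shows "edge_weight p e = real (card {\<eta> \<in> Ext p G. \<eta> \<subseteq> e}) / (real (card (Auts G)) * real (order G))"
    "card {\<eta> \<in> Ext p G. \<eta> \<subseteq> e} > 0" "0 < card (Auts G)"
proof -
  obtain \<psi> where \<psi>: "\<psi> \<in> iso (quot t) G" using e(3) by (auto simp: is_iso_def)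
  define u where "u = t\<lparr>quot := G, proj := (\<lambda>x. \<psi> (proj t x))\<rparr>"
  note m = edge_member[OF e(1,2)]
  have "(t, u) \<in> seq_iso_rel p" using change_quot(2)[OF m(1) G \<psi>] by (simp add: u_def)
  then have ue: "u \<in> e" using m(3) by blast
  note mu = edge_member[OF e(1) ue]
  have qu: "quot u = G" by (simp add: u_def)
  interpret U: exact_sequence p u using mu(1) by (rule exact_sequenceI)
  have c: "card (Auts G) = card (Aut_incl p u) * card {\<eta> \<in> Ext p G. \<eta> \<subseteq> e}"
    using U.card_Auts mu(3) qu by simp
  have "restrict (\<lambda>x. x) (carrier G) \<in> Auts G" using U.id_Auts qu by simp
  then show p0: "0 < card (Auts G)" using finite_Auts[OF pgroupD(3)[OF G]] card_gt_0_iff by blast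
  then show "card {\<eta> \<in> Ext p G. \<eta> \<subseteq> e} > 0" using c by (metis bot_nat_0.not_eq_extremum mult_0_right)
  then have "real (card {\<eta> \<in> Ext p G. \<eta> \<subseteq> e}) / (real (card (Auts G)) * real (order G)) = 1 / (real (card (Aut_incl p u)) * real (order G))"
    unfolding c by simp
  then show "edge_weight p e = real (card {\<eta> \<in> Ext p G. \<eta> \<subseteq> e}) / (real (card (Auts G)) * real (order G))"
    using edge_weight_eq[OF e(1) ue] qu by simp
qed

lemma Ext_in_edge:
  assumes "\<eta> \<in> Ext p G" "G \<in> pgroups p"
  obtains e where "e \<in> edges p" "rep \<eta> \<in> e" "\<eta> \<subseteq> e" "rep \<eta> \<in> \<eta>" "quot (rep \<eta>) = G"
proof -
  have eta: "\<eta> \<in> extensions p G // ext_equiv p G" using assms by (simp add: Ext_def)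
  note r = rep_in_class[OF ext_equiv_equiv eta]
  have rs: "rep \<eta> \<in> exact_seqs p" using extensionsD(1)[OF r(2)] .
  define e where "e = seq_iso_rel p `` {rep \<eta>}"
  have "e \<in> edges p" unfolding e_def edges_eq using rs by (rule quotientI)
  moreover have "rep \<eta> \<in> e" unfolding e_def using equiv_class_self[OF seq_iso_equiv rs] .
  moreover have "\<eta> \<subseteq> e"
  proof
    fix t assume "t \<in> \<eta>"
    then have "(rep \<eta>, t) \<in> ext_equiv p G" using r(3) by blast
    then show "t \<in> e" unfolding e_def by (auto simp: seq_iso_iff ext_equiv_def extensions_def)
  qed
  ultimately show thesis using that r(1) extensionsD(2)[OF r(2)] by blast
qed

lemma edges_disjoint: "e \<in> edges p \<Longrightarrow> e' \<in> edges p \<Longrightarrow> x \<in> e \<Longrightarrow> x \<in> e' \<Longrightarrow> e = e'"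
  using edge_member(3) by metis

text \<open>Each element of \<open>Ext(G, Zp)\<close> is contained in exactly one edge at \<open>G\<close>, and the weight of an edge is the
number of classes contained in it divided by the constant \<open>|Aut(G)| |G|\<close>. The constant cancels in the quotient.\<close>

lemma walk_from_group:
  assumes g: "g \<in> X0 p"
  defines "E \<equiv> {e \<in> edges p. Inl g \<in> edge_ends p e}"
  shows "finite E" "0 < sum (edge_weight p) E"
    "h \<in> X1 p \<Longrightarrow> prob_d_star p (rep g) (rep h) = sum (edge_weight p) {e \<in> edges p. edge_ends p e = {Inl g, Inr h}} / sum (edge_weight p) E"
proof -
  define G where "G = rep g"
  have G: "G \<in> pgroups p" using X0_rep(2)[OF g] by (simp add: G_def)
  define C where "C e = {\<eta> \<in> Ext p G. \<eta> \<subseteq> e}" for e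
  define c where "c = real (card (Auts G)) * real (order G)"
  have EI: "e \<in> E \<longleftrightarrow> e \<in> edges p \<and> quot t \<cong> G" if "t \<in> e" "e \<in> edges p" for e t
    using Inl_edge_ends_iff[OF g that(2,1)] that by (simp add: E_def G_def)
  have in_E: "\<exists>e\<in>E. \<eta> \<in> C e \<and> rep \<eta> \<in> e" if eta: "\<eta> \<in> Ext p G" for \<eta>
  proof -
    obtain e where "e \<in> edges p" "rep \<eta> \<in> e" "\<eta> \<subseteq> e" "quot (rep \<eta>) = G" by (rule Ext_in_edge[OF eta G]) blast
    then show ?thesis using EI eta by (intro bexI[of _ e]) (auto simp: C_def)
  qed
  have repE: "rep \<eta> \<in> \<eta>" if eta: "\<eta> \<in> Ext p G" for \<eta> by (rule Ext_in_edge[OF eta G]) blast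
  have fE: "finite (Ext p G)" and nE: "Ext p G \<noteq> {}" using finite_Ext[OF G] Ext_nonempty[OF G] by auto
  have fC: "finite (C e)" for e using fE by (simp add: C_def)
  have disj: "C e \<inter> C e' = {}" if "e \<in> E" "e' \<in> E" "e \<noteq> e'" for e e'
    using that repE edges_disjoint by (fastforce simp: C_def E_def)
  have wt: "edge_weight p e = real (card (C e)) / c" "C e \<noteq> {}" "c > 0" if "e \<in> E" for e
  proof -
    have e: "e \<in> edges p" using that by (simp add: E_def)
    have "quot (rep e) \<cong> G" using EI[OF edge_rep(1)[OF e] e] that by simp
    from edge_weight_group[OF e edge_rep(1)[OF e] this G]
    show "edge_weight p e = real (card (C e)) / c" "C e \<noteq> {}" "c > 0"
      using order_pos[OF G] by (auto simp: C_def c_def card_gt_0_iff)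
  qed
  have UE: "(\<Union>e\<in>E. C e) = Ext p G" using in_E by (auto simp: C_def)
  show finE: "finite E"
  proof (rule ccontr)
    assume "infinite E"
    have "inj_on C E"
    proof (rule inj_onI)
      fix e e' assume "e \<in> E" "e' \<in> E" "C e = C e'"
      then show "e = e'" using disj[of e e'] wt(2)[of e] by auto
    qed
    moreover have "C ` E \<subseteq> Pow (Ext p G)" by (auto simp: C_def)
    ultimately show False using fE \<open>infinite E\<close> by (meson finite_Pow_iff finite_subset finite_image_iff)
  qed
  have sumE: "sum (edge_weight p) E' = real (card (\<Union>e\<in>E'. C e)) / c" if "E' \<subseteq> E" for E'
  proof -
    have "sum (edge_weight p) E' = (\<Sum>e\<in>E'. real (card (C e)) / c)"
      by (rule sum.cong) (use wt(1) that in auto)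
    also have "\<dots> = real (\<Sum>e\<in>E'. card (C e)) / c" by (simp add: sum_divide_distrib)
    also have "(\<Sum>e\<in>E'. card (C e)) = card (\<Union>e\<in>E'. C e)"
    proof (rule card_UN_disjoint[symmetric])
      show "finite E'" using that finE finite_subset by blast
      show "\<forall>e\<in>E'. finite (C e)" using fC by blast
      show "\<forall>e\<in>E'. \<forall>e'\<in>E'. e \<noteq> e' \<longrightarrow> C e \<inter> C e' = {}" using disj that by blast
    qed
    finally show ?thesis .
  qed
  have cE: "0 < card (Ext p G)" using fE nE by (simp add: card_gt_0_iff)
  obtain e0 where "e0 \<in> E" using nE in_E by blast
  then have c0: "0 < c" by (rule wt(3))
  show pos: "0 < sum (edge_weight p) E" using sumE[OF order_refl] UE cE c0 by simp
  assume h: "h \<in> X1 p"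
  let ?E = "{e \<in> edges p. edge_ends p e = {Inl g, Inr h}}"
  have sub: "?E \<subseteq> E" by (auto simp: E_def)
  have mem: "e \<in> ?E \<longleftrightarrow> zmod_isomorphic p (middle t) (rep h)" if "e \<in> E" "t \<in> e" for e t
  proof -
    have e: "e \<in> edges p" "Inl g \<in> edge_ends p e" using that by (auto simp: E_def)
    show ?thesis using e edge_ends_pair_iff[OF e(1)] Inr_edge_ends_iff[OF h e(1) that(2)] by simp
  qed
  have "(\<Union>e\<in>?E. C e) = {\<xi> \<in> Ext p G. zmod_isomorphic p (middle (rep \<xi>)) (rep h)}"
  proof
    show "(\<Union>e\<in>?E. C e) \<subseteq> {\<xi> \<in> Ext p G. zmod_isomorphic p (middle (rep \<xi>)) (rep h)}"
    proof (rule UN_least, rule subsetI)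
      fix e \<eta> assume e: "e \<in> ?E" and eta: "\<eta> \<in> C e"
      then have "\<eta> \<in> Ext p G" "rep \<eta> \<in> e" using repE by (auto simp: C_def)
      then show "\<eta> \<in> {\<xi> \<in> Ext p G. zmod_isomorphic p (middle (rep \<xi>)) (rep h)}"
        using mem[of e "rep \<eta>"] e sub by auto
    qed
    show "{\<xi> \<in> Ext p G. zmod_isomorphic p (middle (rep \<xi>)) (rep h)} \<subseteq> (\<Union>e\<in>?E. C e)"
    proof
      fix \<eta> assume "\<eta> \<in> {\<xi> \<in> Ext p G. zmod_isomorphic p (middle (rep \<xi>)) (rep h)}"
      then have eta: "\<eta> \<in> Ext p G" "zmod_isomorphic p (middle (rep \<eta>)) (rep h)" by auto
      obtain e where e: "e \<in> E" "\<eta> \<in> C e" "rep \<eta> \<in> e" using in_E[OF eta(1)] by blast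
      then have "e \<in> ?E" using mem[OF e(1,3)] eta(2) by simp
      then show "\<eta> \<in> (\<Union>e\<in>?E. C e)" using e(2) by blast
    qed
  qed
  moreover have "prob_d_star p G (rep h) = real (card {\<xi> \<in> Ext p G. zmod_isomorphic p (middle (rep \<xi>)) (rep h)}) / real (card (Ext p G))"
  proof -
    have "Ext p G \<inter> {\<xi>. zmod_isomorphic p (middle (rep \<xi>)) (rep h)} = {\<xi> \<in> Ext p G. zmod_isomorphic p (middle (rep \<xi>)) (rep h)}"
      by blast
    then show ?thesis unfolding prob_d_star_def measure_pmf_of_set[OF nE fE] by simp
  qed
  ultimately show "prob_d_star p (rep g) (rep h) = sum (edge_weight p) ?E / sum (edge_weight p) E"
    using sumE[OF sub] sumE[OF order_refl] UE c0 by (simp add: G_def)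
qed

end

section \<open>Haar measure\<close>

subsection \<open>Random p-adic integers from independent digits\<close>

lemma sum_digits_less:
  fixes b :: nat
  assumes "\<And>i. i < n \<Longrightarrow> d i < b"
  shows "(\<Sum>i<n. d i * b ^ i) < b ^ n"
  using assms
proof (induction n)
  case (Suc n)
  have "d n * b ^ n \<le> (b - 1) * b ^ n" using Suc.prems[of n] by (intro mult_right_mono) auto
  moreover have "(\<Sum>i<n. d i * b ^ i) < b ^ n" using Suc by simp
  moreover have "(b - 1) * b ^ n + b ^ n = b ^ Suc n" using Suc.prems[of n] by (cases b) auto
  ultimately show ?case unfolding sum.lessThan_Suc by linarith
qed simp

text \<open>A residue modulo \<open>b ^ n\<close> prescribes \<open>n\<close> digits, namely those in \<open>d\<close>. In this form an event about a
residue becomes one about independent coordinates.\<close>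

lemma digits_exist:
  fixes b :: nat
  assumes "c < b ^ n"
  shows "\<exists>d. (\<forall>i<n. d i < b) \<and> (\<forall>w. (\<forall>i. w i < b) \<longrightarrow> ((\<Sum>i<n. w i * b ^ i) = c \<longleftrightarrow> (\<forall>i<n. w i = d i)))"
  using assms
proof (induction n arbitrary: c)
  case (Suc n)
  have b: "0 < b" using Suc.prems by (cases b) auto
  from Suc.IH[of "c mod b ^ n"] b obtain d where d: "\<And>i. i < n \<Longrightarrow> d i < b"
    "\<And>w. (\<forall>i. w i < b) \<Longrightarrow> (\<Sum>i<n. w i * b ^ i) = c mod b ^ n \<longleftrightarrow> (\<forall>i<n. w i = d i)" by auto
  have q: "c div b ^ n < b" using Suc.prems by (simp add: less_mult_imp_div_less)
  show ?case
  proof (intro exI[of _ "d(n := c div b ^ n)"] conjI allI impI)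
    fix i assume "i < Suc n" then show "(d(n := c div b ^ n)) i < b" using d(1) q by (auto simp: less_Suc_eq)
  next
    fix w :: "nat \<Rightarrow> nat" assume w: "\<forall>i. w i < b"
    have S: "(\<Sum>i<n. w i * b ^ i) < b ^ n" using w by (intro sum_digits_less) auto
    have "(\<Sum>i<Suc n. w i * b ^ i) = c \<longleftrightarrow> (\<Sum>i<n. w i * b ^ i) = c mod b ^ n \<and> w n = c div b ^ n"
    proof
      assume *: "(\<Sum>i<Suc n. w i * b ^ i) = c"
      then have "c = w n * b ^ n + (\<Sum>i<n. w i * b ^ i)" by simp
      then show "(\<Sum>i<n. w i * b ^ i) = c mod b ^ n \<and> w n = c div b ^ n" using S b by simp
    next
      assume "(\<Sum>i<n. w i * b ^ i) = c mod b ^ n \<and> w n = c div b ^ n"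
      then show "(\<Sum>i<Suc n. w i * b ^ i) = c" using mod_div_mult_eq[of c "b ^ n"] by simp
    qed
    then show "(\<Sum>i<Suc n. w i * b ^ i) = c \<longleftrightarrow> (\<forall>i<Suc n. w i = (d(n := c div b ^ n)) i)"
      using d(2)[OF w] by (auto simp: less_Suc_eq)
  qed
qed simp

context padic begin

definition digit_space :: "(nat \<Rightarrow> nat) measure" where
  "digit_space = PiM UNIV (\<lambda>_. uniform_count_measure {..<p})"

definition from_digits :: "(nat \<Rightarrow> nat) \<Rightarrow> padic" where
  "from_digits w = (\<lambda>n. int (\<Sum>i<n. w i * p ^ i))"

lemma space_digit_space: "space digit_space = UNIV \<rightarrow>\<^sub>E {..<p}"
  by (simp add: digit_space_def space_PiM space_uniform_count_measure)

lemma digit_prob: "prob_space digit_space"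
  unfolding digit_space_def using p_gt_1
  by (intro prob_space_PiM prob_space_uniform_count_measure) auto

lemma from_digits_closed:
  assumes "w \<in> space digit_space" shows "from_digits w \<in> carrier Z"
proof -
  have w: "w i < p" for i using assms by (auto simp: space_digit_space)
  show ?thesis
  proof (rule Z_memI)
    fix n
    have "(\<Sum>i<n. w i * p ^ i) < p ^ n" using w by (intro sum_digits_less)
    then have "int (\<Sum>i<n. w i * p ^ i) < int p ^ n" by (metis of_nat_less_iff of_nat_power)
    then show "from_digits w n = from_digits w n mod int p ^ n"
      unfolding from_digits_def by (simp only: mod_pos_pos_trivial of_nat_0_le_iff)
    have "from_digits w (Suc n) = from_digits w n + int (w n) * int p ^ n" by (simp add: from_digits_def)
    then show "from_digits w (Suc n) mod int p ^ n = from_digits w n mod int p ^ n" by simp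
  qed
qed

lemma digit_cylinder:
  assumes "a \<in> carrier Z"
  shows "{w \<in> space digit_space. from_digits w n = a n} \<in> sets digit_space" (is "?A \<in> _")
    "emeasure digit_space {w \<in> space digit_space. from_digits w n = a n} = ennreal (1 / p) ^ n"
proof -
  let ?U = "uniform_count_measure {..<p}"
  interpret U: prob_space ?U using p_gt_1 by (intro prob_space_uniform_count_measure) auto
  interpret product_prob_space "\<lambda>_. ?U" UNIV by unfold_locales
  have "nat (a n) < p ^ n" using Z_bounds[OF assms, of n] by (simp add: nat_less_iff)
  from digits_exist[OF this] obtain d where d: "\<And>i. i < n \<Longrightarrow> d i < p"
    "\<And>w. (\<forall>i. w i < p) \<Longrightarrow> (\<Sum>i<n. w i * p ^ i) = nat (a n) \<longleftrightarrow> (\<forall>i<n. w i = d i)" by blast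
  have "from_digits w n = a n \<longleftrightarrow> (\<forall>i\<in>{..<n}. w i \<in> {d i})" if "w \<in> space digit_space" for w
  proof -
    have w: "\<forall>i. w i < p" using that by (auto simp: space_digit_space)
    have "from_digits w n = a n \<longleftrightarrow> (\<Sum>i<n. w i * p ^ i) = nat (a n)"
      using Z_bounds(1)[OF assms, of n] unfolding from_digits_def by linarith
    then show ?thesis using d(2)[OF w] by auto
  qed
  then have A: "?A = {w \<in> space (Pi\<^sub>M UNIV (\<lambda>_. ?U)). \<forall>i\<in>{..<n}. w i \<in> {d i}}"
    unfolding digit_space_def by blast
  have ds: "{d i} \<in> sets ?U" if "i \<in> {..<n}" for i using d(1) that by (simp add: sets_uniform_count_measure)
  show "?A \<in> sets digit_space"
    unfolding A unfolding digit_space_def using ds by measurable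
  have "emeasure digit_space ?A = (\<Prod>i<n. emeasure ?U {d i})"
    unfolding A unfolding digit_space_def by (rule emeasure_PiM_Collect) (use ds in auto)
  also have "\<dots> = (\<Prod>i<n. ennreal (1 / p))"
    by (rule prod.cong[OF refl], subst emeasure_uniform_count_measure) (use d(1) in auto)
  finally show "emeasure digit_space ?A = ennreal (1 / p) ^ n" by simp
qed

end

subsection \<open>Cosets in a module of rank one\<close>

locale rank1_module = padic_module p H for p and H :: zmod (structure) +
  fixes \<pi> e k
  assumes split: "rank1_split \<pi> e k"
begin

text \<open>The torsion part of \<open>H\<close>; an element \<open>x\<close> has the coordinates \<open>\<pi> x\<close> and \<open>tor x\<close> in \<open>Zp e \<oplus> T\<close>.\<close>

definition T where "T = {x \<in> carrier H. \<pi> x = \<zero>\<^bsub>Z\<^esub>}"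
definition tor where "tor x = x \<ominus> \<pi> x \<odot> e"

lemma pi_lin: "\<pi> \<in> lin_hom Z H Z" and e_closed [simp]: "e \<in> carrier H" and pi_e [simp]: "\<pi> e = \<one>\<^bsub>Z\<^esub>"
  and finite_T: "finite T" and T_kill: "x \<in> T \<Longrightarrow> pint (int p ^ k) \<odot> x = \<zero>"
  using split by (auto simp: rank1_split_def T_def)

lemma pi_closed [simp]: "x \<in> carrier H \<Longrightarrow> \<pi> x \<in> carrier Z"
  and pi_add: "x \<in> carrier H \<Longrightarrow> y \<in> carrier H \<Longrightarrow> \<pi> (x \<oplus> y) = \<pi> x \<oplus>\<^bsub>Z\<^esub> \<pi> y"
  and pi_smult: "a \<in> carrier Z \<Longrightarrow> x \<in> carrier H \<Longrightarrow> \<pi> (a \<odot> x) = a \<otimes>\<^bsub>Z\<^esub> \<pi> x"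
  using lin_homD[OF pi_lin] by (auto simp: Z_smult)

lemma T_closed: "t \<in> T \<Longrightarrow> t \<in> carrier H" and pi_T: "t \<in> T \<Longrightarrow> \<pi> t = \<zero>\<^bsub>Z\<^esub>"
  by (auto simp: T_def)

lemma zero_T: "\<zero> \<in> T"
  using lin_hom_zero[OF pi_lin Z_module] by (simp add: T_def)

lemma tor_T: "x \<in> carrier H \<Longrightarrow> tor x \<in> T"
  using lin_hom_diff[OF pi_lin Z_module, of x "\<pi> x \<odot> e"]
  by (simp add: T_def tor_def pi_smult a_minus_def Z.r_neg)

lemma decomp: "x \<in> carrier H \<Longrightarrow> x = \<pi> x \<odot> e \<oplus> tor x"
  using T_closed[OF tor_T] by (simp add: tor_def a_minus_def M.a_comm M.a_lcomm M.r_neg)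

lemma comp_closed: "c \<in> carrier Z \<Longrightarrow> t \<in> T \<Longrightarrow> c \<odot> e \<oplus> t \<in> carrier H"
  using T_closed by simp

lemma pi_comp: "c \<in> carrier Z \<Longrightarrow> t \<in> T \<Longrightarrow> \<pi> (c \<odot> e \<oplus> t) = c"
  using T_closed[of t] pi_T[of t] by (simp add: pi_add pi_smult)

lemma tor_comp:
  assumes "c \<in> carrier Z" "t \<in> T" shows "tor (c \<odot> e \<oplus> t) = t"
proof -
  have "tor (c \<odot> e \<oplus> t) = (c \<odot> e \<oplus> t) \<ominus> c \<odot> e" using pi_comp[OF assms] by (simp add: tor_def)
  then show ?thesis using assms T_closed[of t] by (simp add: a_minus_def M.a_ac M.r_neg2 M.r_neg)
qed

lemma pow_smult:
  assumes "x \<in> carrier H" "k \<le> n"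
  shows "pint (int p ^ n) \<odot> x = (pint (int p ^ n) \<otimes>\<^bsub>Z\<^esub> \<pi> x) \<odot> e"
proof -
  have t: "tor x \<in> T" "tor x \<in> carrier H" using tor_T[OF assms(1)] T_closed by auto
  have "pint (int p ^ n) = pint (int p ^ (n - k)) \<otimes>\<^bsub>Z\<^esub> pint (int p ^ k)"
    using assms(2) by (simp add: pint_mult[symmetric] power_add[symmetric])
  then have "pint (int p ^ n) \<odot> tor x = \<zero>" using t T_kill[OF t(1)] by (simp add: M.smult_assoc1)
  moreover have "pint (int p ^ n) \<odot> x = pint (int p ^ n) \<odot> (\<pi> x \<odot> e \<oplus> tor x)" using decomp[OF assms(1), symmetric] by simp
  ultimately show ?thesis using assms t by (simp add: M.smult_r_distr M.smult_assoc1)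
qed

definition pcoset :: "univ \<Rightarrow> nat \<Rightarrow> univ set" where
  "pcoset x n = (\<lambda>y. x \<oplus> [(p ^ n)] \<cdot>\<^bsub>H\<^esub> y) ` carrier H"

lemma pcoset_iff:
  "y \<in> pcoset x n \<longleftrightarrow> (\<exists>z\<in>carrier H. y = x \<oplus> pint (int p ^ n) \<odot> z)"
  unfolding pcoset_def using add_pow_smult[of _ "p ^ n"] by auto

lemma pcoset_closed: "x \<in> carrier H \<Longrightarrow> pcoset x n \<subseteq> carrier H"
  by (auto simp: pcoset_iff)

lemma pcoset_self: "x \<in> carrier H \<Longrightarrow> x \<in> pcoset x n"
  unfolding pcoset_iff by (rule bexI[of _ \<zero>]) auto

lemma pcoset_sub:
  assumes "x \<in> carrier H" "y \<in> pcoset x n" "n \<le> m"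
  shows "pcoset y m \<subseteq> pcoset x n"
proof
  fix w assume "w \<in> pcoset y m"
  then obtain z where z: "z \<in> carrier H" "w = y \<oplus> pint (int p ^ m) \<odot> z" by (auto simp: pcoset_iff)
  obtain v where v: "v \<in> carrier H" "y = x \<oplus> pint (int p ^ n) \<odot> v" using assms(2) by (auto simp: pcoset_iff)
  have "pint (int p ^ m) = pint (int p ^ n) \<otimes>\<^bsub>Z\<^esub> pint (int p ^ (m - n))"
    using assms(3) by (simp add: pint_mult[symmetric] power_add[symmetric])
  then have "w = x \<oplus> pint (int p ^ n) \<odot> (v \<oplus> pint (int p ^ (m - n)) \<odot> z)"
    using z v assms(1) by (simp add: M.smult_r_distr M.smult_assoc1 M.a_assoc)
  then show "w \<in> pcoset x n" using z v unfolding pcoset_iff by blast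
qed

lemma pcoset_sym:
  assumes "x \<in> carrier H" "y \<in> pcoset x n" shows "x \<in> pcoset y n"
proof -
  obtain v where v: "v \<in> carrier H" "y = x \<oplus> pint (int p ^ n) \<odot> v" using assms(2) by (auto simp: pcoset_iff)
  then have "x = y \<oplus> pint (int p ^ n) \<odot> (\<ominus> v)" using assms(1)
    by (simp add: M.smult_r_minus M.a_assoc M.r_neg)
  then show ?thesis using v unfolding pcoset_iff by blast
qed

lemma pcoset_eq:
  assumes "x \<in> carrier H" "y \<in> pcoset x n" shows "pcoset y n = pcoset x n"
  using pcoset_sub[OF assms order_refl] pcoset_sub[OF _ pcoset_sym[OF assms] order_refl] pcoset_closed[OF assms(1)] assms(2) by blast

lemma pcoset_disj: "x \<in> carrier H \<Longrightarrow> y \<in> carrier H \<Longrightarrow> pcoset x n \<noteq> pcoset y n \<Longrightarrow> pcoset x n \<inter> pcoset y n = {}"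
  using pcoset_eq by blast

text \<open>From level \<open>k\<close> on, \<open>p ^ n\<close> annihilates the torsion part, so a coset of \<open>p ^ n H\<close> fixes the torsion
coordinate.\<close>

lemma pcoset_fine:
  assumes x: "x \<in> carrier H" and n: "k \<le> n"
  shows "y \<in> pcoset x n \<longleftrightarrow> y \<in> carrier H \<and> tor y = tor x \<and> \<pi> y n = \<pi> x n"
proof
  assume "y \<in> pcoset x n"
  then obtain z where z: "z \<in> carrier H" "y = x \<oplus> pint (int p ^ n) \<odot> z" by (auto simp: pcoset_iff)
  have c: "\<pi> x \<oplus>\<^bsub>Z\<^esub> pint (int p ^ n) \<otimes>\<^bsub>Z\<^esub> \<pi> z \<in> carrier Z" using x z by simp
  have "y = \<pi> x \<odot> e \<oplus> tor x \<oplus> (pint (int p ^ n) \<otimes>\<^bsub>Z\<^esub> \<pi> z) \<odot> e"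
    using z(2) pow_smult[OF z(1) n] decomp[OF x, symmetric] by simp
  then have "y = (\<pi> x \<oplus>\<^bsub>Z\<^esub> pint (int p ^ n) \<otimes>\<^bsub>Z\<^esub> \<pi> z) \<odot> e \<oplus> tor x"
    using x z(1) T_closed[OF tor_T[OF x]] by (simp add: M.smult_l_distr M.a_ac)
  then have "tor y = tor x" "\<pi> y = \<pi> x \<oplus>\<^bsub>Z\<^esub> pint (int p ^ n) \<otimes>\<^bsub>Z\<^esub> \<pi> z" "y \<in> carrier H"
    using tor_comp[OF c tor_T[OF x]] pi_comp[OF c tor_T[OF x]] comp_closed[OF c tor_T[OF x]] by simp_all
  then show "y \<in> carrier H \<and> tor y = tor x \<and> \<pi> y n = \<pi> x n"
    using Z_mod_self[OF pi_closed[OF x]] by (simp add: Z_add Z_mult pint_def)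
next
  assume y: "y \<in> carrier H \<and> tor y = tor x \<and> \<pi> y n = \<pi> x n"
  obtain a where a: "a \<in> carrier Z" "\<pi> x = pint (\<pi> x n) \<oplus>\<^bsub>Z\<^esub> pint (int p ^ n) \<otimes>\<^bsub>Z\<^esub> a" using residue_decomposition x pi_closed by blast
  obtain b where b: "b \<in> carrier Z" "\<pi> y = pint (\<pi> x n) \<oplus>\<^bsub>Z\<^esub> pint (int p ^ n) \<otimes>\<^bsub>Z\<^esub> b" using residue_decomposition[OF pi_closed, of y n] y by auto
  have py: "\<pi> y = \<pi> x \<oplus>\<^bsub>Z\<^esub> pint (int p ^ n) \<otimes>\<^bsub>Z\<^esub> (b \<oplus>\<^bsub>Z\<^esub> (\<ominus>\<^bsub>Z\<^esub> a))"
    apply (subst a(2), subst b(2)) using a(1) b(1) by (simp add: Z.a_ac Z.r_distr Z.r_minus Z.r_neg2 Z.r_neg Z.r_neg1)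
  let ?d = "b \<oplus>\<^bsub>Z\<^esub> (\<ominus>\<^bsub>Z\<^esub> a)"
  have t: "tor x \<in> carrier H" using T_closed tor_T x by blast
  have "y = \<pi> y \<odot> e \<oplus> tor x" using decomp[of y] y by metis
  also have "\<dots> = (\<pi> x \<odot> e \<oplus> tor x) \<oplus> (pint (int p ^ n) \<otimes>\<^bsub>Z\<^esub> ?d) \<odot> e"
    unfolding py using a(1) b(1) x t by (simp add: M.smult_l_distr M.a_ac)
  also have "\<dots> = x \<oplus> pint (int p ^ n) \<odot> (?d \<odot> e)"
    using a(1) b(1) decomp[OF x, symmetric] by (simp add: M.smult_assoc1)
  finally have eq: "y = x \<oplus> pint (int p ^ n) \<odot> (?d \<odot> e)" .
  show "y \<in> pcoset x n" unfolding pcoset_iff by (rule bexI, rule eq) (use a(1) b(1) in simp)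
qed

subsection \<open>Existence and uniqueness of the Haar measure\<close>

text \<open>Only levels from \<open>k\<close> on are taken: there \<open>pcoset_fine\<close> describes the cosets, and they suffice to
generate the topology.\<close>

definition Fine where "Fine = {pcoset x n | x n. x \<in> carrier H \<and> k \<le> n}"

lemma FineI: "x \<in> carrier H \<Longrightarrow> k \<le> n \<Longrightarrow> pcoset x n \<in> Fine"
  unfolding Fine_def by blast

definition Level where "Level n = {pcoset x n | x. x \<in> carrier H}"

lemma pcoset_normal_form:
  assumes "x \<in> carrier H" "k \<le> n"
  shows "pcoset x n = pcoset (pint (\<pi> x n) \<odot> e \<oplus> tor x) n"
proof -
  note t = tor_T[OF assms(1)]
  have "pint (\<pi> x n) \<odot> e \<oplus> tor x \<in> pcoset x n"
  proof -
    have "pint (\<pi> x n) n = \<pi> x n" by (simp add: pint_def Z_mod_self assms(1))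
    then show ?thesis unfolding pcoset_fine[OF assms] using t
      by (simp add: comp_closed tor_comp pi_comp)
  qed
  then show ?thesis using pcoset_eq[OF assms(1)] by simp
qed

lemma finite_Level: "k \<le> n \<Longrightarrow> finite (Level n)"
proof (rule finite_subset)
  assume n: "k \<le> n"
  show "Level n \<subseteq> (\<lambda>(c, t). pcoset (pint c \<odot> e \<oplus> t) n) ` ({0..<int p ^ n} \<times> T)"
  proof
    fix C assume "C \<in> Level n"
    then obtain x where x: "x \<in> carrier H" "C = pcoset x n" by (auto simp: Level_def)
    then show "C \<in> (\<lambda>(c, t). pcoset (pint c \<odot> e \<oplus> t) n) ` ({0..<int p ^ n} \<times> T)"
      using pcoset_normal_form[OF x(1) n] tor_T[OF x(1)] Z_bounds[OF pi_closed[OF x(1)], of n]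
      by (intro image_eqI[of _ _ "(\<pi> x n, tor x)"]) auto
  qed
  show "finite ((\<lambda>(c, t). pcoset (pint c \<odot> e \<oplus> t) n) ` ({0..<int p ^ n} \<times> T))" using finite_T by simp
qed

lemma countable_Fine: "countable Fine"
proof -
  have "Fine = (\<Union>n\<in>{k..}. Level n)" by (auto simp: Fine_def Level_def)
  moreover have "countable (\<Union>n\<in>{k..}. Level n)"
    by (rule countable_UN) (use finite_Level in \<open>auto intro: countable_finite\<close>)
  ultimately show ?thesis by simp
qed

text \<open>Each coset is a coset of each of its elements, so a finite intersection of cosets around a point contains
the finest of them.\<close>

lemma openin_iff:
  "openin (padic_topology p H) U \<longleftrightarrow> U \<subseteq> carrier H \<and> (\<forall>x\<in>U. \<exists>n. pcoset x n \<subseteq> U)"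
proof -
  let ?B = "{pcoset x n | x n. x \<in> carrier H}"
  have top: "padic_topology p H = topology_generated_by ?B"
    by (simp add: padic_topology_def pcoset_def)
  show ?thesis
    unfolding top openin_topology_generated_by_iff
  proof
    assume "generate_topology_on ?B U"
    then show "U \<subseteq> carrier H \<and> (\<forall>x\<in>U. \<exists>n. pcoset x n \<subseteq> U)"
    proof (induction U)
      case (Int a b)
      have "\<exists>n. pcoset x n \<subseteq> a \<inter> b" if x: "x \<in> a \<inter> b" for x
      proof -
        obtain n m where nm: "pcoset x n \<subseteq> a" "pcoset x m \<subseteq> b" using Int x by blast
        have xH: "x \<in> carrier H" using Int x by blast
        have "pcoset x (max n m) \<subseteq> pcoset x n" "pcoset x (max n m) \<subseteq> pcoset x m"
          using pcoset_sub[OF xH pcoset_self[OF xH]] by auto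
        then show ?thesis using nm by blast
      qed
      then show ?case using Int by blast
    next
      case (UN K)
      then show ?case by blast
    next
      case (Basis s)
      then obtain x n where s: "s = pcoset x n" "x \<in> carrier H" by blast
      have "\<forall>y\<in>s. pcoset y n \<subseteq> s" using pcoset_eq[OF s(2)] s(1) by blast
      then show ?case using pcoset_closed[OF s(2)] s(1) by blast
    qed simp
  next
    assume U: "U \<subseteq> carrier H \<and> (\<forall>x\<in>U. \<exists>n. pcoset x n \<subseteq> U)"
    have "U = \<Union>{C \<in> ?B. C \<subseteq> U}"
    proof
      show "U \<subseteq> \<Union>{C \<in> ?B. C \<subseteq> U}"
      proof
        fix x assume x: "x \<in> U"
        then obtain n where "pcoset x n \<subseteq> U" "x \<in> carrier H" using U by blast
        then show "x \<in> \<Union>{C \<in> ?B. C \<subseteq> U}" using pcoset_self by blast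
      qed
    qed blast
    moreover have "generate_topology_on ?B (\<Union>{C \<in> ?B. C \<subseteq> U})"
      by (rule generate_topology_on.UN) (auto intro: generate_topology_on.Basis)
    ultimately show "generate_topology_on ?B U" by simp
  qed
qed

lemma Fine_sub: "Fine \<subseteq> Pow (carrier H)"
  using pcoset_closed by (auto simp: Fine_def)

lemma opens_sub: "{U. openin (padic_topology p H) U} \<subseteq> Pow (carrier H)"
  by (auto simp: openin_iff)

text \<open>There are countably many cosets, so every open set is a countable union of cosets.\<close>

lemma sigma_opens:
  "sigma_sets (carrier H) {U. openin (padic_topology p H) U} = sigma_sets (carrier H) (insert {} Fine)"
proof (rule sigma_sets_eqI)
  fix U assume "U \<in> {U. openin (padic_topology p H) U}"
  then have U: "U \<subseteq> carrier H" "\<And>x. x \<in> U \<Longrightarrow> \<exists>n. pcoset x n \<subseteq> U" by (auto simp: openin_iff)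
  have "U = \<Union>{C \<in> Fine. C \<subseteq> U}"
  proof
    show "U \<subseteq> \<Union>{C \<in> Fine. C \<subseteq> U}"
    proof
      fix x assume x: "x \<in> U"
      then have xH: "x \<in> carrier H" using U by blast
      obtain n where n: "pcoset x n \<subseteq> U" using U(2)[OF x] by blast
      have "pcoset x (max n k) \<subseteq> pcoset x n" using pcoset_sub[OF xH pcoset_self[OF xH]] by simp
      then have "pcoset x (max n k) \<in> {C \<in> Fine. C \<subseteq> U}" using n FineI[OF xH, of "max n k"] by auto
      then show "x \<in> \<Union>{C \<in> Fine. C \<subseteq> U}" using pcoset_self[OF xH] by blast
    qed
  qed blast
  moreover have "\<Union>{C \<in> Fine. C \<subseteq> U} \<in> sigma_sets (carrier H) (insert {} Fine)"
  proof (rule sigma_sets_UNION)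
    show "countable {C \<in> Fine. C \<subseteq> U}" using countable_Fine by (rule countable_subset[rotated]) blast
  qed (auto intro: sigma_sets.Basic)
  ultimately show "U \<in> sigma_sets (carrier H) (insert {} Fine)" by simp
next
  fix C assume "C \<in> insert {} Fine"
  then have "openin (padic_topology p H) C"
  proof
    assume "C \<in> Fine"
    then obtain x n where x: "x \<in> carrier H" "C = pcoset x n" by (auto simp: Fine_def)
    then show ?thesis unfolding openin_iff using pcoset_closed pcoset_eq by blast
  qed simp
  then show "C \<in> sigma_sets (carrier H) {U. openin (padic_topology p H) U}" by (auto intro: sigma_sets.Basic)
qed

lemma sets_sigma_opens:
  "sets (sigma (carrier H) {U. openin (padic_topology p H) U}) = sigma_sets (carrier H) (insert {} Fine)"
  using opens_sub sigma_opens by simp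

lemma Int_stable_Fine: "Int_stable (insert {} Fine)"
proof (rule Int_stableI)
  fix A B assume A: "A \<in> insert {} Fine" and B: "B \<in> insert {} Fine"
  show "A \<inter> B \<in> insert {} Fine"
  proof (cases "A \<inter> B = {}")
    case False
    then obtain z where z: "z \<in> A" "z \<in> B" by blast
    then obtain x n y m where x: "A = pcoset x n" "x \<in> carrier H" "k \<le> n" and y: "B = pcoset y m" "y \<in> carrier H" "k \<le> m"
      using A B unfolding Fine_def by blast
    have zH: "z \<in> carrier H" using z x pcoset_closed by blast
    have e: "A = pcoset z n" "B = pcoset z m" using pcoset_eq[of x z n] pcoset_eq[of y z m] x y z by simp_all
    have "pcoset z (max n m) \<subseteq> A" "pcoset z (max n m) \<subseteq> B" using pcoset_sub[OF zH pcoset_self[OF zH]] by (auto simp: e)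
    moreover have "A \<inter> B \<subseteq> pcoset z (max n m)" unfolding e by (cases "n \<le> m") (auto simp: max_def)
    ultimately have "A \<inter> B = pcoset z (max n m)" by blast
    then show ?thesis using FineI[OF zH, of "max n m"] x(3) by simp
  qed simp
qed

definition haar_like :: "univ measure \<Rightarrow> bool" where
  "haar_like \<mu> \<longleftrightarrow> prob_space \<mu> \<and> space \<mu> = carrier H \<and>
     sets \<mu> = sets (sigma (carrier H) {U. openin (padic_topology p H) U}) \<and>
     (\<forall>x \<in> carrier H. distr \<mu> \<mu> (\<lambda>y. x \<oplus> y) = \<mu>)"

lemma Level_partition:
  "\<Union>(Level n) = carrier H" "disjoint (Level n)"
proof -
  show "\<Union>(Level n) = carrier H"
  proof
    show "\<Union>(Level n) \<subseteq> carrier H" unfolding Level_def using pcoset_closed by blast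
    show "carrier H \<subseteq> \<Union>(Level n)" unfolding Level_def using pcoset_self by blast
  qed
  show "disjoint (Level n)"
  proof (rule disjointI)
    fix a b assume "a \<in> Level n" "b \<in> Level n" "a \<noteq> b"
    then show "a \<inter> b = {}" unfolding Level_def using pcoset_disj by blast
  qed
qed

lemma measure_eq_on_Fine:
  assumes "sets \<mu> = sigma_sets (carrier H) (insert {} Fine)" "sets \<nu> = sigma_sets (carrier H) (insert {} Fine)"
    "\<And>x n. x \<in> carrier H \<Longrightarrow> k \<le> n \<Longrightarrow> emeasure \<mu> (pcoset x n) = emeasure \<nu> (pcoset x n)"
    "prob_space \<mu>"
  shows "\<mu> = \<nu>"
proof (rule measure_eqI_generator_eq_countable[OF Int_stable_Fine, of "carrier H" \<mu> \<nu> "Level k"])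
  interpret prob_space \<mu> by fact
  show "insert {} Fine \<subseteq> Pow (carrier H)" using Fine_sub by simp
  show "\<And>X. X \<in> insert {} Fine \<Longrightarrow> emeasure \<mu> X = emeasure \<nu> X" using assms(3) by (auto simp: Fine_def)
  show "Level k \<subseteq> insert {} Fine" by (auto simp: Level_def Fine_def)
  show "\<Union>(Level k) = carrier H" by (rule Level_partition)
  show "countable (Level k)" using finite_Level by (simp add: countable_finite)
  show "\<And>a. a \<in> Level k \<Longrightarrow> emeasure \<mu> a \<noteq> \<infinity>" using emeasure_finite by simp
qed (use assms in auto)

lemma translate_vimage:
  assumes "x \<in> carrier H" "y \<in> carrier H"
  shows "(\<lambda>z. x \<oplus> z) -` pcoset y n \<inter> carrier H = pcoset (\<ominus> x \<oplus> y) n"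
proof -
  have "x \<oplus> z = y \<oplus> w \<longleftrightarrow> z = \<ominus> x \<oplus> y \<oplus> w" if "z \<in> carrier H" "w \<in> carrier H" for z w
  proof
    assume "x \<oplus> z = y \<oplus> w"
    then have "\<ominus> x \<oplus> (x \<oplus> z) = \<ominus> x \<oplus> (y \<oplus> w)" by simp
    then show "z = \<ominus> x \<oplus> y \<oplus> w" using assms that by (simp add: M.r_neg1 M.a_assoc)
  next
    assume "z = \<ominus> x \<oplus> y \<oplus> w"
    then show "x \<oplus> z = y \<oplus> w" using assms that by (simp add: M.r_neg2 M.a_assoc)
  qed
  then have "z \<in> carrier H \<Longrightarrow> x \<oplus> z \<in> pcoset y n \<longleftrightarrow> z \<in> pcoset (\<ominus> x \<oplus> y) n" for z
    unfolding pcoset_iff by (intro bex_cong refl) simp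
  then show ?thesis using pcoset_closed[of "\<ominus> x \<oplus> y" n] assms by auto
qed

lemma translate_measurable:
  assumes "sets \<mu> = sigma_sets (carrier H) (insert {} Fine)" "space \<mu> = carrier H" "x \<in> carrier H"
  shows "(\<lambda>y. x \<oplus> y) \<in> measurable \<mu> \<mu>"
proof (rule measurable_sigma_sets[OF assms(1)])
  show "insert {} Fine \<subseteq> Pow (carrier H)" using Fine_sub by simp
  show "(\<lambda>y. x \<oplus> y) \<in> space \<mu> \<rightarrow> carrier H" using assms by simp
  fix A assume "A \<in> insert {} Fine"
  then show "(\<lambda>y. x \<oplus> y) -` A \<inter> space \<mu> \<in> sets \<mu>"
  proof
    assume "A \<in> Fine"
    then obtain y n where y: "A = pcoset y n" "y \<in> carrier H" "k \<le> n" by (auto simp: Fine_def)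
    have "pcoset (\<ominus> x \<oplus> y) n \<in> Fine" using y assms(3) by (intro FineI) auto
    then show ?thesis using translate_vimage[OF assms(3) y(2)] assms y(1) by (simp add: sigma_sets.Basic)
  qed simp
qed

text \<open>The cosets of one level are translates of each other, and finitely many of them make up the module.\<close>

lemma haar_like_coset:
  assumes "haar_like \<mu>" "k \<le> n" "x \<in> carrier H"
  shows "of_nat (card (Level n)) * emeasure \<mu> (pcoset x n) = 1"
proof -
  interpret prob_space \<mu> using assms by (simp add: haar_like_def)
  have sets: "sets \<mu> = sigma_sets (carrier H) (insert {} Fine)" using assms sets_sigma_opens by (simp add: haar_like_def)
  have sp: "space \<mu> = carrier H" using assms by (simp add: haar_like_def)
  have cs: "pcoset y n \<in> sets \<mu>" if "y \<in> carrier H" for y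
    unfolding sets by (rule sigma_sets.Basic) (use that assms(2) FineI in auto)
  have tr: "emeasure \<mu> (pcoset y n) = emeasure \<mu> (pcoset x n)" if y: "y \<in> carrier H" for y
  proof -
    let ?d = "\<ominus> (\<ominus> y \<oplus> x)"
    have d: "?d \<in> carrier H" using y assms(3) by simp
    have "\<ominus> ?d \<oplus> y = x" using y assms(3) by (simp add: M.a_ac M.r_neg1 M.r_neg M.r_neg2)
    then have "(\<lambda>z. ?d \<oplus> z) -` pcoset y n \<inter> space \<mu> = pcoset x n" using translate_vimage[OF d y, of n] sp by simp
    moreover have "emeasure (distr \<mu> \<mu> (\<lambda>z. ?d \<oplus> z)) (pcoset y n) = emeasure \<mu> ((\<lambda>z. ?d \<oplus> z) -` pcoset y n \<inter> space \<mu>)"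
      by (rule emeasure_distr[OF translate_measurable[OF sets sp d] cs[OF y]])
    moreover have "distr \<mu> \<mu> (\<lambda>z. ?d \<oplus> z) = \<mu>" using assms(1) d by (simp add: haar_like_def)
    ultimately show ?thesis by simp
  qed
  have "1 = emeasure \<mu> (\<Union>C\<in>Level n. C)" using Level_partition(1)[of n] emeasure_space_1 sp by simp
  also have "\<dots> = (\<Sum>C\<in>Level n. emeasure \<mu> C)"
    by (rule sum_emeasure[symmetric])
      (use cs finite_Level[OF assms(2)] Level_partition(2) in \<open>auto simp: Level_def disjoint_family_on_def disjoint_def\<close>)
  also have "\<dots> = (\<Sum>C\<in>Level n. emeasure \<mu> (pcoset x n))"
    by (rule sum.cong) (use tr in \<open>auto simp: Level_def\<close>)
  finally show ?thesis by simp
qed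

lemma haar_like_unique:
  assumes "haar_like \<mu>" "haar_like \<nu>" shows "\<mu> = \<nu>"
proof (rule measure_eq_on_Fine)
  show "sets \<mu> = sigma_sets (carrier H) (insert {} Fine)" "sets \<nu> = sigma_sets (carrier H) (insert {} Fine)"
    using assms sets_sigma_opens by (auto simp: haar_like_def)
  show "prob_space \<mu>" using assms by (simp add: haar_like_def)
  fix x n assume x: "x \<in> carrier H" and n: "k \<le> n"
  note m = haar_like_coset[OF assms(1) n x] and nu = haar_like_coset[OF assms(2) n x]
  have "emeasure \<mu> (pcoset x n) = emeasure \<mu> (pcoset x n) * (of_nat (card (Level n)) * emeasure \<nu> (pcoset x n))" using nu by simp
  also have "\<dots> = (of_nat (card (Level n)) * emeasure \<mu> (pcoset x n)) * emeasure \<nu> (pcoset x n)" by (simp add: mult_ac)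
  finally show "emeasure \<mu> (pcoset x n) = emeasure \<nu> (pcoset x n)" using m by simp
qed

text \<open>The element \<open>c e + t\<close> is taken with \<open>c\<close> of independent uniform digits and \<open>t\<close> uniform in the torsion part.
It lies in each coset of a given level, from \<open>k\<close> on, with the same probability. Translations permute these cosets, so
they preserve the distribution.\<close>

lemma haar_like_exists: "\<exists>\<mu>. haar_like \<mu>"
proof -
  let ?U = "uniform_count_measure T"
  let ?P = "digit_space \<Otimes>\<^sub>M ?U"
  let ?S = "sigma (carrier H) (insert {} Fine)"
  let ?F = "\<lambda>(w, t). from_digits w \<odot> e \<oplus> t"
  have T0: "T \<noteq> {}" using zero_T by blast
  interpret U: prob_space ?U using finite_T T0 by (rule prob_space_uniform_count_measure)
  interpret D: prob_space digit_space by (rule digit_prob)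
  interpret P: pair_prob_space digit_space ?U ..
  have spP: "space ?P = space digit_space \<times> T" by (simp add: space_pair_measure space_uniform_count_measure)
  have ssub: "insert {} Fine \<subseteq> Pow (carrier H)" using Fine_sub by simp
  have Fc: "?F \<in> space ?P \<rightarrow> carrier H" using from_digits_closed T_closed by (auto simp: spP)
  have vim: "?F -` pcoset x n \<inter> space ?P = {w \<in> space digit_space. from_digits w n = \<pi> x n} \<times> {tor x}"
    if x: "x \<in> carrier H" and n: "k \<le> n" for x n
    unfolding spP using tor_T[OF x]
    by (auto simp: pcoset_fine[OF x n] tor_comp pi_comp comp_closed from_digits_closed)
  have ts: "{tor x} \<in> sets ?U" if "x \<in> carrier H" for x using tor_T[OF that] by (simp add: sets_uniform_count_measure)
  have Fm: "?F \<in> measurable ?P ?S"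
  proof (rule measurable_measure_of[OF ssub Fc])
    fix A assume "A \<in> insert {} Fine"
    then show "?F -` A \<inter> space ?P \<in> sets ?P"
    proof
      assume "A \<in> Fine"
      then obtain x n where x: "A = pcoset x n" "x \<in> carrier H" "k \<le> n" by (auto simp: Fine_def)
      show ?thesis unfolding x(1) vim[OF x(2,3)]
        using digit_cylinder(1)[OF pi_closed[OF x(2)]] ts[OF x(2)] by (rule pair_measureI)
    qed simp
  qed
  define \<mu> where "\<mu> = distr ?P ?S ?F"
  have sets: "sets \<mu> = sigma_sets (carrier H) (insert {} Fine)" unfolding \<mu>_def using ssub by simp
  have sp: "space \<mu> = carrier H" unfolding \<mu>_def using ssub by simp
  have prob: "prob_space \<mu>" unfolding \<mu>_def by (rule P.prob_space_distr[OF Fm])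
  have val: "emeasure \<mu> (pcoset x n) = ennreal (1 / p) ^ n * ennreal (1 / card T)"
    if x: "x \<in> carrier H" and n: "k \<le> n" for x n
  proof -
    have "pcoset x n \<in> sets ?S" using ssub x n FineI[OF x n] by (auto intro!: sigma_sets.Basic)
    then have "emeasure \<mu> (pcoset x n) = emeasure ?P ({w \<in> space digit_space. from_digits w n = \<pi> x n} \<times> {tor x})"
      unfolding \<mu>_def by (subst emeasure_distr[OF Fm]) (simp_all only: vim[OF x n])
    also have "\<dots> = emeasure digit_space {w \<in> space digit_space. from_digits w n = \<pi> x n} * emeasure ?U {tor x}"
      by (rule U.emeasure_pair_measure_Times[OF digit_cylinder(1)[OF pi_closed[OF x]] ts[OF x]])
    also have "emeasure ?U {tor x} = ennreal (1 / card T)"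
      using finite_T tor_T[OF x] by (subst emeasure_uniform_count_measure) auto
    finally show ?thesis using digit_cylinder(2)[OF pi_closed[OF x]] by simp
  qed
  have "distr \<mu> \<mu> (\<lambda>y. x \<oplus> y) = \<mu>" if x: "x \<in> carrier H" for x
  proof (rule measure_eq_on_Fine)
    note tm = translate_measurable[OF sets sp x]
    show "prob_space (distr \<mu> \<mu> (\<lambda>y. x \<oplus> y))" using prob tm by (rule prob_space.prob_space_distr)
    fix y n assume y: "y \<in> carrier H" and n: "k \<le> n"
    have "pcoset y n \<in> sets \<mu>" unfolding sets by (rule sigma_sets.Basic) (use y n FineI in auto)
    then have "emeasure (distr \<mu> \<mu> (\<lambda>y. x \<oplus> y)) (pcoset y n) = emeasure \<mu> (pcoset (\<ominus> x \<oplus> y) n)"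
      using emeasure_distr[OF tm] translate_vimage[OF x y] sp by simp
    also have "\<dots> = emeasure \<mu> (pcoset y n)" using val[OF _ n] x y by simp
    finally show "emeasure (distr \<mu> \<mu> (\<lambda>y. x \<oplus> y)) (pcoset y n) = emeasure \<mu> (pcoset y n)" .
  qed (simp_all add: sets)
  then have "haar_like \<mu>" unfolding haar_like_def using prob sp sets sets_sigma_opens by simp
  then show ?thesis by blast
qed

lemma haar_like_haar: "haar_like (haar p H)"
proof -
  have "haar p H = (THE \<mu>. haar_like \<mu>)" by (simp add: haar_def haar_like_def)
  moreover have "\<exists>!\<mu>. haar_like \<mu>" using haar_like_exists haar_like_unique by blast
  ultimately show ?thesis using theI'[of haar_like] by simp
qed

abbreviation "\<mu> \<equiv> haar p H"

sublocale haar: prob_space "haar p H"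
  using haar_like_haar by (simp add: haar_like_def)

lemma space_haar: "space \<mu> = carrier H" and sets_haar: "sets \<mu> = sigma_sets (carrier H) (insert {} Fine)"
  using haar_like_haar sets_sigma_opens by (auto simp: haar_like_def)

lemma haar_openI:
  assumes "U \<subseteq> carrier H" "\<And>x. x \<in> U \<Longrightarrow> \<exists>n. pcoset x n \<subseteq> U"
  shows "U \<in> sets \<mu>"
proof -
  have "openin (padic_topology p H) U" unfolding openin_iff using assms by blast
  then show ?thesis unfolding sets_haar sigma_opens[symmetric] by (intro sigma_sets.Basic) simp
qed

lemma haar_translate:
  assumes "x \<in> carrier H" "A \<in> sets \<mu>"
  shows "(\<lambda>y. x \<oplus> y) ` A \<in> sets \<mu>" "measure \<mu> ((\<lambda>y. x \<oplus> y) ` A) = measure \<mu> A"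
proof -
  have A: "A \<subseteq> carrier H" using assms(2) sets.sets_into_space space_haar by blast
  have eq: "(\<lambda>y. \<ominus> x \<oplus> y) -` A \<inter> space \<mu> = (\<lambda>y. x \<oplus> y) ` A"
  proof
    show "(\<lambda>y. \<ominus> x \<oplus> y) -` A \<inter> space \<mu> \<subseteq> (\<lambda>y. x \<oplus> y) ` A"
    proof
      fix z assume z: "z \<in> (\<lambda>y. \<ominus> x \<oplus> y) -` A \<inter> space \<mu>"
      then have "z = x \<oplus> (\<ominus> x \<oplus> z)" using assms(1) by (simp add: space_haar M.r_neg2)
      then show "z \<in> (\<lambda>y. x \<oplus> y) ` A" using z by blast
    qed
    show "(\<lambda>y. x \<oplus> y) ` A \<subseteq> (\<lambda>y. \<ominus> x \<oplus> y) -` A \<inter> space \<mu>"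
      using A assms(1) by (auto simp: space_haar M.r_neg1 subset_iff)
  qed
  note tm = translate_measurable[OF sets_haar space_haar M.a_inv_closed[OF assms(1)]]
  show "(\<lambda>y. x \<oplus> y) ` A \<in> sets \<mu>" using measurable_sets[OF tm assms(2)] eq by simp
  have "measure (distr \<mu> \<mu> (\<lambda>y. \<ominus> x \<oplus> y)) A = measure \<mu> ((\<lambda>y. x \<oplus> y) ` A)"
    using measure_distr[OF tm assms(2)] eq by simp
  moreover have "distr \<mu> \<mu> (\<lambda>y. \<ominus> x \<oplus> y) = \<mu>" using haar_like_haar assms(1) by (simp add: haar_like_def)
  ultimately show "measure \<mu> ((\<lambda>y. x \<oplus> y) ` A) = measure \<mu> A" by simp
qed

lemma haar_tiling:
  assumes "finite X" "X \<subseteq> carrier H" "A \<in> sets \<mu>"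
    "\<And>x y. x \<in> X \<Longrightarrow> y \<in> X \<Longrightarrow> x \<noteq> y \<Longrightarrow> (\<lambda>z. x \<oplus> z) ` A \<inter> (\<lambda>z. y \<oplus> z) ` A = {}"
  shows "measure \<mu> (\<Union>x\<in>X. (\<lambda>z. x \<oplus> z) ` A) = real (card X) * measure \<mu> A"
proof -
  have "measure \<mu> (\<Union>x\<in>X. (\<lambda>z. x \<oplus> z) ` A) = (\<Sum>x\<in>X. measure \<mu> ((\<lambda>z. x \<oplus> z) ` A))"
    by (rule haar.finite_measure_finite_Union)
      (use assms haar_translate(1) in \<open>auto simp: disjoint_family_on_def\<close>)
  also have "\<dots> = (\<Sum>x\<in>X. measure \<mu> A)"
    by (rule sum.cong) (use assms haar_translate(2) in auto)
  finally show ?thesis by simp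
qed

end

section \<open>Exact sequences through a given element\<close>

text \<open>For another prime divisor \<open>q\<close> of the order there is a subgroup of order \<open>q\<close> by Sylow's theorem; the order
of its elements would divide both \<open>q\<close> and \<open>p ^ K\<close>.\<close>

lemma (in group) order_prime_power:
  assumes fin: "finite (carrier G)" and p: "prime (p::nat)" and ex: "\<And>x. x \<in> carrier G \<Longrightarrow> x [^] (p ^ K) = \<one>"
  shows "\<exists>n. order G = p ^ n"
proof -
  have o0: "order G \<noteq> 0" using fin carrier_not_empty by (simp add: order_def)
  obtain m where m: "order G = p ^ multiplicity p (order G) * m" "\<not> p dvd m"
    by (rule multiplicity_decompose'[of "order G" p]) (use o0 p in auto)
  have "m = 1"
  proof (rule ccontr)
    assume "m \<noteq> 1"
    then obtain q where q: "prime q" "q dvd m" using prime_factor_nat by blast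
    then obtain r where r: "m = q * r" by (auto elim: dvdE)
    have "order G = q ^ 1 * (p ^ multiplicity p (order G) * r)"
      using m(1) unfolding r power_one_right by (simp only: mult.left_commute)
    from sylow_thm[OF q(1) is_group this fin] obtain S where S: "subgroup S G" "card S = q" by auto
    interpret S: subgroup S G by fact
    have "1 < card S" using S(2) q(1) prime_gt_1_nat by simp
    then obtain x where x: "x \<in> S" "x \<noteq> \<one>"
      by (metis One_nat_def S.one_closed card_le_Suc0_iff_eq card_ge_0_finite linorder_not_less not_one_less_zero less_imp_le_nat neq0_conv not_less_zero)
    have xG: "x \<in> carrier G" using x S.mem_carrier by blast
    interpret GS: group "G\<lparr>carrier := S\<rparr>" by (rule S.subgroup_is_group) (rule is_group)
    have "x [^]\<^bsub>G\<lparr>carrier := S\<rparr>\<^esub> order (G\<lparr>carrier := S\<rparr>) = \<one>\<^bsub>G\<lparr>carrier := S\<rparr>\<^esub>"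
      by (rule GS.pow_order_eq_1) (use x in simp)
    then have "x [^] q = \<one>" using S(2) by (simp add: order_def nat_pow_consistent[symmetric])
    then have "ord x dvd q" using pow_eq_id[OF xG] by simp
    moreover have "ord x dvd p ^ K" using pow_eq_id[OF xG] ex[OF xG] by simp
    moreover have "coprime q (p ^ K)"
    proof -
      have "q \<noteq> p" using q(2) m(2) by auto
      then have "coprime q p" using q(1) p primes_coprime by blast
      then show ?thesis by simp
    qed
    ultimately have "ord x = 1" using coprime_common_divisor[of q "p ^ K" "ord x"] by simp
    then show False using pow_ord_eq_1[OF xG] x(2) xG by simp
  qed
  then show ?thesis using m by auto
qed

context rank1_module begin

lemma nontorsion_pi_nonzero:
  assumes "nontorsion x" shows "\<pi> x \<noteq> \<zero>\<^bsub>Z\<^esub>"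
proof
  assume "\<pi> x = \<zero>\<^bsub>Z\<^esub>"
  then have "pint (int p ^ k) \<odot> x = \<zero>" using assms T_kill by (auto simp: T_def nontorsion_def)
  then show False using assms pint_pow_nz[of k] by (auto simp: nontorsion_def)
qed

lemma nontorsion_iff: "nontorsion x \<longleftrightarrow> x \<in> carrier H \<and> \<pi> x \<noteq> \<zero>\<^bsub>Z\<^esub>"
proof
  assume "nontorsion x" then show "x \<in> carrier H \<and> \<pi> x \<noteq> \<zero>\<^bsub>Z\<^esub>"
    using nontorsion_pi_nonzero by (simp add: nontorsion_def)
next
  assume x: "x \<in> carrier H \<and> \<pi> x \<noteq> \<zero>\<^bsub>Z\<^esub>"
  have "a = \<zero>\<^bsub>Z\<^esub>" if "a \<in> carrier Z" "a \<odot> x = \<zero>" for a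
  proof -
    have "a \<otimes>\<^bsub>Z\<^esub> \<pi> x = \<zero>\<^bsub>Z\<^esub>" using pi_smult[OF that(1), of x] x that(2) pi_T[OF zero_T] by simp
    then show ?thesis using Z.integral x that(1) pi_closed by blast
  qed
  then show "nontorsion x" using x by (simp add: nontorsion_def)
qed

text \<open>Up to a unit, \<open>p ^ k h\<close> is a power of \<open>p\<close> times \<open>e\<close>; and \<open>p ^ k\<close> annihilates the torsion part of \<open>x\<close>.\<close>

lemma power_in_span:
  assumes h: "nontorsion h"
  shows "\<exists>K\<ge>k. \<forall>x\<in>carrier H. \<exists>a\<in>carrier Z. pint (int p ^ K) \<odot> x = a \<odot> h"
proof -
  have hc: "h \<in> carrier H" and ph: "\<pi> h \<noteq> \<zero>\<^bsub>Z\<^esub>" using h by (auto simp: nontorsion_iff)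
  obtain m u where u: "u \<in> carrier Z" "u 1 \<noteq> 0" "\<pi> h = pint (int p ^ m) \<otimes>\<^bsub>Z\<^esub> u"
    using Z_factor[OF pi_closed[OF hc] ph] by metis
  obtain v where v: "v \<in> carrier Z" "u \<otimes>\<^bsub>Z\<^esub> v = \<one>\<^bsub>Z\<^esub>" using Z_unit u by blast
  let ?pk = "pint (int p ^ k)" and ?pm = "pint (int p ^ m)"
  have "\<exists>a\<in>carrier Z. pint (int p ^ (m + k)) \<odot> x = a \<odot> h" if x: "x \<in> carrier H" for x
  proof (rule bexI)
    let ?a = "(v \<otimes>\<^bsub>Z\<^esub> \<pi> x) \<otimes>\<^bsub>Z\<^esub> ?pk"
    show "?a \<in> carrier Z" using v x by simp
    have "?a \<odot> h = (v \<otimes>\<^bsub>Z\<^esub> \<pi> x) \<odot> (?pk \<odot> h)" using v x hc by (simp add: M.smult_assoc1)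
    also have "?pk \<odot> h = (?pk \<otimes>\<^bsub>Z\<^esub> (?pm \<otimes>\<^bsub>Z\<^esub> u)) \<odot> e" using pow_smult[OF hc order_refl] u(3) by simp
    also have "(v \<otimes>\<^bsub>Z\<^esub> \<pi> x) \<odot> \<dots> = ((v \<otimes>\<^bsub>Z\<^esub> \<pi> x) \<otimes>\<^bsub>Z\<^esub> (?pk \<otimes>\<^bsub>Z\<^esub> (?pm \<otimes>\<^bsub>Z\<^esub> u))) \<odot> e"
      using v u x by (simp add: M.smult_assoc1)
    also have "(v \<otimes>\<^bsub>Z\<^esub> \<pi> x) \<otimes>\<^bsub>Z\<^esub> (?pk \<otimes>\<^bsub>Z\<^esub> (?pm \<otimes>\<^bsub>Z\<^esub> u)) = (u \<otimes>\<^bsub>Z\<^esub> v) \<otimes>\<^bsub>Z\<^esub> (?pm \<otimes>\<^bsub>Z\<^esub> (?pk \<otimes>\<^bsub>Z\<^esub> \<pi> x))"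
      using v(1) u(1) pi_closed[OF x] by (simp add: Z.m_ac)
    also have "\<dots> = ?pm \<otimes>\<^bsub>Z\<^esub> (?pk \<otimes>\<^bsub>Z\<^esub> \<pi> x)" using v(2) x by simp
    also have "\<dots> \<odot> e = ?pm \<odot> (?pk \<odot> x)" using pow_smult[OF x order_refl] x by (simp add: M.smult_assoc1)
    also have "\<dots> = pint (int p ^ (m + k)) \<odot> x" using x by (simp add: power_add pint_mult M.smult_assoc1)
    finally show "pint (int p ^ (m + k)) \<odot> x = ?a \<odot> h" by simp
  qed
  then show ?thesis by (intro exI[of _ "m + k"]) auto
qed

lemma smult_lin_hom:
  assumes "h \<in> carrier H" shows "(\<lambda>a. a \<odot> h) \<in> lin_hom Z Z H"
  using assms by (simp add: lin_hom_iff Z_smult M.smult_l_distr M.smult_assoc1)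

lemma nontorsion_smult_inj:
  assumes "nontorsion h" shows "inj_on (\<lambda>a. a \<odot> h) (carrier Z)"
proof (rule inj_onI)
  fix a b assume ab: "a \<in> carrier Z" "b \<in> carrier Z" "a \<odot> h = b \<odot> h"
  have h: "h \<in> carrier H" using assms by (simp add: nontorsion_def)
  have "(a \<oplus>\<^bsub>Z\<^esub> (\<ominus>\<^bsub>Z\<^esub> b)) \<odot> h = \<zero>" using ab h by (simp add: M.smult_l_distr M.smult_l_minus M.r_neg)
  then have "a \<oplus>\<^bsub>Z\<^esub> (\<ominus>\<^bsub>Z\<^esub> b) = \<zero>\<^bsub>Z\<^esub>" using assms ab by (auto simp: nontorsion_def)
  then show "a = b" using Z.minus_equality[of a "\<ominus>\<^bsub>Z\<^esub> b"] ab by simp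
qed

text \<open>The cokernel \<open>H / Zp h\<close> is finite of exponent \<open>p ^ K\<close> by \<open>power_in_span\<close>. Its elements have to belong to
the same type as those of \<open>H\<close>, so a coset is represented by one chosen element of it.\<close>

lemma exact_seq_through:
  assumes h: "nontorsion h"
  shows "\<exists>s\<in>exact_seqs p. middle s = H \<and> incl s \<one>\<^bsub>Z\<^esub> = h"
proof -
  have hc: "h \<in> carrier H" using h by (simp add: nontorsion_def)
  define P where "P x y \<longleftrightarrow> y \<in> carrier H \<and> (\<exists>a\<in>carrier Z. y = x \<oplus> a \<odot> h)" for x y
  have P_refl: "P x x" if "x \<in> carrier H" for x
    unfolding P_def using that hc by (intro conjI bexI[of _ "\<zero>\<^bsub>Z\<^esub>"]) auto
  have P_sym: "P y x" if h1: "P x y" and h2: "x \<in> carrier H" for x y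
  proof -
    obtain a where a: "a \<in> carrier Z" "y = x \<oplus> a \<odot> h" using h1 by (auto simp: P_def)
    then have "x = y \<oplus> (\<ominus>\<^bsub>Z\<^esub> a) \<odot> h" using that(2) hc by (simp add: M.smult_l_minus M.a_assoc M.r_neg)
    then show ?thesis unfolding P_def using that(2) a(1) by (intro conjI bexI[of _ "\<ominus>\<^bsub>Z\<^esub> a"]) auto
  qed
  have P_trans: "P x z" if h1: "P x y" "P y z" and h2: "x \<in> carrier H" for x y z
  proof -
    obtain a b where a: "a \<in> carrier Z" "y = x \<oplus> a \<odot> h" "b \<in> carrier Z" "z = y \<oplus> b \<odot> h"
      using h1 by (auto simp: P_def)
    then have "z = x \<oplus> (a \<oplus>\<^bsub>Z\<^esub> b) \<odot> h" using that(3) hc by (simp add: M.smult_l_distr M.a_assoc)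
    then show ?thesis using that(2) a(1,3) unfolding P_def by (intro conjI bexI[of _ "a \<oplus>\<^bsub>Z\<^esub> b"]) auto
  qed
  have P_add: "P (x \<oplus> x') (y \<oplus> y')" if h1: "P x y" "P x' y'" and h2: "x \<in> carrier H" "x' \<in> carrier H" for x y x' y'
  proof -
    obtain a b where a: "a \<in> carrier Z" "y = x \<oplus> a \<odot> h" "b \<in> carrier Z" "y' = x' \<oplus> b \<odot> h"
      using h1 by (auto simp: P_def)
    then have "y \<oplus> y' = x \<oplus> x' \<oplus> (a \<oplus>\<^bsub>Z\<^esub> b) \<odot> h" using h2 hc
      by (simp add: M.smult_l_distr add_interchange)
    then show ?thesis using h1 h2 hc a(1,3) unfolding P_def by (intro conjI bexI[of _ "a \<oplus>\<^bsub>Z\<^esub> b"]) auto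
  qed
  define c where "c x = (SOME y. P x y)" for x
  have Pc: "P x (c x)" if "x \<in> carrier H" for x unfolding c_def by (rule someI[of "P x", OF P_refl[OF that]])
  have cc: "c x \<in> carrier H" if "x \<in> carrier H" for x using Pc[OF that] by (simp add: P_def)
  have c_eq: "c x = c y" if "P x y" "x \<in> carrier H" for x y
  proof -
    have y: "y \<in> carrier H" using that by (simp add: P_def)
    have "P x = P y" using P_trans[OF P_sym[OF that]] P_trans[OF that(1)] that(2) y by blast
    then show ?thesis by (simp add: c_def)
  qed
  have c_iff: "c x = c y \<longleftrightarrow> P x y" if "x \<in> carrier H" "y \<in> carrier H" for x y
    using c_eq that Pc P_sym P_trans cc by metis
  define G0 :: grp where "G0 = \<lparr>carrier = UNIV, mult = (\<lambda>u v. c (u \<oplus> v)), one = c \<zero>\<rparr>"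
  define G :: grp where "G = G0\<lparr>carrier := c ` carrier (add_monoid H), one := c \<one>\<^bsub>add_monoid H\<^esub>\<rparr>"
  have c_add: "c (x \<oplus> y) = c (c x \<oplus> c y)" if "x \<in> carrier H" "y \<in> carrier H" for x y
    by (rule c_eq[OF P_add[OF Pc Pc]]) (use that in auto)
  have "c \<in> hom (add_monoid H) G0" using c_add by (simp add: hom_def G0_def)
  then have G: "comm_group G"
    unfolding G_def using comm_group.hom_imp_img_comm_group[OF M.a_comm_group] by blast
  have Gs: "carrier G = c ` carrier H" "\<one>\<^bsub>G\<^esub> = c \<zero>" "x \<otimes>\<^bsub>G\<^esub> y = c (x \<oplus> y)" for x y by (simp_all add: G_def G0_def)
  have hom: "c \<in> hom (add_monoid H) G" using c_add by (simp add: hom_def Gs)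
  interpret G: comm_group G by (rule G)
  obtain K where K: "k \<le> K" "\<And>x. x \<in> carrier H \<Longrightarrow> \<exists>a\<in>carrier Z. pint (int p ^ K) \<odot> x = a \<odot> h"
    using power_in_span[OF h] by blast
  have fin: "finite (carrier G)"
  proof -
    have "c ` carrier H \<subseteq> (\<lambda>C. c (SOME x. x \<in> C)) ` Level K"
    proof (rule image_subsetI)
      fix x assume x: "x \<in> carrier H"
      let ?y = "SOME y. y \<in> pcoset x K"
      have y: "?y \<in> pcoset x K" by (rule someI[of "\<lambda>y. y \<in> pcoset x K", OF pcoset_self[OF x]])
      then obtain z where z: "z \<in> carrier H" "?y = x \<oplus> pint (int p ^ K) \<odot> z" by (auto simp: pcoset_iff)
      have "P x ?y" unfolding P_def z(2) using K(2)[OF z(1)] x z(1) by auto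
      then have "c x = c ?y" using c_eq x by blast
      then show "c x \<in> (\<lambda>C. c (SOME x. x \<in> C)) ` Level K" using x by (auto simp: Level_def)
    qed
    then show ?thesis unfolding Gs using finite_Level[OF K(1)] finite_surj by blast
  qed
  have "\<exists>n. order G = p ^ n"
  proof (rule G.order_prime_power[OF fin prime])
    fix g assume "g \<in> carrier G"
    then obtain x where x: "x \<in> carrier H" "g = c x" by (auto simp: Gs)
    have "c ([(p ^ K)] \<cdot>\<^bsub>H\<^esub> x) = g [^]\<^bsub>G\<^esub> (p ^ K)"
      using hom_nat_pow[OF hom, of x "p ^ K"] x M.a_group G.is_group by (simp add: add_pow_def)
    moreover have "c ([(p ^ K)] \<cdot>\<^bsub>H\<^esub> x) = c \<zero>"
    proof (rule sym, rule c_eq)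
      show "P \<zero> ([(p ^ K)] \<cdot>\<^bsub>H\<^esub> x)" unfolding P_def
        using K(2)[OF x(1)] add_pow_smult[OF x(1), of "p ^ K"] x(1) hc by auto
    qed simp
    ultimately show "g [^]\<^bsub>G\<^esub> (p ^ K) = \<one>\<^bsub>G\<^esub>" by (simp add: Gs)
  qed
  then have Gp: "G \<in> pgroups p" using fin G by (simp add: pgroups_def)
  have "\<lparr>middle = H, incl = (\<lambda>a. a \<odot> h), quot = G, proj = c\<rparr> \<in> exact_seqs p"
  proof (rule exact_seqI[OF M.module_axioms Gp smult_lin_hom[OF hc] hom nontorsion_smult_inj[OF h]])
    show "c ` carrier H = carrier G" by (simp add: Gs)
    fix x assume x: "x \<in> carrier H"
    have "c x = \<one>\<^bsub>G\<^esub> \<longleftrightarrow> P \<zero> x" using c_iff[of \<zero> x] x by (auto simp: Gs)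
    also have "\<dots> \<longleftrightarrow> x \<in> (\<lambda>a. a \<odot> h) ` carrier Z" using hc x by (auto simp: P_def)
    finally show "c x = \<one>\<^bsub>G\<^esub> \<longleftrightarrow> x \<in> (\<lambda>a. a \<odot> h) ` carrier Z" .
  qed
  then show ?thesis using hc by (intro bexI) auto
qed

subsection \<open>The measure of the generators of a cyclic submodule\<close>

definition "cyclic x = (\<lambda>a. a \<odot> x) ` carrier Z"
definition "unit_multiples x = (\<lambda>a. a \<odot> x) ` {a \<in> carrier Z. a 1 \<noteq> 0}"

lemma overlapping_translates:
  assumes "x \<in> carrier H" "A \<subseteq> carrier H" "y \<in> carrier H" "A = (\<lambda>a. a \<odot> h) ` B" "h \<in> carrier H" "B \<subseteq> carrier Z"
    "\<And>a b. a \<in> B \<Longrightarrow> b \<in> B \<Longrightarrow> a \<ominus>\<^bsub>Z\<^esub> b \<in> B" "(\<lambda>z. x \<oplus> z) ` A \<inter> (\<lambda>z. y \<oplus> z) ` A \<noteq> {}"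
  shows "\<exists>a\<in>B. x = y \<oplus> a \<odot> h"
proof -
  obtain a b where ab: "a \<in> B" "b \<in> B" "x \<oplus> a \<odot> h = y \<oplus> b \<odot> h" using assms(4,8) by auto
  have c: "a \<in> carrier Z" "b \<in> carrier Z" using ab assms(6) by auto
  have "x = (x \<oplus> a \<odot> h) \<oplus> (\<ominus>\<^bsub>Z\<^esub> a) \<odot> h" using c assms by (simp add: M.smult_l_minus M.a_assoc M.r_neg)
  also have "\<dots> = y \<oplus> (b \<ominus>\<^bsub>Z\<^esub> a) \<odot> h" unfolding ab(3) using c assms
    by (simp add: a_minus_def M.smult_l_distr M.a_assoc)
  finally show ?thesis using assms(7)[OF ab(2,1)] by blast
qed

text \<open>The translates of \<open>Zp h\<close> by lifts of the elements of the quotient tile the module.\<close>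

lemma cyclic_measure:
  assumes s: "s \<in> exact_seqs p" and m: "middle s = H"
  defines "h \<equiv> incl s \<one>\<^bsub>Z\<^esub>"
  shows "cyclic h \<in> sets \<mu>" "measure \<mu> (cyclic h) = 1 / real (order (quot s))"
proof -
  interpret S: exact_sequence p s using s by (rule exact_sequenceI)
  have hc: "h \<in> carrier H" using S.i_closed[of "\<one>\<^bsub>Z\<^esub>"] m by (simp add: h_def)
  have ieq: "S.i a = a \<odot> h" if "a \<in> carrier Z" for a using S.i_eq[OF that] m by (simp add: h_def)
  have qeq: "S.q x = S.q y \<longleftrightarrow> (\<exists>a\<in>carrier Z. x = y \<oplus> a \<odot> h)" if "x \<in> carrier H" "y \<in> carrier H" for x y
    using S.q_eq_iff[of x y] m that ieq by simp
  have qs: "S.q ` carrier H = carrier S.G" using S.q_surj m by simp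
  have sc: "cyclic h \<subseteq> carrier H" using hc by (auto simp: cyclic_def)
  show sets: "cyclic h \<in> sets \<mu>"
  proof (rule haar_openI[OF sc])
    fix x assume "x \<in> cyclic h"
    then obtain a where a: "a \<in> carrier Z" "x = a \<odot> h" by (auto simp: cyclic_def)
    have "pcoset x S.N \<subseteq> cyclic h"
    proof
      fix y assume "y \<in> pcoset x S.N"
      then obtain z where z: "z \<in> carrier H" "y = x \<oplus> pint (int p ^ S.N) \<odot> z" by (auto simp: pcoset_iff)
      obtain b where b: "b \<in> carrier Z" "pint (int p ^ S.N) \<odot> z = b \<odot> h" using S.pN_in_image[of z] z(1) m ieq by auto
      have "y = (a \<oplus>\<^bsub>Z\<^esub> b) \<odot> h" using a b z hc by (simp add: M.smult_l_distr)
      then show "y \<in> cyclic h" using a(1) b(1) by (auto simp: cyclic_def)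
    qed
    then show "\<exists>n. pcoset x n \<subseteq> cyclic h" ..
  qed
  define \<sigma> where "\<sigma> = inv_into (carrier H) S.q"
  have \<sigma>: "\<sigma> g \<in> carrier H" "S.q (\<sigma> g) = g" if "g \<in> carrier S.G" for g
    using that qs unfolding \<sigma>_def by (metis inv_into_into, metis f_inv_into_f)
  let ?X = "\<sigma> ` carrier S.G"
  have inj: "inj_on \<sigma> (carrier S.G)" by (rule inj_on_inverseI[of _ S.q]) (use \<sigma> in auto)
  have X: "finite ?X" "?X \<subseteq> carrier H" "card ?X = order S.G"
    using \<sigma> pgroupD(3)[OF S.G_pgroup] card_image[OF inj] by (auto simp: order_def)
  have "(\<Union>x\<in>?X. (\<lambda>z. x \<oplus> z) ` cyclic h) = carrier H"
  proof
    show "(\<Union>x\<in>?X. (\<lambda>z. x \<oplus> z) ` cyclic h) \<subseteq> carrier H" using X(2) sc by auto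
    show "carrier H \<subseteq> (\<Union>x\<in>?X. (\<lambda>z. x \<oplus> z) ` cyclic h)"
    proof
      fix y assume y: "y \<in> carrier H"
      have g: "S.q y \<in> carrier S.G" using qs y by blast
      have "S.q y = S.q (\<sigma> (S.q y))" using \<sigma>(2)[OF g] by simp
      then obtain a where "a \<in> carrier Z" "y = \<sigma> (S.q y) \<oplus> a \<odot> h" using qeq[OF y \<sigma>(1)[OF g]] by blast
      then show "y \<in> (\<Union>x\<in>?X. (\<lambda>z. x \<oplus> z) ` cyclic h)" using g unfolding cyclic_def by blast
    qed
  qed
  then have "1 = measure \<mu> (\<Union>x\<in>?X. (\<lambda>z. x \<oplus> z) ` cyclic h)" using haar.prob_space space_haar by simp
  also have "\<dots> = real (card ?X) * measure \<mu> (cyclic h)"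
  proof (rule haar_tiling[OF X(1,2) sets])
    fix x y assume xy: "x \<in> ?X" "y \<in> ?X" "x \<noteq> y"
    then have c: "x \<in> carrier H" "y \<in> carrier H" using X(2) by auto
    show "(\<lambda>z. x \<oplus> z) ` cyclic h \<inter> (\<lambda>z. y \<oplus> z) ` cyclic h = {}"
    proof (rule ccontr)
      assume "\<not> ?thesis"
      then have "\<exists>a\<in>carrier Z. x = y \<oplus> a \<odot> h"
        by (intro overlapping_translates[OF c(1) sc c(2) _ hc]) (auto simp: cyclic_def)
      then have "S.q x = S.q y" using qeq c by blast
      then show False using xy \<sigma> by auto
    qed
  qed
  finally show "measure \<mu> (cyclic h) = 1 / real (order S.G)"
    using X(3) order_pos[OF S.G_pgroup] by (simp add: field_simps)
qed

text \<open>The translates of \<open>p Zp h\<close> by \<open>0, h, \<dots>, (p - 1) h\<close> tile \<open>Zp h\<close>, and the unit multiples of \<open>h\<close> are what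
is left of \<open>Zp h\<close> when \<open>p Zp h\<close> is removed.\<close>

lemma unit_multiples_measure:
  assumes s: "s \<in> exact_seqs p" and m: "middle s = H"
  defines "h \<equiv> incl s \<one>\<^bsub>Z\<^esub>"
  shows "unit_multiples h \<in> sets \<mu>" "measure \<mu> (unit_multiples h) = (1 - 1 / real p) / real (order (quot s))"
proof -
  interpret S: exact_sequence p s using s by (rule exact_sequenceI)
  have hc: "h \<in> carrier H" using S.i_closed[of "\<one>\<^bsub>Z\<^esub>"] m by (simp add: h_def)
  have hn: "nontorsion h" using S.i_one_nontorsion m by (simp add: h_def)
  have ieq: "S.i a = a \<odot> h" if "a \<in> carrier Z" for a using S.i_eq[OF that] m by (simp add: h_def)
  note sp = cyclic_measure[OF s m, folded h_def]
  define B where "B = (\<lambda>b. pint (int p) \<otimes>\<^bsub>Z\<^esub> b) ` carrier Z"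
  have Bc: "B \<subseteq> carrier Z" by (auto simp: B_def)
  have B_iff: "a \<in> B \<longleftrightarrow> a 1 = 0" if "a \<in> carrier Z" for a
    using divide_by_p_power[OF that, of 1] pint_p_not_unit by (auto simp: B_def)
  let ?A = "(\<lambda>a. a \<odot> h) ` B"
  have Ac: "?A \<subseteq> carrier H" using hc Bc by auto
  have Asets: "?A \<in> sets \<mu>"
  proof (rule haar_openI[OF Ac])
    fix x assume "x \<in> ?A"
    then obtain a where a: "a \<in> carrier Z" "x = (pint (int p) \<otimes>\<^bsub>Z\<^esub> a) \<odot> h" by (auto simp: B_def)
    have "pcoset x (Suc S.N) \<subseteq> ?A"
    proof
      fix y assume "y \<in> pcoset x (Suc S.N)"
      then obtain z where z: "z \<in> carrier H" "y = x \<oplus> pint (int p ^ Suc S.N) \<odot> z" by (auto simp: pcoset_iff)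
      obtain b where b: "b \<in> carrier Z" "pint (int p ^ S.N) \<odot> z = b \<odot> h" using S.pN_in_image[of z] z(1) m ieq by auto
      have "pint (int p ^ Suc S.N) \<odot> z = pint (int p) \<odot> (b \<odot> h)"
        using z(1) b(2) by (simp add: pint_mult M.smult_assoc1)
      then have "y = (pint (int p) \<otimes>\<^bsub>Z\<^esub> (a \<oplus>\<^bsub>Z\<^esub> b)) \<odot> h" using a b(1) z hc
        by (simp add: M.smult_l_distr Z.r_distr M.smult_assoc1)
      then show "y \<in> ?A" using a(1) b(1) by (auto simp: B_def)
    qed
    then show "\<exists>n. pcoset x n \<subseteq> ?A" ..
  qed
  let ?X = "(\<lambda>j. pint (int j) \<odot> h) ` {..<p}"
  have injX: "inj_on (\<lambda>j. pint (int j) \<odot> h) {..<p}"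
  proof (rule inj_onI)
    fix i j assume "pint (int i) \<odot> h = pint (int j) \<odot> h"
    then have "pint (int i) = pint (int j)" using inj_onD[OF nontorsion_smult_inj[OF hn]] by simp
    then have "int i = int j" by (rule pint_inj)
    then show "i = j" by simp
  qed
  have "cyclic h = (\<Union>x\<in>?X. (\<lambda>z. x \<oplus> z) ` ?A)"
  proof
    show "cyclic h \<subseteq> (\<Union>x\<in>?X. (\<lambda>z. x \<oplus> z) ` ?A)"
    proof
      fix y assume "y \<in> cyclic h"
      then obtain a where a: "a \<in> carrier Z" "y = a \<odot> h" by (auto simp: cyclic_def)
      obtain b where b: "b \<in> carrier Z" "a = pint (a 1) \<oplus>\<^bsub>Z\<^esub> pint (int p ^ 1) \<otimes>\<^bsub>Z\<^esub> b" using residue_decomposition[OF a(1)] by blast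
      have y: "y = pint (a 1) \<odot> h \<oplus> (pint (int p) \<otimes>\<^bsub>Z\<^esub> b) \<odot> h" unfolding a(2)
        by (subst b(2)) (use b(1) hc in \<open>simp add: M.smult_l_distr\<close>)
      have "pint (a 1) \<odot> h = pint (int (nat (a 1))) \<odot> h" "nat (a 1) \<in> {..<p}"
        using Z_bounds[OF a(1), of 1] by auto
      then show "y \<in> (\<Union>x\<in>?X. (\<lambda>z. x \<oplus> z) ` ?A)" unfolding y B_def using b(1) by blast
    qed
    show "(\<Union>x\<in>?X. (\<lambda>z. x \<oplus> z) ` ?A) \<subseteq> cyclic h"
      using hc Bc by (auto simp: cyclic_def M.smult_l_distr[symmetric])
  qed
  then have "1 / real (order S.G) = measure \<mu> (\<Union>x\<in>?X. (\<lambda>z. x \<oplus> z) ` ?A)" using sp(2) by simp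
  also have "\<dots> = real (card ?X) * measure \<mu> ?A"
  proof (rule haar_tiling[OF _ _ Asets])
    show "finite ?X" "?X \<subseteq> carrier H" using hc by auto
    fix x y assume xy: "x \<in> ?X" "y \<in> ?X" "x \<noteq> y"
    then obtain i j where ij: "x = pint (int i) \<odot> h" "y = pint (int j) \<odot> h" "i < p" "j < p" by auto
    show "(\<lambda>z. x \<oplus> z) ` ?A \<inter> (\<lambda>z. y \<oplus> z) ` ?A = {}"
    proof (rule ccontr)
      assume "\<not> ?thesis"
      moreover have "a \<ominus>\<^bsub>Z\<^esub> b \<in> B" if "a \<in> B" "b \<in> B" for a b
      proof -
        obtain a' b' where "a' \<in> carrier Z" "b' \<in> carrier Z" "a = pint (int p) \<otimes>\<^bsub>Z\<^esub> a'" "b = pint (int p) \<otimes>\<^bsub>Z\<^esub> b'"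
          using \<open>a \<in> B\<close> \<open>b \<in> B\<close> by (auto simp: B_def)
        then have "a \<ominus>\<^bsub>Z\<^esub> b = pint (int p) \<otimes>\<^bsub>Z\<^esub> (a' \<ominus>\<^bsub>Z\<^esub> b')" by (simp add: a_minus_def Z.r_distr Z.r_minus)
        then show ?thesis using \<open>a' \<in> carrier Z\<close> \<open>b' \<in> carrier Z\<close> by (auto simp: B_def)
      qed
      ultimately have "\<exists>a\<in>B. x = y \<oplus> a \<odot> h"
        using ij hc by (intro overlapping_translates[OF _ Ac _ refl hc Bc]) auto
      then obtain b where b: "b \<in> carrier Z" "x = y \<oplus> (pint (int p) \<otimes>\<^bsub>Z\<^esub> b) \<odot> h" by (auto simp: B_def)
      then have "pint (int i) \<odot> h = (pint (int j) \<oplus>\<^bsub>Z\<^esub> pint (int p) \<otimes>\<^bsub>Z\<^esub> b) \<odot> h" using ij hc by (simp add: M.smult_l_distr)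
      then have "pint (int i) = pint (int j) \<oplus>\<^bsub>Z\<^esub> pint (int p) \<otimes>\<^bsub>Z\<^esub> b"
        using inj_onD[OF nontorsion_smult_inj[OF hn]] b(1) by simp
      then have "pint (int i) 1 = (pint (int j) \<oplus>\<^bsub>Z\<^esub> pint (int p) \<otimes>\<^bsub>Z\<^esub> b) 1" by simp
      then have "int i mod int p = int j mod int p" by (simp add: Z_add Z_mult pint_def)
      then have "i = j" using ij by simp
      then show False using xy(3) ij by simp
    qed
  qed
  also have "card ?X = p" using card_image[OF injX] by simp
  finally have mA: "measure \<mu> ?A = 1 / real (order S.G) / real p" using p_gt_1 by (simp add: field_simps)
  have U: "unit_multiples h = cyclic h - ?A"
  proof
    show "unit_multiples h \<subseteq> cyclic h - ?A"
    proof
      fix y assume "y \<in> unit_multiples h"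
      then obtain a where a: "a \<in> carrier Z" "a 1 \<noteq> 0" "y = a \<odot> h" by (auto simp: unit_multiples_def)
      have "y \<notin> ?A"
      proof
        assume "y \<in> ?A"
        then obtain b where b: "b \<in> B" "a \<odot> h = b \<odot> h" using a(3) by auto
        then have "a = b" using inj_onD[OF nontorsion_smult_inj[OF hn], of a b] b a(1) Bc by auto
        then show False using b(1) a B_iff by simp
      qed
      then show "y \<in> cyclic h - ?A" using a by (auto simp: cyclic_def)
    qed
    show "cyclic h - ?A \<subseteq> unit_multiples h" using B_iff by (auto simp: cyclic_def unit_multiples_def)
  qed
  show "unit_multiples h \<in> sets \<mu>" unfolding U using sp(1) Asets by auto
  have "?A \<subseteq> cyclic h" using Bc by (auto simp: cyclic_def)
  then have "measure \<mu> (unit_multiples h) = measure \<mu> (cyclic h) - measure \<mu> ?A"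
    unfolding U using sp(1) Asets by (intro haar.finite_measure_Diff)
  then show "measure \<mu> (unit_multiples h) = (1 - 1 / real p) / real (order S.G)"
    using sp(2) mA by (simp add: diff_divide_distrib mult.commute)
qed

end

section \<open>Orbits of automorphisms\<close>

context padic begin

lemma smult_unit_iso:
  fixes H :: "(padic, 'a, 'm) module_scheme"
  assumes "Module.module Z H" "v \<in> carrier Z" "v 1 \<noteq> 0"
  shows "(\<lambda>x. v \<odot>\<^bsub>H\<^esub> x) \<in> lin_iso Z H H"
proof -
  interpret padic_module p H by (intro padic_module.intro padic_axioms assms(1))
  obtain w where w: "w \<in> carrier Z" "v \<otimes>\<^bsub>Z\<^esub> w = \<one>\<^bsub>Z\<^esub>" using Z_unit assms(2,3) by blast
  have wv: "w \<odot>\<^bsub>H\<^esub> (v \<odot>\<^bsub>H\<^esub> x) = x" "v \<odot>\<^bsub>H\<^esub> (w \<odot>\<^bsub>H\<^esub> x) = x" if "x \<in> carrier H" for x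
    using w assms(2) that by (simp_all add: M.smult_assoc1[symmetric] Z.m_comm)
  show ?thesis
  proof (rule lin_isoI)
    show "(\<lambda>x. v \<odot>\<^bsub>H\<^esub> x) \<in> lin_hom Z H H"
      unfolding lin_hom_iff using assms(2) by (auto simp: M.smult_r_distr intro: smult_commute)
    show "inj_on (\<lambda>x. v \<odot>\<^bsub>H\<^esub> x) (carrier H)" by (rule inj_on_inverseI[of _ "\<lambda>x. w \<odot>\<^bsub>H\<^esub> x"]) (rule wv)
    show "(\<lambda>x. v \<odot>\<^bsub>H\<^esub> x) ` carrier H = carrier H"
    proof
      show "carrier H \<subseteq> (\<lambda>x. v \<odot>\<^bsub>H\<^esub> x) ` carrier H"
      proof
        fix x assume "x \<in> carrier H"
        then show "x \<in> (\<lambda>x. v \<odot>\<^bsub>H\<^esub> x) ` carrier H"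
          using wv(2) w(1) by (intro image_eqI[of _ _ "w \<odot>\<^bsub>H\<^esub> x"]) auto
      qed
    qed (use assms(2) in auto)
  qed
qed

lemma right_inverse_imp_unit:
  assumes "a \<in> carrier Z" "b \<in> carrier Z" "a \<otimes>\<^bsub>Z\<^esub> b = \<one>\<^bsub>Z\<^esub>"
  shows "a 1 \<noteq> 0"
proof -
  have "(a 1 * b 1) mod int p ^ 1 = 1 mod int p ^ 1" using fun_cong[OF assms(3), of 1] by (simp only: Z_mult Z_one)
  then show ?thesis using p_gt_1 by auto
qed

end

context rank1_module begin

lemma T_map:
  assumes "\<phi> \<in> lin_hom Z H H" "t \<in> T" shows "\<phi> t \<in> T"
proof -
  note f = lin_homD[OF assms(1)]
  have t: "t \<in> carrier H" using assms(2) T_closed by blast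
  have "pint (int p ^ k) \<odot> \<phi> t = \<phi> (pint (int p ^ k) \<odot> t)" using f(3) t by simp
  also have "\<dots> = \<zero>" using T_kill[OF assms(2)] lin_hom_zero[OF assms(1) M.module_axioms] by simp
  finally have "pint (int p ^ k) \<otimes>\<^bsub>Z\<^esub> \<pi> (\<phi> t) = \<zero>\<^bsub>Z\<^esub>"
    using pi_smult[of "pint (int p ^ k)" "\<phi> t"] f(1)[OF t] pi_T[OF zero_T] by simp
  then have "\<pi> (\<phi> t) = \<zero>\<^bsub>Z\<^esub>" using p_power_mult_eq_0 f(1)[OF t] pi_closed by blast
  then show ?thesis using f(1)[OF t] by (simp add: T_def)
qed

lemma map_decomp:
  assumes "\<phi> \<in> lin_hom Z H H" "x \<in> carrier H"
  shows "\<phi> x = \<pi> x \<odot> \<phi> e \<oplus> \<phi> (tor x)"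
proof -
  note f = lin_homD[OF assms(1)]
  have "\<phi> (\<pi> x \<odot> e \<oplus> tor x) = \<pi> x \<odot> \<phi> e \<oplus> \<phi> (tor x)"
    using f assms(2) T_closed[OF tor_T[OF assms(2)]] by simp
  then show ?thesis using decomp[OF assms(2)] by metis
qed

text \<open>Torsion is mapped to torsion, so an endomorphism acts on \<open>H / T\<close> by a scalar.\<close>

lemma pi_map:
  assumes "\<phi> \<in> lin_hom Z H H" "x \<in> carrier H"
  shows "\<pi> (\<phi> x) = \<pi> (\<phi> e) \<otimes>\<^bsub>Z\<^esub> \<pi> x"
proof -
  note f = lin_homD[OF assms(1)]
  note t = T_map[OF assms(1) tor_T[OF assms(2)]]
  have "\<pi> (\<phi> x) = \<pi> (\<pi> x \<odot> \<phi> e \<oplus> \<phi> (tor x))" using map_decomp[OF assms] by simp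
  also have "\<dots> = \<pi> x \<otimes>\<^bsub>Z\<^esub> \<pi> (\<phi> e)"
    using f(1) assms(2) T_closed[OF t] pi_T[OF t] by (simp add: pi_add pi_smult)
  finally show ?thesis using f(1) assms(2) by (simp add: Z.m_comm)
qed

lemma pi_iso_unit:
  assumes "\<phi> \<in> lin_iso Z H H"
  shows "\<exists>v\<in>carrier Z. \<pi> (\<phi> e) \<otimes>\<^bsub>Z\<^esub> v = \<one>\<^bsub>Z\<^esub>"
proof -
  note inv = lin_iso_inv[OF M.module_axioms assms]
  let ?g = "inv_into (carrier H) \<phi>"
  have g: "?g e \<in> carrier H" using lin_homD(1)[OF lin_isoD(1)[OF inv]] by simp
  have "\<phi> (?g e) = e" using lin_isoD(3)[OF assms] by (simp add: f_inv_into_f)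
  then have eq: "\<pi> (\<phi> e) \<otimes>\<^bsub>Z\<^esub> \<pi> (?g e) = \<one>\<^bsub>Z\<^esub>" using pi_map[OF lin_isoD(1)[OF assms] g] by simp
  show ?thesis by (rule bexI, rule eq) (use g in simp)
qed

text \<open>The automorphisms that act trivially on \<open>H / T\<close>.\<close>

definition proj_auts where
  "proj_auts = {\<phi> \<in> extensional (carrier H). \<phi> \<in> lin_iso Z H H \<and> (\<forall>x\<in>carrier H. \<pi> (\<phi> x) = \<pi> x)}"

text \<open>Such an automorphism is determined by the images of \<open>e\<close> and of the elements of \<open>T\<close>, for which there are
finitely many possibilities.\<close>

lemma finite_proj_auts: "finite proj_auts"
proof -
  let ?C = "((\<lambda>t. e \<oplus> t) ` T) \<union> T"
  have "inj_on (\<lambda>\<phi>. restrict \<phi> (insert e T)) proj_auts"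
  proof (rule inj_onI)
    fix \<phi> \<phi>' assume a: "\<phi> \<in> proj_auts" "\<phi>' \<in> proj_auts" and e: "restrict \<phi> (insert e T) = restrict \<phi>' (insert e T)"
    have r: "\<phi> y = \<phi>' y" if "y \<in> insert e T" for y using fun_cong[OF e, of y] that by simp
    show "\<phi> = \<phi>'"
    proof (rule extensionalityI)
      show "\<phi> \<in> extensional (carrier H)" "\<phi>' \<in> extensional (carrier H)" using a by (auto simp: proj_auts_def)
      fix x assume x: "x \<in> carrier H"
      have l: "\<phi> \<in> lin_hom Z H H" "\<phi>' \<in> lin_hom Z H H" using a lin_isoD(1) by (auto simp: proj_auts_def)
      show "\<phi> x = \<phi>' x" unfolding map_decomp[OF l(1) x] map_decomp[OF l(2) x]
        using r[of e] r[of "tor x"] tor_T[OF x] by simp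
    qed
  qed
  moreover have "(\<lambda>\<phi>. restrict \<phi> (insert e T)) ` proj_auts \<subseteq> insert e T \<rightarrow>\<^sub>E ?C"
  proof (rule image_subsetI)
    fix \<phi> assume "\<phi> \<in> proj_auts"
    then have l: "\<phi> \<in> lin_hom Z H H" and pe: "\<pi> (\<phi> e) = \<one>\<^bsub>Z\<^esub>" using lin_isoD(1) by (auto simp: proj_auts_def)
    have c: "\<phi> e \<in> carrier H" using lin_homD(1)[OF l] by simp
    have "\<phi> e = e \<oplus> tor (\<phi> e)" using decomp[OF c] pe by simp
    then have "\<phi> e \<in> ?C" using tor_T[OF c] by blast
    then show "restrict \<phi> (insert e T) \<in> insert e T \<rightarrow>\<^sub>E ?C" using T_map[OF l] by auto
  qed
  moreover have "finite (insert e T \<rightarrow>\<^sub>E ?C)" using finite_T by (intro finite_PiE) auto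
  ultimately show ?thesis by (metis finite_imageD finite_subset)
qed

lemma proj_autsD:
  assumes "\<phi> \<in> proj_auts"
  shows "\<phi> \<in> lin_iso Z H H" "\<phi> \<in> lin_hom Z H H" "x \<in> carrier H \<Longrightarrow> \<phi> x \<in> carrier H" "x \<in> carrier H \<Longrightarrow> \<pi> (\<phi> x) = \<pi> x"
  using assms lin_isoD(1) lin_homD(1) by (fastforce simp: proj_auts_def)+

lemma proj_autsI:
  assumes "\<phi> \<in> lin_iso Z H H" "\<And>x. x \<in> carrier H \<Longrightarrow> \<pi> (\<phi> x) = \<pi> x"
  shows "restrict \<phi> (carrier H) \<in> proj_auts"
  unfolding proj_auts_def using lin_iso_cong[OF M.module_axioms assms(1), of "restrict \<phi> (carrier H)"] assms(2) by simp

lemma card_proj_auts_pos: "0 < card proj_auts"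
proof -
  have "restrict (\<lambda>x. x) (carrier H) \<in> proj_auts" by (rule proj_autsI) (auto intro: lin_iso_id)
  then show ?thesis using finite_proj_auts card_gt_0_iff by blast
qed

text \<open>The orbit-stabilizer theorem for the action of \<open>proj_auts\<close> on \<open>H\<close>. An automorphism that fixes \<open>h\<close> acts
on \<open>H / T\<close> by a scalar that fixes \<open>\<pi>(h) \<noteq> 0\<close>, so it belongs to \<open>proj_auts\<close>.\<close>

lemma stabilizer_count:
  assumes s: "s \<in> exact_seqs p" and m: "middle s = H"
  defines "h \<equiv> incl s \<one>\<^bsub>Z\<^esub>"
  shows "card proj_auts = card (Aut_incl p s) * card ((\<lambda>\<phi>. \<phi> h) ` proj_auts)"
proof (rule card_eq_fibre_times_image[OF finite_proj_auts])
  interpret S: exact_sequence p s using s by (rule exact_sequenceI)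
  have hc: "h \<in> carrier H" using S.i_closed[of "\<one>\<^bsub>Z\<^esub>"] m by (simp add: h_def)
  have hn: "\<pi> h \<noteq> \<zero>\<^bsub>Z\<^esub>" using S.i_one_nontorsion m by (simp add: h_def nontorsion_iff)
  have ieq: "S.i a = a \<odot> h" if "a \<in> carrier Z" for a using S.i_eq[OF that] m by (simp add: h_def)
  have Aut: "\<alpha> \<in> Aut_incl p s \<longleftrightarrow> \<alpha> \<in> proj_auts \<and> \<alpha> h = h" for \<alpha>
  proof
    assume a: "\<alpha> \<in> Aut_incl p s"
    then have l: "\<alpha> \<in> lin_iso Z H H" and ext: "\<alpha> \<in> extensional (carrier H)" and ah: "\<alpha> h = h"
      using m by (auto simp: Aut_incl_def h_def)
    note lh = lin_isoD(1)[OF l]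
    have u: "\<pi> (\<alpha> e) \<in> carrier Z" using lin_homD(1)[OF lh] by simp
    have "\<pi> (\<alpha> e) \<otimes>\<^bsub>Z\<^esub> \<pi> h = \<one>\<^bsub>Z\<^esub> \<otimes>\<^bsub>Z\<^esub> \<pi> h" using pi_map[OF lh hc] ah hc by simp
    then have "\<pi> (\<alpha> e) = \<one>\<^bsub>Z\<^esub>" using Z.m_rcancel[OF hn, of "\<pi> (\<alpha> e)" "\<one>\<^bsub>Z\<^esub>"] u hc by simp
    then have "\<pi> (\<alpha> x) = \<pi> x" if "x \<in> carrier H" for x using pi_map[OF lh that] that by simp
    then show "\<alpha> \<in> proj_auts \<and> \<alpha> h = h" using l ext ah by (simp add: proj_auts_def)
  next
    assume a: "\<alpha> \<in> proj_auts \<and> \<alpha> h = h"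
    have "\<alpha> (S.i a) = S.i a" if "a \<in> carrier Z" for a
      using ieq[OF that] lin_homD(3)[OF proj_autsD(2) that hc, of \<alpha>] a by simp
    then show "\<alpha> \<in> Aut_incl p s" using a m by (simp add: Aut_incl_def proj_auts_def)
  qed
  fix \<phi> assume \<phi>: "\<phi> \<in> proj_auts"
  note f = proj_autsD[OF \<phi>]
  let ?g = "inv_into (carrier H) \<phi>"
  note inv = lin_iso_inv[OF M.module_axioms f(1)]
  have gf: "?g (\<phi> x) = x" if "x \<in> carrier H" for x using lin_isoD(2)[OF f(1)] that by (rule inv_into_f_f)
  have fg: "\<phi> (?g y) = y" if "y \<in> carrier H" for y using that lin_isoD(3)[OF f(1)] by (simp add: f_inv_into_f)
  have gc: "?g y \<in> carrier H" if "y \<in> carrier H" for y using lin_homD(1)[OF lin_isoD(1)[OF inv] that] .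
  have gpi: "\<pi> (?g y) = \<pi> y" if "y \<in> carrier H" for y using f(4)[OF gc[OF that]] fg[OF that] by simp
  let ?D = "\<lambda>\<alpha>. restrict (\<lambda>x. \<phi> (\<alpha> x)) (carrier H)"
  have "bij_betw ?D (Aut_incl p s) {\<psi> \<in> proj_auts. \<psi> h = \<phi> h}"
  proof (rule bij_betw_imageI)
    show "inj_on ?D (Aut_incl p s)"
    proof (rule inj_onI)
      fix \<alpha> \<beta> assume a: "\<alpha> \<in> Aut_incl p s" "\<beta> \<in> Aut_incl p s" "?D \<alpha> = ?D \<beta>"
      show "\<alpha> = \<beta>"
      proof (rule extensionalityI)
        show "\<alpha> \<in> extensional (carrier H)" "\<beta> \<in> extensional (carrier H)" using a m by (auto simp: Aut_incl_def)
        fix x assume x: "x \<in> carrier H"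
        have "\<phi> (\<alpha> x) = \<phi> (\<beta> x)" using fun_cong[OF a(3), of x] x by simp
        then show "\<alpha> x = \<beta> x" using inj_onD[OF lin_isoD(2)[OF f(1)]] proj_autsD(3)[OF _ x] a(1,2) Aut by blast
      qed
    qed
    show "?D ` Aut_incl p s = {\<psi> \<in> proj_auts. \<psi> h = \<phi> h}"
    proof
      show "?D ` Aut_incl p s \<subseteq> {\<psi> \<in> proj_auts. \<psi> h = \<phi> h}"
      proof (rule image_subsetI)
        fix \<alpha> assume "\<alpha> \<in> Aut_incl p s"
        then have a: "\<alpha> \<in> proj_auts" "\<alpha> h = h" using Aut by auto
        have "?D \<alpha> \<in> proj_auts"
          by (rule proj_autsI[OF lin_iso_comp[OF proj_autsD(1)[OF a(1)] f(1)]]) (use f(4) proj_autsD(3,4)[OF a(1)] in simp)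
        then show "?D \<alpha> \<in> {\<psi> \<in> proj_auts. \<psi> h = \<phi> h}" using a(2) hc by simp
      qed
      show "{\<psi> \<in> proj_auts. \<psi> h = \<phi> h} \<subseteq> ?D ` Aut_incl p s"
      proof
        fix \<psi> assume "\<psi> \<in> {\<psi> \<in> proj_auts. \<psi> h = \<phi> h}"
        then have psi: "\<psi> \<in> proj_auts" "\<psi> h = \<phi> h" by auto
        let ?a = "restrict (\<lambda>x. ?g (\<psi> x)) (carrier H)"
        have "?a \<in> proj_auts"
          by (rule proj_autsI[OF lin_iso_comp[OF proj_autsD(1)[OF psi(1)] inv]]) (use gpi proj_autsD(3,4)[OF psi(1)] in simp)
        moreover have "?a h = h" using hc psi(2) gf by simp
        ultimately have "?a \<in> Aut_incl p s" using Aut by blast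
        moreover have "\<psi> = ?D ?a"
        proof (rule extensionalityI)
          show "\<psi> \<in> extensional (carrier H)" using psi(1) by (simp add: proj_auts_def)
          show "?D ?a \<in> extensional (carrier H)" by simp
          fix x assume "x \<in> carrier H"
          then show "\<psi> x = ?D ?a x" using fg proj_autsD(3)[OF psi(1)] by simp
        qed
        ultimately show "\<psi> \<in> ?D ` Aut_incl p s" by blast
      qed
    qed
  qed
  then show "card {\<psi> \<in> proj_auts. \<psi> h = \<phi> h} = card (Aut_incl p s)" using bij_betw_same_card by fastforce
qed

definition orbit where "orbit h = {\<phi> h | \<phi>. \<phi> \<in> lin_iso Z H H}"

text \<open>An automorphism acts on \<open>H / T\<close> by a unit; multiplied by the inverse of this unit it belongs to
\<open>proj_auts\<close>.\<close>

lemma orbit_eq: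
  assumes h: "nontorsion h"
  shows "orbit h = (\<Union>x\<in>(\<lambda>\<phi>. \<phi> h) ` proj_auts. unit_multiples x)"
proof
  have hc: "h \<in> carrier H" using h by (simp add: nontorsion_def)
  show "orbit h \<subseteq> (\<Union>x\<in>(\<lambda>\<phi>. \<phi> h) ` proj_auts. unit_multiples x)"
  proof
    fix y assume "y \<in> orbit h"
    then obtain \<phi> where \<phi>: "\<phi> \<in> lin_iso Z H H" "y = \<phi> h" by (auto simp: orbit_def)
    note lh = lin_isoD(1)[OF \<phi>(1)]
    note f = lin_homD[OF lh]
    let ?u = "\<pi> (\<phi> e)"
    have u: "?u \<in> carrier Z" using f(1) by simp
    obtain v where v: "v \<in> carrier Z" "?u \<otimes>\<^bsub>Z\<^esub> v = \<one>\<^bsub>Z\<^esub>" using pi_iso_unit[OF \<phi>(1)] by blast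
    have vu: "v \<otimes>\<^bsub>Z\<^esub> ?u = \<one>\<^bsub>Z\<^esub>" using v u by (simp add: Z.m_comm)
    have v1: "v 1 \<noteq> 0" and u1: "?u 1 \<noteq> 0" using right_inverse_imp_unit[OF v(1) u vu] right_inverse_imp_unit[OF u v] by auto
    have psi: "restrict (\<lambda>x. v \<odot> \<phi> x) (carrier H) \<in> proj_auts"
    proof (rule proj_autsI)
      show "(\<lambda>x. v \<odot> \<phi> x) \<in> lin_iso Z H H"
        using lin_iso_comp[OF \<phi>(1) smult_unit_iso[OF M.module_axioms v(1) v1]] .
      fix x assume x: "x \<in> carrier H"
      have "\<pi> (v \<odot> \<phi> x) = (v \<otimes>\<^bsub>Z\<^esub> ?u) \<otimes>\<^bsub>Z\<^esub> \<pi> x"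
        using v(1) u x f(1) by (simp add: pi_smult pi_map[OF lh x] Z.m_assoc)
      then show "\<pi> (v \<odot> \<phi> x) = \<pi> x" using vu x by simp
    qed
    have "y = ?u \<odot> (restrict (\<lambda>x. v \<odot> \<phi> x) (carrier H) h)"
      using hc u v f(1) \<phi>(2) by (simp add: M.smult_assoc1[symmetric])
    then have "y \<in> unit_multiples (restrict (\<lambda>x. v \<odot> \<phi> x) (carrier H) h)"
      unfolding unit_multiples_def using u u1 by blast
    then show "y \<in> (\<Union>x\<in>(\<lambda>\<phi>. \<phi> h) ` proj_auts. unit_multiples x)" using psi by blast
  qed
  show "(\<Union>x\<in>(\<lambda>\<phi>. \<phi> h) ` proj_auts. unit_multiples x) \<subseteq> orbit h"
  proof
    fix y assume "y \<in> (\<Union>x\<in>(\<lambda>\<phi>. \<phi> h) ` proj_auts. unit_multiples x)"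
    then obtain \<phi> a where \<phi>: "\<phi> \<in> proj_auts" "a \<in> carrier Z" "a 1 \<noteq> 0" "y = a \<odot> \<phi> h" by (auto simp: unit_multiples_def)
    have "(\<lambda>x. a \<odot> \<phi> x) \<in> lin_iso Z H H"
      using lin_iso_comp[OF proj_autsD(1)[OF \<phi>(1)] smult_unit_iso[OF M.module_axioms \<phi>(2,3)]] .
    then show "y \<in> orbit h" unfolding orbit_def mem_Collect_eq \<phi>(4) by (intro exI conjI) auto
  qed
qed

text \<open>The elements of the orbit under \<open>proj_auts\<close> have the same coordinate \<open>\<pi>(h) \<noteq> 0\<close>, so multiples of two of
them can agree only for equal factors.\<close>

lemma unit_multiples_disjoint:
  assumes "nontorsion h" "x \<in> (\<lambda>\<phi>. \<phi> h) ` proj_auts" "y \<in> (\<lambda>\<phi>. \<phi> h) ` proj_auts" "x \<noteq> y"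
  shows "unit_multiples x \<inter> unit_multiples y = {}"
proof (rule ccontr)
  assume "\<not> ?thesis"
  then obtain a b where ab: "a \<in> carrier Z" "a 1 \<noteq> 0" "b \<in> carrier Z" "a \<odot> x = b \<odot> y" by (auto simp: unit_multiples_def)
  have hc: "h \<in> carrier H" "\<pi> h \<noteq> \<zero>\<^bsub>Z\<^esub>" using assms(1) by (auto simp: nontorsion_iff)
  have c: "x \<in> carrier H" "y \<in> carrier H" "\<pi> x = \<pi> h" "\<pi> y = \<pi> h" using assms(2,3) proj_autsD(3,4) hc(1) by auto
  have "a \<otimes>\<^bsub>Z\<^esub> \<pi> h = b \<otimes>\<^bsub>Z\<^esub> \<pi> h" using pi_smult[OF ab(1) c(1)] pi_smult[OF ab(3) c(2)] ab(4) c by simp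
  then have "a = b" using Z.m_rcancel[OF hc(2), of a b] ab hc by simp
  then have "a \<odot> x = a \<odot> y" using ab(4) by simp
  then have "x = y" using inj_onD[OF lin_isoD(2)[OF smult_unit_iso[OF M.module_axioms ab(1,2)]]] c by simp
  then show False using assms(4) by simp
qed

text \<open>The orbit is made up of \<open>card proj_auts / card (Aut_incl p s)\<close> sets of unit multiples, and all of them have
the same measure because the quotients by their elements are isomorphic.\<close>

lemma orbit_measure:
  assumes s: "s \<in> exact_seqs p" and m: "middle s = H"
  shows "orbit (incl s \<one>\<^bsub>Z\<^esub>) \<in> sets \<mu>"
    "measure \<mu> (orbit (incl s \<one>\<^bsub>Z\<^esub>)) =
       real (card proj_auts) * (1 - 1 / real p) * (1 / (real (card (Aut_incl p s)) * real (order (quot s))))"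
proof -
  define h where "h = incl s \<one>\<^bsub>Z\<^esub>"
  interpret S: exact_sequence p s using s by (rule exact_sequenceI)
  have hn: "nontorsion h" using S.i_one_nontorsion m by (simp add: h_def)
  let ?X = "(\<lambda>\<phi>. \<phi> h) ` proj_auts"
  have fX: "finite ?X" using finite_proj_auts by simp
  have us: "unit_multiples x \<in> sets \<mu>" "measure \<mu> (unit_multiples x) = (1 - 1 / real p) / real (order S.G)" if x: "x \<in> ?X" for x
  proof -
    obtain \<phi> where \<phi>: "\<phi> \<in> proj_auts" "x = \<phi> h" using x by blast
    have "\<phi> \<in> lin_iso Z (middle s) H" using proj_autsD(1)[OF \<phi>(1)] m by simp
    from change_middle[OF s M.module_axioms this] obtain t where t: "(s, t) \<in> seq_iso_rel p" "middle t = H"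
      "quot t = S.G" "incl t = (\<lambda>a. \<phi> (S.i a))" by blast
    have te: "t \<in> exact_seqs p" using t(1) by (simp add: seq_iso_rel_def)
    have "incl t \<one>\<^bsub>Z\<^esub> = x" using t(4) \<phi>(2) by (simp add: h_def)
    then show "unit_multiples x \<in> sets \<mu>" "measure \<mu> (unit_multiples x) = (1 - 1 / real p) / real (order S.G)"
      using unit_multiples_measure[OF te t(2)] t(3) by simp_all
  qed
  show "orbit (incl s \<one>\<^bsub>Z\<^esub>) \<in> sets \<mu>"
    unfolding h_def[symmetric] orbit_eq[OF hn] by (rule sets.finite_UN[OF fX us(1)])
  have "measure \<mu> (orbit h) = (\<Sum>x\<in>?X. measure \<mu> (unit_multiples x))"
    unfolding orbit_eq[OF hn]
    by (rule haar.finite_measure_finite_Union[OF fX])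
      (use us(1) unit_multiples_disjoint[OF hn] in \<open>auto simp: disjoint_family_on_def\<close>)
  also have "\<dots> = (\<Sum>x\<in>?X. (1 - 1 / real p) / real (order S.G))" by (rule sum.cong[OF refl us(2)])
  also have "\<dots> = real (card ?X) * ((1 - 1 / real p) / real (order S.G))" by simp
  also have "real (card ?X) = real (card proj_auts) / real (card (Aut_incl p s))"
    using stabilizer_count[OF s m] S.card_Aut_incl_pos by (simp add: h_def)
  finally show "measure \<mu> (orbit (incl s \<one>\<^bsub>Z\<^esub>)) =
       real (card proj_auts) * (1 - 1 / real p) * (1 / (real (card (Aut_incl p s)) * real (order (quot s))))"
    by (simp add: h_def)
qed

end

section \<open>The walk from a module of rank one\<close>

text \<open>Since the measures are positive and summable, the index set is countable.\<close>

lemma (in prob_space) measure_disjoint_infsum: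
  assumes meas: "\<And>i. i \<in> I \<Longrightarrow> A i \<in> events" and disj: "disjoint_family_on A I"
    and pos: "\<And>i. i \<in> I \<Longrightarrow> 0 < prob (A i)"
  shows "(\<lambda>i. prob (A i)) summable_on I" "(\<Sum>\<^sub>\<infinity>i\<in>I. prob (A i)) = prob (\<Union>i\<in>I. A i)"
proof -
  let ?f = "\<lambda>i. prob (A i)"
  have bound: "sum ?f F \<le> 1" if F: "F \<subseteq> I" "finite F" for F
  proof -
    have "sum ?f F = prob (\<Union>i\<in>F. A i)"
      by (rule finite_measure_finite_Union[symmetric])
        (use F meas disjoint_family_on_mono[OF F(1) disj] in auto)
    then show ?thesis using prob_le_1 by simp
  qed
  show s: "?f summable_on I"
    by (rule nonneg_bdd_above_summable_on) (use bound in \<open>auto intro!: bdd_aboveI[of _ 1]\<close>)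
  have "{i \<in> I. ?f i \<noteq> 0} = I" using pos by force
  then have c: "countable I" using summable_countable_real[OF s] by simp
  have abs: "Infinite_Set_Sum.abs_summable_on ?f I"
    unfolding abs_summable_equivalent[symmetric] using s by (rule summable_on_iff_abs_summable_on_real[THEN iffD1])
  have "emeasure M (\<Union>i\<in>I. A i) = (\<integral>\<^sup>+i. emeasure M (A i) \<partial>count_space I)"
    by (rule emeasure_UN_countable[OF meas c disj])
  also have "\<dots> = (\<integral>\<^sup>+i. ennreal (?f i) \<partial>count_space I)" by (simp add: emeasure_eq_measure)
  also have "\<dots> = ennreal (infsetsum ?f I)" by (rule nn_integral_conv_infsetsum[OF abs]) simp
  also have "infsetsum ?f I = infsum ?f I" by (rule infsetsum_infsum[OF abs])
  finally have "ennreal (prob (\<Union>i\<in>I. A i)) = ennreal (infsum ?f I)" by (simp add: emeasure_eq_measure)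
  moreover have "0 \<le> infsum ?f I" by (rule infsum_nonneg) simp
  ultimately show "infsum ?f I = prob (\<Union>i\<in>I. A i)" by (simp add: ennreal_inj)
qed

context rank1_module begin

lemma same_start_seq_iso:
  assumes s: "s \<in> exact_seqs p" "middle s = H" and t: "t \<in> exact_seqs p" "middle t = H"
    and eq: "incl s \<one>\<^bsub>Z\<^esub> = incl t \<one>\<^bsub>Z\<^esub>"
  shows "(s, t) \<in> seq_iso_rel p"
proof -
  have "incl s a = incl t a" if a: "a \<in> carrier Z" for a
    using exact_sequence.i_eq[OF exact_sequenceI[OF s(1)] a] exact_sequence.i_eq[OF exact_sequenceI[OF t(1)] a]
      s(2) t(2) eq by simp
  then show ?thesis unfolding seq_iso_iff using s t by (intro conjI bexI[of _ "\<lambda>x. x"]) (auto intro: lin_iso_id)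
qed

text \<open>The images of \<open>1\<close> under the inclusions with target \<open>H\<close> that belong to the edge.\<close>

definition starts where "starts d = {incl s \<one>\<^bsub>Z\<^esub> | s. s \<in> d \<and> middle s = H}"

lemma starts_eq_orbit:
  assumes d: "d \<in> edges p" and s: "s \<in> d" "middle s = H"
  shows "starts d = orbit (incl s \<one>\<^bsub>Z\<^esub>)"
proof
  note m = edge_member[OF d s(1)]
  show "starts d \<subseteq> orbit (incl s \<one>\<^bsub>Z\<^esub>)"
  proof
    fix x assume "x \<in> starts d"
    then obtain t where t: "t \<in> d" "middle t = H" "x = incl t \<one>\<^bsub>Z\<^esub>" by (auto simp: starts_def)
    have "(s, t) \<in> seq_iso_rel p" using t(1) m(3) by blast
    then obtain \<phi> where \<phi>: "\<phi> \<in> lin_iso Z H H" "\<forall>a\<in>carrier Z. \<phi> (incl s a) = incl t a"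
      unfolding seq_iso_iff using s(2) t(2) by auto
    have "x = \<phi> (incl s \<one>\<^bsub>Z\<^esub>)" using \<phi>(2) t(3) by simp
    then show "x \<in> orbit (incl s \<one>\<^bsub>Z\<^esub>)" unfolding orbit_def using \<phi>(1) by blast
  qed
  show "orbit (incl s \<one>\<^bsub>Z\<^esub>) \<subseteq> starts d"
  proof
    fix x assume "x \<in> orbit (incl s \<one>\<^bsub>Z\<^esub>)"
    then obtain \<phi> where \<phi>: "\<phi> \<in> lin_iso Z (middle s) H" "x = \<phi> (incl s \<one>\<^bsub>Z\<^esub>)" using s(2) by (auto simp: orbit_def)
    from change_middle[OF m(1) M.module_axioms \<phi>(1)] obtain t where
      t: "(s, t) \<in> seq_iso_rel p" "middle t = H" "incl t = (\<lambda>a. \<phi> (incl s a))" by blast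
    have "t \<in> d" using t(1) m(3) by blast
    then show "x \<in> starts d" unfolding starts_def mem_Collect_eq
      by (intro exI[of _ t]) (use t(2,3) \<phi>(2) in simp)
  qed
qed

definition edge_const :: real where "edge_const = real (card proj_auts) * (1 - 1 / real p)"

lemma edge_const_pos: "0 < edge_const"
  using card_proj_auts_pos p_gt_1 by (simp add: edge_const_def)

lemma starts_measure:
  assumes d: "d \<in> edges p" and s: "s \<in> d" "middle s = H"
  shows "starts d \<in> sets \<mu>" "measure \<mu> (starts d) = edge_const * edge_weight p d"
  using orbit_measure[OF edge_member(1)[OF d s(1)] s(2)] starts_eq_orbit[OF d s] edge_weight_eq[OF d s(1)]
  by (simp_all add: edge_const_def)

lemma starts_disjoint:
  assumes "d \<in> edges p" "d' \<in> edges p" "d \<noteq> d'"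
  shows "starts d \<inter> starts d' = {}"
proof (rule ccontr)
  assume "\<not> ?thesis"
  then obtain s t where s: "s \<in> d" "middle s = H" and t: "t \<in> d'" "middle t = H" and eq: "incl s \<one>\<^bsub>Z\<^esub> = incl t \<one>\<^bsub>Z\<^esub>"
    by (auto simp: starts_def)
  have "(s, t) \<in> seq_iso_rel p"
    by (rule same_start_seq_iso[OF edge_member(1)[OF assms(1) s(1)] s(2) edge_member(1)[OF assms(2) t(1)] t(2) eq])
  then have "t \<in> d" using edge_member(3)[OF assms(1) s(1)] by blast
  then show False using edges_disjoint[OF assms(1,2) _ t(1)] assms(3) by blast
qed

text \<open>The translates of the torsion part by the multiples \<open>j e\<close> are disjoint, and there are arbitrarily many of
them; so the torsion part has measure zero.\<close>

lemma nontorsion_measure: "{x. nontorsion x} \<in> sets \<mu>" "measure \<mu> {x. nontorsion x} = 1"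
proof -
  let ?N = "{x. nontorsion x}"
  have Nc: "?N \<subseteq> carrier H" by (auto simp: nontorsion_def)
  show N: "?N \<in> sets \<mu>"
  proof (rule haar_openI[OF Nc])
    fix x assume "x \<in> ?N"
    then have x: "x \<in> carrier H" "\<pi> x \<noteq> \<zero>\<^bsub>Z\<^esub>" by (auto simp: nontorsion_iff)
    then obtain n where n: "\<pi> x n \<noteq> 0" by (auto simp: Z_zero)
    have "pcoset x (max n k) \<subseteq> ?N"
    proof
      fix y assume "y \<in> pcoset x (max n k)"
      then have y: "y \<in> carrier H" "\<pi> y (max n k) = \<pi> x (max n k)" using pcoset_fine[OF x(1)] by auto
      have "\<pi> y n = \<pi> x n" using y Z_compat[OF pi_closed[OF y(1)], of n "max n k"] Z_compat[OF pi_closed[OF x(1)], of n "max n k"] by simp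
      then have "\<pi> y \<noteq> \<zero>\<^bsub>Z\<^esub>" using n by (auto simp: Z_zero)
      then show "y \<in> ?N" using y by (simp add: nontorsion_iff)
    qed
    then show "\<exists>n. pcoset x n \<subseteq> ?N" ..
  qed
  have T: "T = space \<mu> - ?N" by (auto simp: T_def nontorsion_iff space_haar)
  then have Ts: "T \<in> sets \<mu>" using N by auto
  have "real m * measure \<mu> T \<le> 1" for m :: nat
  proof -
    let ?X = "(\<lambda>j. pint (int j) \<odot> e) ` {..<m}"
    have pj: "\<pi> (pint (int j) \<odot> e) = pint (int j)" for j by (simp add: pi_smult)
    have "inj_on (\<lambda>j. pint (int j) \<odot> e) {..<m}"
    proof (rule inj_onI)
      fix i j assume "pint (int i) \<odot> e = pint (int j) \<odot> e"
      then have "pint (int i) = pint (int j)" using pj by metis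
      then have "int i = int j" by (rule pint_inj)
      then show "i = j" by simp
    qed
    then have "card ?X = m" by (simp add: card_image)
    moreover have "measure \<mu> (\<Union>x\<in>?X. (\<lambda>z. x \<oplus> z) ` T) = real (card ?X) * measure \<mu> T"
    proof (rule haar_tiling[OF _ _ Ts])
      fix x y assume xy: "x \<in> ?X" "y \<in> ?X" "x \<noteq> y"
      then obtain i j where ij: "x = pint (int i) \<odot> e" "y = pint (int j) \<odot> e" by auto
      show "(\<lambda>z. x \<oplus> z) ` T \<inter> (\<lambda>z. y \<oplus> z) ` T = {}"
      proof (rule ccontr)
        assume "\<not> ?thesis"
        then obtain t t' where t: "t \<in> T" "t' \<in> T" "x \<oplus> t = y \<oplus> t'" by auto
        then have "\<pi> (x \<oplus> t) = \<pi> (y \<oplus> t')" by simp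
        then have "pint (int i) = pint (int j)" unfolding ij using t(1,2) by (simp add: pi_comp)
        then show False using xy(3) ij by simp
      qed
    qed auto
    ultimately show ?thesis using haar.prob_le_1 by metis
  qed
  then have "measure \<mu> T \<le> 0"
    by (metis linorder_not_le measure_nonneg ex_less_of_nat_mult)
  then have "measure \<mu> T = 0" using measure_nonneg[of \<mu> T] by simp
  moreover have "measure \<mu> T = 1 - measure \<mu> ?N" unfolding T by (rule haar.prob_compl[OF N])
  ultimately show "measure \<mu> ?N = 1" by simp
qed

text \<open>A group isomorphic to the quotient by \<open>x\<close> gives an exact sequence, provided that \<open>x\<close> is not a torsion
element. For a torsion element the quotient would be infinite: its exponent \<open>p ^ n\<close> would make \<open>p ^ n e\<close>
a multiple of \<open>x\<close> and hence a torsion element.\<close>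

lemma quotient_iso_iff:
  assumes G: "G \<in> pgroups p" and x: "x \<in> carrier H"
  shows "add_monoid H Mod gen_submodule Z H {x} \<cong> G \<longleftrightarrow>
    (\<exists>s\<in>exact_seqs p. middle s = H \<and> incl s \<one>\<^bsub>Z\<^esub> = x \<and> quot s \<cong> G)"
proof
  let ?N = "gen_submodule Z H {x}"
  interpret G: comm_group G using pgroupD(1)[OF G] .
  have sub: "subgroup ?N (add_monoid H)"
    using gen_submodule_is_submodule[of "{x}"] x by (auto dest: submodule.axioms(1))
  interpret N: normal ?N "add_monoid H" by (rule comm_group.subgroup_imp_normal[OF M.a_comm_group sub])
  assume "add_monoid H Mod ?N \<cong> G"
  then obtain f where f: "f \<in> iso (add_monoid H Mod ?N) G" by (auto simp: is_iso_def)
  then have fh: "f \<in> hom (add_monoid H Mod ?N) G" and fi: "inj_on f (carrier (add_monoid H Mod ?N))"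
    and fs: "f ` carrier (add_monoid H Mod ?N) = carrier G" by (auto simp: iso_iff)
  define q where "q y = f (?N #>\<^bsub>add_monoid H\<^esub> y)" for y
  have cosc: "?N #>\<^bsub>add_monoid H\<^esub> y \<in> carrier (add_monoid H Mod ?N)" if "y \<in> carrier H" for y
    using that N.r_coset_hom_Mod by (auto simp: hom_def)
  have qh: "q \<in> hom (add_monoid H) G"
    using hom_compose[OF N.r_coset_hom_Mod fh] by (simp add: q_def[abs_def] o_def)
  have one: "f ?N = \<one>\<^bsub>G\<^esub>"
    using hom_one[OF fh N.factorgroup_is_group G.is_group] by (simp add: FactGroup_def)
  have Nc: "?N \<in> carrier (add_monoid H Mod ?N)"
    using group.is_monoid[OF N.factorgroup_is_group] monoid.one_closed by (fastforce simp: FactGroup_def)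
  have ker: "q y = \<one>\<^bsub>G\<^esub> \<longleftrightarrow> y \<in> (\<lambda>a. a \<odot> x) ` carrier Z" if y: "y \<in> carrier H" for y
  proof -
    have "q y = \<one>\<^bsub>G\<^esub> \<longleftrightarrow> ?N #>\<^bsub>add_monoid H\<^esub> y = ?N"
      unfolding q_def one[symmetric] using inj_on_eq_iff[OF fi cosc[OF y] Nc] .
    also have "\<dots> \<longleftrightarrow> y \<in> ?N"
      using group.coset_join1[OF M.a_group _ _ sub] group.coset_join2[OF M.a_group _ sub] y by auto
    finally show ?thesis using gen_singleton[OF x] by simp
  qed
  have qs: "q ` carrier H = carrier G"
  proof -
    have "carrier (add_monoid H Mod ?N) = (\<lambda>y. ?N #>\<^bsub>add_monoid H\<^esub> y) ` carrier H"
      by (auto simp: FactGroup_def RCOSETS_def)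
    then show ?thesis unfolding fs[symmetric] q_def by (simp add: image_image)
  qed
  have nx: "nontorsion x"
  proof -
    let ?n = "multiplicity p (order G)"
    note ql = hom_pgroup_linear[OF M.module_axioms G qh]
    have "pint (int p ^ ?n) ?n = 0" by (simp add: pint_def)
    then have "q (pint (int p ^ ?n) \<odot> e) = \<one>\<^bsub>G\<^esub>" using lin_homD(3)[OF ql, of "pint (int p ^ ?n)" e] by simp
    then obtain a where a: "a \<in> carrier Z" "pint (int p ^ ?n) \<odot> e = a \<odot> x" using ker[of "pint (int p ^ ?n) \<odot> e"] by auto
    have "pint (int p ^ ?n) = a \<otimes>\<^bsub>Z\<^esub> \<pi> x"
      using pi_smult[OF a(1) x] pi_smult[of "pint (int p ^ ?n)" e] a(2) by simp
    then have "\<pi> x \<noteq> \<zero>\<^bsub>Z\<^esub>" using pint_pow_nz[of ?n] a(1) by auto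
    then show ?thesis using x by (simp add: nontorsion_iff)
  qed
  have "\<lparr>middle = H, incl = (\<lambda>a. a \<odot> x), quot = G, proj = q\<rparr> \<in> exact_seqs p"
    by (rule exact_seqI[OF M.module_axioms G smult_lin_hom[OF x] qh nontorsion_smult_inj[OF nx] qs ker])
  then show "\<exists>s\<in>exact_seqs p. middle s = H \<and> incl s \<one>\<^bsub>Z\<^esub> = x \<and> quot s \<cong> G"
    by (rule bexI[rotated]) (use x in simp)
next
  assume "\<exists>s\<in>exact_seqs p. middle s = H \<and> incl s \<one>\<^bsub>Z\<^esub> = x \<and> quot s \<cong> G"
  then obtain s where s: "s \<in> exact_seqs p" "middle s = H" "incl s \<one>\<^bsub>Z\<^esub> = x" "quot s \<cong> G" by blast
  interpret S: exact_sequence p s using s(1) by (rule exact_sequenceI)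
  have gh: "group_hom (add_monoid H) S.G S.q"
    unfolding group_hom_def group_hom_axioms_def using M.a_group S.G.is_group S.q_hom s(2) by simp
  have "kernel (add_monoid H) S.G S.q = gen_submodule Z H {x}"
  proof -
    have "S.i ` carrier Z = kernel (add_monoid S.H) S.G S.q" using s(1) by (simp add: exact_seqs_def)
    then show ?thesis using S.i_image s(2,3) by simp
  qed
  then have "add_monoid H Mod gen_submodule Z H {x} \<cong> S.G"
    using group_hom.FactGroup_iso[OF gh] S.q_surj s(2) by simp
  then show "add_monoid H Mod gen_submodule Z H {x} \<cong> G" using s(4) by (rule iso_trans)
qed

end

context padic begin

text \<open>The sets \<open>starts d\<close> for the edges \<open>d\<close> at \<open>H\<close> partition the nontorsion elements, and the measure of each is
\<open>edge_const\<close> times the weight. The quotient by a nontorsion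
element is isomorphic to \<open>G\<close> exactly if its edge ends at \<open>G\<close>.\<close>

lemma walk_from_module:
  assumes h: "h \<in> X1 p"
  defines "E \<equiv> {e \<in> edges p. Inr h \<in> edge_ends p e}"
  shows "edge_weight p summable_on E" "0 < infsum (edge_weight p) E"
    "g \<in> X0 p \<Longrightarrow> prob_d p (rep h) (rep g) =
       infsum (edge_weight p) {e \<in> edges p. edge_ends p e = {Inl g, Inr h}} / infsum (edge_weight p) E"
proof -
  note r = rank1D[OF X1_rep(2)[OF h]]
  obtain \<pi> e0 k where sp: "padic_module.rank1_split p (rep h) \<pi> e0 k"
    using padic_module.rank1_split_exists[OF r(4,2,3)] by blast
  interpret rank1_module p "rep h" \<pi> e0 k
    by (intro rank1_module.intro r(4) rank1_module_axioms.intro sp)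
  have EI: "\<exists>s. s \<in> e \<and> middle s = rep h" if e: "e \<in> E" for e
  proof -
    have e': "e \<in> edges p" "Inr h \<in> edge_ends p e" using e by (auto simp: E_def)
    note t = edge_rep(1)[OF e'(1)]
    have "zmod_isomorphic p (middle (rep e)) (rep h)" using Inr_edge_ends_iff[OF h e'(1) t] e'(2) by simp
    then obtain \<phi> where "\<phi> \<in> lin_iso Z (middle (rep e)) (rep h)" by (auto simp: zmod_isomorphic_def)
    from change_middle[OF edge_rep(2)[OF e'(1)] r(1) this] obtain s where
      "(rep e, s) \<in> seq_iso_rel p" "middle s = rep h" by blast
    then show ?thesis using edge_rep(3)[OF e'(1)] by blast
  qed
  have IE: "e \<in> E" if "e \<in> edges p" "s \<in> e" "middle s = rep h" for e s
    using Inr_edge_ends_iff[OF h that(1,2)] that lin_iso_id by (fastforce simp: E_def zmod_isomorphic_def)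
  have EX: "\<exists>e\<in>edges p. s \<in> e" if "s \<in> exact_seqs p" for s
    using that equiv_class_self[OF seq_iso_equiv that] unfolding edges_eq by (blast intro: quotientI)
  have st: "starts e \<in> sets \<mu>" "measure \<mu> (starts e) = edge_const * edge_weight p e" if "e \<in> E" for e
    using EI[OF that] starts_measure that by (auto simp: E_def)
  have sums: "edge_weight p summable_on E'" "edge_const * infsum (edge_weight p) E' = measure \<mu> (\<Union>e\<in>E'. starts e)"
    if E': "E' \<subseteq> E" for E'
  proof -
    have 1: "starts e \<in> sets \<mu>" "0 < measure \<mu> (starts e)" if "e \<in> E'" for e
      using st[of e] that E' edge_const_pos edge_weight_pos[of e] by (auto simp: E_def)
    have 2: "disjoint_family_on starts E'"
      unfolding disjoint_family_on_def using starts_disjoint E' by (auto simp: E_def)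
    note m = haar.measure_disjoint_infsum[OF 1(1) 2 1(2)]
    have "(\<lambda>e. edge_const * edge_weight p e) summable_on E'"
      using m(1) st(2) E' by (subst summable_on_cong[of _ _ "\<lambda>e. measure \<mu> (starts e)"]) auto
    then show "edge_weight p summable_on E'"
      using summable_on_cmult_right'[of edge_const "edge_weight p" E'] edge_const_pos by simp
    have "edge_const * infsum (edge_weight p) E' = (\<Sum>\<^sub>\<infinity>e\<in>E'. edge_const * edge_weight p e)"
      by (rule infsum_cmult_right'[symmetric])
    also have "\<dots> = (\<Sum>\<^sub>\<infinity>e\<in>E'. measure \<mu> (starts e))"
      by (rule infsum_cong) (use st(2) E' in auto)
    finally show "edge_const * infsum (edge_weight p) E' = measure \<mu> (\<Union>e\<in>E'. starts e)" using m(2) by simp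
  qed
  show "edge_weight p summable_on E" by (rule sums(1)) simp
  have "(\<Union>e\<in>E. starts e) = {x. nontorsion x}"
  proof
    show "(\<Union>e\<in>E. starts e) \<subseteq> {x. nontorsion x}"
    proof (rule UN_least, rule subsetI)
      fix e x assume "e \<in> E" "x \<in> starts e"
      then obtain s where s: "e \<in> edges p" "s \<in> e" "middle s = rep h" "x = incl s \<one>\<^bsub>Z\<^esub>" by (auto simp: E_def starts_def)
      show "x \<in> {x. nontorsion x}"
        using exact_sequence.i_one_nontorsion[OF exact_sequenceI[OF edge_member(1)[OF s(1,2)]]] s(3,4) by simp
    qed
    show "{x. nontorsion x} \<subseteq> (\<Union>e\<in>E. starts e)"
    proof
      fix x assume "x \<in> {x. nontorsion x}"
      then obtain s where s: "s \<in> exact_seqs p" "middle s = rep h" "incl s \<one>\<^bsub>Z\<^esub> = x" using exact_seq_through by blast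
      obtain e where "e \<in> edges p" "s \<in> e" using EX[OF s(1)] by blast
      then show "x \<in> (\<Union>e\<in>E. starts e)" using IE[of e s] s by (auto simp: starts_def)
    qed
  qed
  then have tot: "edge_const * infsum (edge_weight p) E = 1" using sums(2)[OF order_refl] nontorsion_measure(2) by simp
  then show pos: "0 < infsum (edge_weight p) E" using edge_const_pos by (metis zero_less_mult_pos zero_less_one)
  assume g: "g \<in> X0 p"
  note G = X0_rep(2)[OF g]
  let ?E = "{e \<in> edges p. edge_ends p e = {Inl g, Inr h}}"
  have sub: "?E \<subseteq> E" by (auto simp: E_def)
  have "{x \<in> carrier (rep h). add_monoid (rep h) Mod gen_submodule Z (rep h) {x} \<cong> rep g} = (\<Union>e\<in>?E. starts e)"
  proof
    show "{x \<in> carrier (rep h). add_monoid (rep h) Mod gen_submodule Z (rep h) {x} \<cong> rep g} \<subseteq> (\<Union>e\<in>?E. starts e)"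
    proof
      fix x assume "x \<in> {x \<in> carrier (rep h). add_monoid (rep h) Mod gen_submodule Z (rep h) {x} \<cong> rep g}"
      then obtain s where s: "s \<in> exact_seqs p" "middle s = rep h" "incl s \<one>\<^bsub>Z\<^esub> = x" "quot s \<cong> rep g"
        using quotient_iso_iff[OF G] by blast
      obtain e where e: "e \<in> edges p" "s \<in> e" using EX[OF s(1)] by blast
      have "Inl g \<in> edge_ends p e" using Inl_edge_ends_iff[OF g e] s(4) by simp
      moreover have "Inr h \<in> edge_ends p e" using IE[OF e s(2)] by (simp add: E_def)
      ultimately have "e \<in> ?E" using edge_ends_pair_iff[OF e(1)] e(1) by simp
      then show "x \<in> (\<Union>e\<in>?E. starts e)" using e(2) s(2,3) by (auto simp: starts_def)
    qed
    show "(\<Union>e\<in>?E. starts e) \<subseteq> {x \<in> carrier (rep h). add_monoid (rep h) Mod gen_submodule Z (rep h) {x} \<cong> rep g}"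
    proof (rule UN_least, rule subsetI)
      fix e x assume e: "e \<in> ?E" and "x \<in> starts e"
      then obtain s where s: "e \<in> edges p" "s \<in> e" "middle s = rep h" "x = incl s \<one>\<^bsub>Z\<^esub>" by (auto simp: starts_def)
      have "quot s \<cong> rep g" using Inl_edge_ends_iff[OF g s(1,2)] e by simp
      moreover have "s \<in> exact_seqs p" by (rule edge_member(1)[OF s(1,2)])
      moreover have "x \<in> carrier (rep h)"
        using exact_seq_incl[OF edge_member(1)[OF s(1,2)], of "\<one>\<^bsub>Z\<^esub>"] s(3,4) by simp
      ultimately show "x \<in> {x \<in> carrier (rep h). add_monoid (rep h) Mod gen_submodule Z (rep h) {x} \<cong> rep g}"
        using quotient_iso_iff[OF G] s(3,4) by blast
    qed
  qed
  then have "prob_d p (rep h) (rep g) = edge_const * infsum (edge_weight p) ?E"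
    using sums(2)[OF sub] by (simp add: prob_d_def)
  also have "\<dots> = infsum (edge_weight p) ?E / infsum (edge_weight p) E"
    using tot pos by (simp add: field_simps)
  finally show "prob_d p (rep h) (rep g) = infsum (edge_weight p) ?E / infsum (edge_weight p) E" .
qed

end

theorem lemma0p3:
  fixes p :: nat
  assumes "prime p"
  shows "is_random_walk_on (X0 p <+> X1 p) (edges p) (edge_ends p) (edge_weight p) (transition p)"
proof -
  interpret padic p by (rule padic.intro) fact
  show ?thesis
    unfolding is_random_walk_on_def
  proof (intro conjI ballI)
    fix e assume e: "e \<in> edges p"
    show "edge_ends p e \<subseteq> X0 p <+> X1 p" using edge_ends_subset[OF e] .
    show "0 < edge_weight p e" using edge_weight_pos[OF e] .
  next
    fix v assume v: "v \<in> X0 p <+> X1 p"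
    have "edge_weight p summable_on {e \<in> edges p. v \<in> edge_ends p e} \<and> 0 < infsum (edge_weight p) {e \<in> edges p. v \<in> edge_ends p e}"
    proof (cases v)
      case (Inl g)
      then have "g \<in> X0 p" using v by auto
      then show ?thesis using walk_from_group(1,2)[of g] Inl by (simp add: summable_on_finite)
    next
      case (Inr h)
      then have "h \<in> X1 p" using v by auto
      then show ?thesis using walk_from_module(1,2)[of h] Inr by simp
    qed
    then show "edge_weight p summable_on {e \<in> edges p. v \<in> edge_ends p e}"
      "0 < infsum (edge_weight p) {e \<in> edges p. v \<in> edge_ends p e}" by auto
  next
    fix v u assume v: "v \<in> X0 p <+> X1 p" and u: "u \<in> X0 p <+> X1 p"
    show "transition p v u = infsum (edge_weight p) {e \<in> edges p. edge_ends p e = {v, u}} /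
      infsum (edge_weight p) {e \<in> edges p. v \<in> edge_ends p e}"
    proof (cases v)
      case v': (Inl g)
      then have g: "g \<in> X0 p" using v by auto
      show ?thesis
      proof (cases u)
        case (Inl g')
        then have "{e \<in> edges p. edge_ends p e = {v, u}} = {}" using v' by (auto simp: edge_ends_def)
        then have 0: "infsum (edge_weight p) {e \<in> edges p. edge_ends p e = {v, u}} = 0" by (simp only: infsum_empty)
        show ?thesis unfolding 0 using Inl v' by simp
      next
        case (Inr h)
        then have h: "h \<in> X1 p" using u by auto
        have "finite {e \<in> edges p. edge_ends p e = {Inl g, Inr h}}"
          by (rule finite_subset[OF _ walk_from_group(1)[OF g]]) auto
        then show ?thesis using walk_from_group(1)[OF g] walk_from_group(3)[OF g h] Inr v' by simp
      qed
    next
      case v': (Inr h)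
      then have h: "h \<in> X1 p" using v by auto
      show ?thesis
      proof (cases u)
        case (Inr h')
        then have "{e \<in> edges p. edge_ends p e = {v, u}} = {}" using v' by (auto simp: edge_ends_def)
        then have 0: "infsum (edge_weight p) {e \<in> edges p. edge_ends p e = {v, u}} = 0" by (simp only: infsum_empty)
        show ?thesis unfolding 0 using Inr v' by simp
      next
        case (Inl g)
        then have g: "g \<in> X0 p" using u by auto
        show ?thesis using walk_from_module(3)[OF h g] Inl v' by (simp add: insert_commute)
      qed
    qed
  qed
qed

end
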